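(* Let $\psi_0$ be a two-sided Lévy process with paths of bounded variation satisfying Hypothesis A, Hypothesis B and Assumption B(II). Then almost surely, for every $y\in\mathbb{R}$, $a(y)=y$ if and only if $y$ is a Lagrangian regular point. Hence $\mathcal{A}_0$ is exactly the set of Lagrangian regular points.
   Context: A two-sided Lévy process $\psi_0=(\psi_0(x))_{x\in\mathbb{R}}$ has càdlàg paths, $\psi_0(0)=0$, and stationary independent increments indexed by $\mathbb{R}$; standing convention: bounded variation $\psi_0$ has zero drift coefficient. Hypothesis A: a.s. $\lim_{|x|\to\infty}x^{-2}\psi_0(x)=0$. Hypothesis B: a.s. $\limsup_{h\downarrow0}h^{-2}\psi_0(h)=+\infty$ and $\liminf_{h\downarrow0}h^{-2}\psi_0(h)=-\infty$. Assumption B(II): for every $b>0,s>0$, with $T'=\inf\{x\ge0:\psi_0(x)+bx-\tfrac12x^2\le -s\}$, on $\{T'<\infty\}$ one has a.s. $\psi_0(T')+bT'-\tfrac12T'^2<s$. For $x\in\mathbb{R}$, $a(x)$ is the largest maximizer of $y\mapsto\psi_0(y)\vee\psi_0(y-)-\tfrac12(y-x)^2$; $\mathcal{A}:=\overline{\{a(x):x\in\mathbb{R}\}}$; $\mathcal{A}_0:=\overline{\{x:a(x)=x\}}$. A Lagrangian regular point is a point of $\mathcal{A}$ that is isolated in $\mathcal{A}$ neither from the left nor from the right. *)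

theory Defs
  imports "HOL-Probability.Probability"
begin

definition left_lim :: "(real \<Rightarrow> real) \<Rightarrow> real \<Rightarrow> real" where
  "left_lim f y = Lim (at_left y) f"

definition cadlag :: "(real \<Rightarrow> real) \<Rightarrow> bool" where
  "cadlag f \<longleftrightarrow> (\<forall>x. continuous (at_right x) f \<and> (\<exists>l. (f \<longlongrightarrow> l) (at_left x)))"

definition locally_bounded_variation :: "(real \<Rightarrow> real) \<Rightarrow> bool" where
  "locally_bounded_variation f \<longleftrightarrow>
     (\<forall>u v. \<exists>B. \<forall>(t::nat \<Rightarrow> real) n. t 0 = u \<longrightarrow> t n = v \<longrightarrow>
        (\<forall>i<n. t i \<le> t (Suc i)) \<longrightarrow> (\<Sum>i<n. \<bar>f (t (Suc i)) - f (t i)\<bar>) \<le> B)"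

definition jump :: "(real \<Rightarrow> real) \<Rightarrow> real \<Rightarrow> real" where
  "jump f s = f s - left_lim f s"

definition zero_drift :: "(real \<Rightarrow> real) \<Rightarrow> bool" where
  "zero_drift f \<longleftrightarrow>
     (\<forall>x\<ge>0. (jump f has_sum f x) {0<..x}) \<and>
     (\<forall>x<0. (jump f has_sum (- f x)) {x<..0})"

definition two_sided_levy :: "'a measure \<Rightarrow> ('a \<Rightarrow> real \<Rightarrow> real) \<Rightarrow> bool" where
  "two_sided_levy M X \<longleftrightarrow>
     prob_space M \<and>
     (\<forall>x. (\<lambda>\<omega>. X \<omega> x) \<in> borel_measurable M) \<and>
     (\<forall>\<omega>\<in>space M. X \<omega> 0 = 0 \<and> cadlag (X \<omega>)) \<and>
     (\<forall>(t::nat \<Rightarrow> real) n. (\<forall>i<n. t i < t (Suc i)) \<longrightarrow>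
        prob_space.indep_vars M (\<lambda>_. borel) (\<lambda>i \<omega>. X \<omega> (t (Suc i)) - X \<omega> (t i)) {..<n}) \<and>
     (\<forall>t h. distr M borel (\<lambda>\<omega>. X \<omega> (t + h) - X \<omega> t) = distr M borel (\<lambda>\<omega>. X \<omega> h - X \<omega> 0))"

definition hypA :: "(real \<Rightarrow> real) \<Rightarrow> bool" where
  "hypA f \<longleftrightarrow> ((\<lambda>x. f x / x\<^sup>2) \<longlongrightarrow> 0) at_infinity"

definition hypB :: "(real \<Rightarrow> real) \<Rightarrow> bool" where
  "hypB f \<longleftrightarrow> Limsup (at_right 0) (\<lambda>h. ereal (f h / h\<^sup>2)) = \<infinity> \<and>
                Liminf (at_right 0) (\<lambda>h. ereal (f h / h\<^sup>2)) = - \<infinity>"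

definition assumption_BII :: "'a measure \<Rightarrow> ('a \<Rightarrow> real \<Rightarrow> real) \<Rightarrow> bool" where
  "assumption_BII M X \<longleftrightarrow>
     (\<forall>b>0. \<forall>s>0. AE \<omega> in M.
        let S = {x. x \<ge> 0 \<and> X \<omega> x + b * x - x\<^sup>2 / 2 \<le> - s}; T = Inf S in
        S \<noteq> {} \<longrightarrow> X \<omega> T + b * T - T\<^sup>2 / 2 < s)"

definition a_map :: "(real \<Rightarrow> real) \<Rightarrow> real \<Rightarrow> real" where
  "a_map f x = (GREATEST y. \<forall>z. max (f z) (left_lim f z) - (z - x)\<^sup>2 / 2
                                 \<le> max (f y) (left_lim f y) - (y - x)\<^sup>2 / 2)"

definition calA :: "(real \<Rightarrow> real) \<Rightarrow> real set" where
  "calA f = closure (range (a_map f))"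

definition calA0 :: "(real \<Rightarrow> real) \<Rightarrow> real set" where
  "calA0 f = closure {x. a_map f x = x}"

definition lagrangian_regular :: "(real \<Rightarrow> real) \<Rightarrow> real \<Rightarrow> bool" where
  "lagrangian_regular f y \<longleftrightarrow> y \<in> calA f \<and>
     (\<forall>e>0. \<exists>z\<in>calA f. y - e < z \<and> z < y) \<and>
     (\<forall>e>0. \<exists>z\<in>calA f. y < z \<and> z < y + e)"

end

theory Submission
  imports Defs
begin

text \<open>Call y a maximizer for x if it maximizes the upper path (the larger of value and left limit)
minus the parabola centred at x. If x > y, the path falls at a positive rate to the right of y, and
if x < y, to the left. A zero-drift path of bounded variation has a.s. no continuity point with this
property, and no such points accumulate on their steep side: run from that side they are strict
records of a walk with negative drift, which are locally finite in number and occur at jumps. On the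
other hand, by Hypothesis B the path leaves each jump, in both directions, above every parabola, so
a maximizer y for x = y is a continuity point. It is the only maximizer for y: another one, s, would
be a jump, and y would be the first time after s (in the direction from s to y) at which the path plus
\<open>(t - s)\<^sup>2 / 2\<close> regains its level before the jump, a stopping time from which the path a.s. climbs above the
parabola required. These three facts give the equivalence by monotonicity and closedness of the
maximizer relation.

The stopping times are replaced by dyadic walks, so that only independence of finitely many
increments is needed: if each of the events \<open>A\<^sub>k\<close> (a record, a jump) is followed by another one with
conditional probability at most 1/2, the expected number of them is bounded uniformly in the mesh,
and the probability that one of them has an atypical future is a bounded multiple of the probability
of that future.\<close>

section \<open>Walks of processes with stationary independent increments\<close>

text \<open>The exceptional points range over uncountably many times, so the event that one exists
  need not be measurable. It is never measured: every bad path lies in all but finitely many of a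
  sequence of events built from grid values, each of probability at most \<epsilon>. Jumps and
  records are counted on a window so short that the bound 1/2 holds for every fine mesh; rational
  translations of the window then cover the line. A grid point is only near the jump or record that
  it stands for, so conditions on the future carry some slack (half of the slope, or a constant
  \<open>q\<close>), fixed before the mesh tends to 0. Everything is proved in one time direction:
  reversal exchanges the two limits at a jump, and the estimates at the origin become those of the
  negated process. This is why both halves of Hypothesis B occur, although it speaks of positive
  times only. Zero drift enters through stationarity: the origin is as good as a grid time chosen
  uniformly, and a sum of jumps rises steeply from few of those.\<close>

text \<open>Path regularity and the value at 0 are left out, so that the class is stable under
  translation, sign change and time reversal. The increment laws \<open>\<nu>\<close> are a
  parameter in order to express that two processes share them.\<close>

definition stat_indep :: "'a measure \<Rightarrow> ('a \<Rightarrow> real \<Rightarrow> real) \<Rightarrow> (real \<Rightarrow> real measure) \<Rightarrow> bool" where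
  "stat_indep M X \<nu> \<longleftrightarrow>
     prob_space M \<and>
     (\<forall>t. (\<lambda>\<omega>. X \<omega> t) \<in> borel_measurable M) \<and>
     (\<forall>(t::nat \<Rightarrow> real) n. (\<forall>i<n. t i < t (Suc i)) \<longrightarrow>
        prob_space.indep_vars M (\<lambda>_. borel) (\<lambda>i \<omega>. X \<omega> (t (Suc i)) - X \<omega> (t i)) {..<n}) \<and>
     (\<forall>t. \<forall>h>0. distr M borel (\<lambda>\<omega>. X \<omega> (t + h) - X \<omega> t) = \<nu> h)"

lemma stat_indep_levy:
  assumes "two_sided_levy M X"
  shows "stat_indep M X (\<lambda>h. distr M borel (\<lambda>\<omega>. X \<omega> h - X \<omega> 0))"
  using assms unfolding two_sided_levy_def stat_indep_def by blast

lemma stat_indep_prob_space: "stat_indep M X \<nu> \<Longrightarrow> prob_space M"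
  by (simp add: stat_indep_def)

lemma stat_indep_measurable: "stat_indep M X \<nu> \<Longrightarrow> (\<lambda>\<omega>. X \<omega> t) \<in> borel_measurable M"
  by (simp add: stat_indep_def)

lemma stat_indep_shift:
  assumes "stat_indep M X \<nu>"
  shows "stat_indep M (\<lambda>\<omega> t. X \<omega> (p + t)) \<nu>"
proof -
  have "prob_space.indep_vars M (\<lambda>_. borel)
      (\<lambda>i \<omega>. X \<omega> (p + t (Suc i)) - X \<omega> (p + t i)) {..<n}"
    if "\<forall>i<n. t i < t (Suc i)" for t :: "nat \<Rightarrow> real" and n
    using assms that unfolding stat_indep_def
    by (elim conjE) (drule spec[of _ "\<lambda>i. p + t i"], auto)
  moreover have "distr M borel (\<lambda>\<omega>. X \<omega> (p + (t + h)) - X \<omega> (p + t)) = \<nu> h" if "h > 0" for t h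
    using assms that unfolding stat_indep_def by (metis add.assoc)
  ultimately show ?thesis
    using assms by (auto simp: stat_indep_def)
qed

lemma stat_indep_uminus:
  assumes "stat_indep M X \<nu>"
  shows "stat_indep M (\<lambda>\<omega> t. - X \<omega> t) (\<lambda>h. distr (\<nu> h) borel uminus)"
proof -
  interpret prob_space M using assms by (rule stat_indep_prob_space)
  note [measurable] = stat_indep_measurable[OF assms]
  have "indep_vars (\<lambda>_. borel) (\<lambda>i \<omega>. - X \<omega> (t (Suc i)) - - X \<omega> (t i)) {..<n}"
    if "\<forall>i<n. t i < t (Suc i)" for t :: "nat \<Rightarrow> real" and n
  proof -
    have "indep_vars (\<lambda>_. borel) (\<lambda>i \<omega>. X \<omega> (t (Suc i)) - X \<omega> (t i)) {..<n}"
      using assms that unfolding stat_indep_def by blast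
    then have "indep_vars (\<lambda>_. borel) (\<lambda>i \<omega>. - (X \<omega> (t (Suc i)) - X \<omega> (t i))) {..<n}"
      by (rule indep_vars_compose2) auto
    then show ?thesis by simp
  qed
  moreover have "distr M borel (\<lambda>\<omega>. - X \<omega> (t + h) - - X \<omega> t) = distr (\<nu> h) borel uminus"
    if "h > 0" for t h
  proof -
    have "\<nu> h = distr M borel (\<lambda>\<omega>. X \<omega> (t + h) - X \<omega> t)"
      using assms that by (simp add: stat_indep_def)
    then show ?thesis
      by (simp add: distr_distr comp_def)
  qed
  ultimately show ?thesis
    using prob_space_axioms by (auto simp: stat_indep_def)
qed

lemma (in prob_space) indep_sets_reindex:
  assumes "inj_on r I" and "indep_sets F (r ` I)"
  shows "indep_sets (\<lambda>i. F (r i)) I"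
proof (rule indep_setsI)
  show "F (r i) \<subseteq> events" if "i \<in> I" for i
    using assms(2) that by (auto simp: indep_sets_def)
next
  fix A J assume J: "J \<noteq> {}" "J \<subseteq> I" "finite J" and A: "\<forall>j\<in>J. A j \<in> F (r j)"
  define B where "B k = A (inv_into J r k)" for k
  have inj: "inj_on r J" using assms(1) J(2) by (rule inj_on_subset)
  have B: "B (r j) = A j" if "j \<in> J" for j using inj that by (simp add: B_def)
  have "prob (\<Inter>k\<in>r ` J. B k) = (\<Prod>k\<in>r ` J. prob (B k))"
    by (rule indep_setsD[OF assms(2)]) (use J A B in auto)
  then show "prob (\<Inter>j\<in>J. A j) = (\<Prod>j\<in>J. prob (A j))"
    using B by (simp add: prod.reindex[OF inj] cong: INF_cong)
qed

text \<open>Reading a partition backwards permutes the increments and changes their signs. The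
  resulting laws are those of \<open>stat_indep_uminus\<close>, so walks of the reversed process are
  distributed like walks of the negated one.\<close>

lemma stat_indep_reverse:
  assumes "stat_indep M X \<nu>"
  shows "stat_indep M (\<lambda>\<omega> t. X \<omega> (p - t)) (\<lambda>h. distr (\<nu> h) borel uminus)"
proof -
  interpret prob_space M using assms by (rule stat_indep_prob_space)
  note [measurable] = stat_indep_measurable[OF assms]
  have "indep_vars (\<lambda>_. borel) (\<lambda>i \<omega>. X \<omega> (p - t (Suc i)) - X \<omega> (p - t i)) {..<n}"
    if t: "\<forall>i<n. t i < t (Suc i)" for t :: "nat \<Rightarrow> real" and n
  proof -
    \<comment> \<open>\<open>s\<close> lists the reflected partition in increasing order;
      \<open>r\<close> below undoes the reversal of the indices.\<close>
    define s where "s i = p - t (n - i)" for i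
    have "s i < s (Suc i)" if "i < n" for i
      using t[rule_format, of "n - Suc i"] that by (simp add: s_def Suc_diff_Suc)
    then have "indep_vars (\<lambda>_. borel) (\<lambda>i \<omega>. X \<omega> (s (Suc i)) - X \<omega> (s i)) {..<n}"
      using assms unfolding stat_indep_def by blast
    then have "indep_vars (\<lambda>_. borel) (\<lambda>i \<omega>. - (X \<omega> (s (Suc i)) - X \<omega> (s i))) {..<n}"
      by (rule indep_vars_compose2) auto
    then have *: "indep_vars (\<lambda>_. borel) (\<lambda>i \<omega>. X \<omega> (s i) - X \<omega> (s (Suc i))) {..<n}"
      by simp
    define r where "r i = n - Suc i" for i
    have "indep_vars (\<lambda>_. borel) (\<lambda>i \<omega>. X \<omega> (s (r i)) - X \<omega> (s (Suc (r i)))) {..<n}"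
    proof (cases "n = 0")
      case False
      have inj: "inj_on r {..<n}" by (auto simp: inj_on_def r_def)
      have im: "r ` {..<n} \<subseteq> {..<n}" using False by (auto simp: r_def)
      have "indep_sets (\<lambda>i. {(\<lambda>\<omega>. X \<omega> (s i) - X \<omega> (s (Suc i))) -` A \<inter> space M |A. A \<in> sets borel}) {..<n}"
        using * unfolding indep_vars_def2 by blast
      then have "indep_sets (\<lambda>i. {(\<lambda>\<omega>. X \<omega> (s i) - X \<omega> (s (Suc i))) -` A \<inter> space M |A. A \<in> sets borel}) (r ` {..<n})"
        using im by (meson indep_sets_mono_index)
      then have "indep_sets (\<lambda>i. {(\<lambda>\<omega>. X \<omega> (s (r i)) - X \<omega> (s (Suc (r i)))) -` A \<inter> space M |A. A \<in> sets borel}) {..<n}"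
        by (rule indep_sets_reindex[OF inj])
      then show ?thesis unfolding indep_vars_def2 by auto
    qed (simp add: indep_vars_def2 indep_sets_def)
    moreover have "X \<omega> (s (r i)) - X \<omega> (s (Suc (r i))) = X \<omega> (p - t (Suc i)) - X \<omega> (p - t i)"
      if "i < n" for i \<omega>
    proof -
      have "n - r i = Suc i" "n - Suc (r i) = i" using that by (auto simp: r_def)
      then show ?thesis by (simp add: s_def)
    qed
    ultimately show ?thesis
      by (subst (asm) indep_vars_cong[where J="{..<n}"]) auto
  qed
  moreover have "distr M borel (\<lambda>\<omega>. X \<omega> (p - (t + h)) - X \<omega> (p - t)) = distr (\<nu> h) borel uminus"
    if "h > 0" for t h
  proof -
    have "\<nu> h = distr M borel (\<lambda>\<omega>. X \<omega> ((p - (t + h)) + h) - X \<omega> (p - (t + h)))"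
      using assms that unfolding stat_indep_def by metis
    then have *: "\<nu> h = distr M borel (\<lambda>\<omega>. X \<omega> (p - t) - X \<omega> (p - (t + h)))"
      by (simp add: algebra_simps)
    show ?thesis
      unfolding * by (simp add: distr_distr comp_def)
  qed
  ultimately show ?thesis
    using prob_space_axioms by (auto simp: stat_indep_def)
qed

section \<open>Walks sampled along a grid\<close>

definition walk :: "(real \<Rightarrow> real) \<Rightarrow> real \<Rightarrow> nat \<Rightarrow> real" where
  "walk f \<delta> i = f (real i * \<delta>) - f 0"

abbreviation seqM :: "(nat \<Rightarrow> real) measure" where
  "seqM \<equiv> PiM UNIV (\<lambda>_. borel)"

lemma measurable_partial_sums: "(\<lambda>d i. \<Sum>j<i. d j) \<in> seqM \<rightarrow>\<^sub>M seqM"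
  by (intro measurable_PiM_single') auto

lemma increments_indep:
  assumes X: "stat_indep M X \<nu>" and "\<delta> > 0"
  shows "prob_space.indep_vars M (\<lambda>_. borel)
    (\<lambda>i \<omega>. X \<omega> (s + real (Suc i) * \<delta>) - X \<omega> (s + real i * \<delta>)) (UNIV::nat set)"
proof -
  interpret prob_space M using X by (rule stat_indep_prob_space)
  note [measurable] = stat_indep_measurable[OF X]
  define D where "D = (\<lambda>i \<omega>. X \<omega> (s + real (Suc i) * \<delta>) - X \<omega> (s + real i * \<delta>))"
  have ind: "indep_vars (\<lambda>_. borel) D {..<n}" for n
  proof -
    have "\<forall>i<n. s + real i * \<delta> < s + real (Suc i) * \<delta>" using \<open>\<delta> > 0\<close> by (simp add: field_simps)
    then show ?thesis
      using X unfolding stat_indep_def D_def by (elim conjE) (drule spec[of _ "\<lambda>i. s + real i * \<delta>"], auto)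
  qed
  have "indep_sets (\<lambda>i. {D i -` A \<inter> space M |A. A \<in> sets borel}) UNIV"
  proof (subst indep_sets_finite_index_sets, intro allI impI)
    fix J :: "nat set" assume "finite J" and "J \<noteq> {}"
    then have "J \<subseteq> {..<Suc (Max J)}" by (auto simp: less_Suc_eq_le)
    then show "indep_sets (\<lambda>i. {D i -` A \<inter> space M |A. A \<in> sets borel}) J"
      using ind[of "Suc (Max J)"] unfolding indep_vars_def2 by (meson indep_sets_mono_index)
  qed
  moreover have "random_variable borel (D i)" for i unfolding D_def by measurable
  ultimately show ?thesis unfolding indep_vars_def2 D_def[symmetric] by auto
qed

text \<open>The right-hand side contains neither the process nor the starting time \<open>s\<close>.
  Both the restart of a walk at a later grid time and the passage from one process to another rest
  on this. A \<open>walk\<close> subtracts its value at 0 for the same reason: it becomes a function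
  of the increments alone.\<close>

lemma increments_law:
  assumes X: "stat_indep M X \<nu>" and "\<delta> > 0"
  shows "distr M seqM (\<lambda>\<omega> i. X \<omega> (s + real (Suc i) * \<delta>) - X \<omega> (s + real i * \<delta>)) = PiM UNIV (\<lambda>_. \<nu> \<delta>)"
proof -
  interpret prob_space M using X by (rule stat_indep_prob_space)
  note [measurable] = stat_indep_measurable[OF X]
  have "distr M borel (\<lambda>\<omega>. X \<omega> (s + real (Suc i) * \<delta>) - X \<omega> (s + real i * \<delta>)) = \<nu> \<delta>" for i
  proof -
    have "distr M borel (\<lambda>\<omega>. X \<omega> ((s + real i * \<delta>) + \<delta>) - X \<omega> (s + real i * \<delta>)) = \<nu> \<delta>"
      using X \<open>\<delta> > 0\<close> unfolding stat_indep_def by blast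
    then show ?thesis by (simp add: algebra_simps)
  qed
  moreover have "(\<lambda>\<omega>. X \<omega> (s + real (Suc i) * \<delta>) - X \<omega> (s + real i * \<delta>)) \<in> borel_measurable M" for i
    by measurable
  ultimately show ?thesis
    using increments_indep[OF X \<open>\<delta> > 0\<close>, of s]
    by (subst (asm) indep_vars_iff_distr_eq_PiM) (auto simp: restrict_UNIV)
qed

lemma measurable_walk:
  assumes X: "stat_indep M X \<nu>"
  shows "(\<lambda>\<omega>. walk (X \<omega>) \<delta>) \<in> M \<rightarrow>\<^sub>M seqM"
proof -
  note [measurable] = stat_indep_measurable[OF X]
  show ?thesis
    by (intro measurable_PiM_single') (auto simp: walk_def)
qed

text \<open>The event on the future is transported to a second process with the same one-step laws: the
reversed paths of a Levy process are left-continuous, but their walks have the law of walks of a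
right-continuous process.\<close>

lemma walk_markov:
  assumes X: "stat_indep M X \<nu>" and Y: "stat_indep M Y \<nu>" and "\<delta> > 0"
    and P[measurable]: "Measurable.pred seqM P" and Q[measurable]: "Measurable.pred seqM Q"
    and loc: "\<And>v w. (\<And>i. i \<le> k \<Longrightarrow> v i = w i) \<Longrightarrow> P v \<longleftrightarrow> P w"
  shows "measure M {\<omega> \<in> space M. P (walk (X \<omega>) \<delta>) \<and> Q (\<lambda>i. walk (X \<omega>) \<delta> (k + i) - walk (X \<omega>) \<delta> k)} =
    measure M {\<omega> \<in> space M. P (walk (X \<omega>) \<delta>)} * measure M {\<omega> \<in> space M. Q (walk (Y \<omega>) \<delta>)}"
proof -
  interpret prob_space M using X by (rule stat_indep_prob_space)
  note [measurable] = stat_indep_measurable[OF X] stat_indep_measurable[OF Y] measurable_partial_sums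
  define D where "D = (\<lambda>i \<omega>. X \<omega> (real (Suc i) * \<delta>) - X \<omega> (real i * \<delta>))"
  define S where "S = (\<lambda>(d :: nat \<Rightarrow> real) i. \<Sum>j<i. d j)"
  have [measurable]: "S \<in> seqM \<rightarrow>\<^sub>M seqM" unfolding S_def by measurable
  have S_walk: "S (\<lambda>i. X \<omega> (s + real (Suc i) * \<delta>) - X \<omega> (s + real i * \<delta>)) j = X \<omega> (s + real j * \<delta>) - X \<omega> s"
    for X :: "'a \<Rightarrow> real \<Rightarrow> real" and s \<omega> j
    unfolding S_def by (subst sum_lessThan_telescope[of "\<lambda>i. X \<omega> (s + real i * \<delta>)"]) simp
  have wD: "walk (X \<omega>) \<delta> = S (\<lambda>i. D i \<omega>)" for \<omega>
    using S_walk[of X \<omega> 0] by (auto simp: fun_eq_iff walk_def D_def)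
  have ind: "indep_vars (\<lambda>_. borel) D UNIV"
    using increments_indep[OF X \<open>\<delta> > 0\<close>, of 0] by (simp add: D_def)
  \<comment> \<open>By \<open>loc\<close> the event \<open>P\<close> depends on the increments below
    \<open>k\<close> only, so the later ones may be replaced by 0; \<open>e2\<close> moves the index
    \<open>k\<close> to the origin.\<close>
  define e1 where "e1 = (\<lambda>(d :: nat \<Rightarrow> real) i. if i < k then d i else 0)"
  define e2 where "e2 = (\<lambda>(d :: nat \<Rightarrow> real) i. d (k + i))"
  have [measurable]: "e1 \<in> PiM {..<k} (\<lambda>_. borel) \<rightarrow>\<^sub>M seqM"
  proof -
    have "(\<lambda>d. if i < k then d i else 0) \<in> PiM {..<k} (\<lambda>_. borel) \<rightarrow>\<^sub>M (borel :: real measure)" for i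
      by (cases "i < k") auto
    then show ?thesis unfolding e1_def by (intro measurable_PiM_single') auto
  qed
  have [measurable]: "e2 \<in> PiM {k..} (\<lambda>_. borel) \<rightarrow>\<^sub>M seqM"
    unfolding e2_def by (intro measurable_PiM_single') auto
  have iv: "indep_var (PiM {..<k} (\<lambda>_. borel)) (\<lambda>\<omega>. restrict (\<lambda>i. D i \<omega>) {..<k})
      (PiM {k..} (\<lambda>_. borel)) (\<lambda>\<omega>. restrict (\<lambda>i. D i \<omega>) {k..})"
    by (rule indep_var_restrict[OF ind]) auto
  define A where "A = {d \<in> space (PiM {..<k} (\<lambda>_. borel)). P (S (e1 d))}"
  define B where "B = {d \<in> space (PiM {k..} (\<lambda>_. borel)). Q (S (e2 d))}"
  have AB: "A \<in> sets (PiM {..<k} (\<lambda>_. borel))" "B \<in> sets (PiM {k..} (\<lambda>_. borel))"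
    unfolding A_def B_def by measurable
  have PA: "P (walk (X \<omega>) \<delta>) \<longleftrightarrow> restrict (\<lambda>i. D i \<omega>) {..<k} \<in> A" for \<omega>
  proof -
    have "P (S (\<lambda>i. D i \<omega>)) \<longleftrightarrow> P (S (e1 (restrict (\<lambda>i. D i \<omega>) {..<k})))"
      by (rule loc) (auto simp: S_def e1_def intro!: sum.cong)
    then show ?thesis by (simp add: A_def space_PiM wD)
  qed
  have e2D: "e2 (restrict (\<lambda>i. D i \<omega>) {k..}) = (\<lambda>i. X \<omega> (real k * \<delta> + real (Suc i) * \<delta>) - X \<omega> (real k * \<delta> + real i * \<delta>))" for \<omega>
    by (auto simp: e2_def D_def fun_eq_iff algebra_simps)
  have QB': "Q (S (e2 (restrict (\<lambda>i. D i \<omega>) {k..}))) \<longleftrightarrow> restrict (\<lambda>i. D i \<omega>) {k..} \<in> B" for \<omega>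
    by (simp add: B_def space_PiM)
  have "S (e2 (restrict (\<lambda>i. D i \<omega>) {k..})) = (\<lambda>i. walk (X \<omega>) \<delta> (k + i) - walk (X \<omega>) \<delta> k)" for \<omega>
    unfolding e2D using S_walk[of X \<omega> "real k * \<delta>"] by (auto simp: fun_eq_iff walk_def algebra_simps)
  then have QB: "Q (\<lambda>i. walk (X \<omega>) \<delta> (k + i) - walk (X \<omega>) \<delta> k) \<longleftrightarrow> restrict (\<lambda>i. D i \<omega>) {k..} \<in> B" for \<omega>
    using QB' by simp
  \<comment> \<open>Stated for any process with these laws and any start, because it is applied to
    \<open>X\<close> restarted at time \<open>k * \<delta>\<close> and to \<open>Y\<close> at time
    0.\<close>
  have law: "prob {\<omega> \<in> space M. Q (S (\<lambda>i. X \<omega> (s + real (Suc i) * \<delta>) - X \<omega> (s + real i * \<delta>)))}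
      = measure (PiM UNIV (\<lambda>_. \<nu> \<delta>)) {d \<in> space seqM. Q (S d)}" if X: "stat_indep M X \<nu>" for X s
  proof -
    note [measurable] = stat_indep_measurable[OF X]
    have [measurable]: "(\<lambda>\<omega> i. X \<omega> (s + real (Suc i) * \<delta>) - X \<omega> (s + real i * \<delta>)) \<in> M \<rightarrow>\<^sub>M seqM"
      by (intro measurable_PiM_single') auto
    have QS: "{d \<in> space seqM. Q (S d)} \<in> sets seqM"
      by measurable
    show ?thesis
      unfolding increments_law[OF X \<open>\<delta> > 0\<close>, of s, symmetric]
      by (subst measure_distr[OF _ QS], measurable)
        (auto intro!: arg_cong[where f=prob] simp: space_PiM simp del: of_nat_Suc)
  qed
  have "prob {\<omega> \<in> space M. P (walk (X \<omega>) \<delta>) \<and> Q (\<lambda>i. walk (X \<omega>) \<delta> (k + i) - walk (X \<omega>) \<delta> k)} =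
    prob ((\<lambda>\<omega>. (restrict (\<lambda>i. D i \<omega>) {..<k}, restrict (\<lambda>i. D i \<omega>) {k..})) -` (A \<times> B) \<inter> space M)"
    by (rule arg_cong[where f=prob]) (auto simp: PA QB)
  also have "\<dots> = prob ((\<lambda>\<omega>. restrict (\<lambda>i. D i \<omega>) {..<k}) -` A \<inter> space M) *
      prob ((\<lambda>\<omega>. restrict (\<lambda>i. D i \<omega>) {k..}) -` B \<inter> space M)"
    by (rule indep_varD[OF iv AB])
  also have "(\<lambda>\<omega>. restrict (\<lambda>i. D i \<omega>) {..<k}) -` A \<inter> space M = {\<omega> \<in> space M. P (walk (X \<omega>) \<delta>)}"
    by (auto simp: PA)
  also have "(\<lambda>\<omega>. restrict (\<lambda>i. D i \<omega>) {k..}) -` B \<inter> space M =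
      {\<omega> \<in> space M. Q (S (\<lambda>i. X \<omega> (real k * \<delta> + real (Suc i) * \<delta>) - X \<omega> (real k * \<delta> + real i * \<delta>)))}"
    by (auto simp: QB'[symmetric] e2D)
  also have "prob \<dots> = prob {\<omega> \<in> space M. Q (walk (Y \<omega>) \<delta>)}"
  proof -
    have "walk (Y \<omega>) \<delta> = S (\<lambda>i. Y \<omega> (0 + real (Suc i) * \<delta>) - Y \<omega> (0 + real i * \<delta>))" for \<omega>
      unfolding fun_eq_iff S_walk by (simp add: walk_def)
    then show ?thesis
      unfolding law[OF X] law[OF Y, of 0, symmetric] by simp
  qed
  finally show ?thesis .
qed

section \<open>Exceptional points through dyadic walks\<close>

lemma (in prob_space) prob_liminf_le:
  fixes E :: "nat \<Rightarrow> 'a set"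
  assumes E[measurable]: "\<And>N. E N \<in> events" and le: "\<And>N. prob (E N) \<le> \<epsilon>"
  shows "prob {\<omega> \<in> space M. \<forall>\<^sub>F N in sequentially. \<omega> \<in> E N} \<le> \<epsilon>"
proof -
  define L where "L m = (\<Inter>N\<in>{m..}. E N)" for m
  have L[measurable]: "L m \<in> events" for m unfolding L_def by measurable
  have "incseq L" by (auto simp: L_def incseq_def)
  then have "(\<lambda>m. prob (L m)) \<longlonglongrightarrow> prob (\<Union>m. L m)"
    using L by (intro finite_Lim_measure_incseq) auto
  moreover have "prob (L m) \<le> \<epsilon>" for m
  proof -
    have "prob (L m) \<le> prob (E m)" by (rule finite_measure_mono) (auto simp: L_def)
    then show ?thesis using le[of m] by simp
  qed
  ultimately have "prob (\<Union>m. L m) \<le> \<epsilon>"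
    by (meson LIMSEQ_le_const2)
  moreover have "{\<omega> \<in> space M. \<forall>\<^sub>F N in sequentially. \<omega> \<in> E N} = (\<Union>m. L m)"
    using sets.sets_into_space[OF E] by (fastforce simp: L_def eventually_sequentially)
  ultimately show ?thesis by simp
qed

text \<open>\<open>bad\<close> is an arbitrary predicate. It is enclosed in liminf events of measure
  at most 1 / (n + 1), whose intersection over n is a null set.\<close>

lemma (in prob_space) AE_not_if_liminf_small:
  assumes "\<And>\<epsilon>. \<epsilon> > 0 \<Longrightarrow> \<exists>E::nat \<Rightarrow> 'a set. (\<forall>N. E N \<in> events \<and> prob (E N) \<le> \<epsilon>) \<and>
     (\<forall>\<omega>\<in>space M. bad \<omega> \<longrightarrow> (\<forall>\<^sub>F N in sequentially. \<omega> \<in> E N))"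
  shows "AE \<omega> in M. \<not> bad \<omega>"
proof -
  have "\<exists>L. L \<in> events \<and> prob L \<le> 1 / real (Suc n) \<and> {\<omega> \<in> space M. bad \<omega>} \<subseteq> L" for n
  proof -
    obtain E :: "nat \<Rightarrow> 'a set" where [measurable]: "\<And>N. E N \<in> events"
      and E: "\<And>N. prob (E N) \<le> 1 / real (Suc n)"
        "\<forall>\<omega>\<in>space M. bad \<omega> \<longrightarrow> (\<forall>\<^sub>F N in sequentially. \<omega> \<in> E N)"
      using assms[of "1 / real (Suc n)"] by auto
    have "prob {\<omega> \<in> space M. \<forall>\<^sub>F N in sequentially. \<omega> \<in> E N} \<le> 1 / real (Suc n)"
      by (rule prob_liminf_le) (use E in auto)
    moreover have "{\<omega> \<in> space M. \<forall>\<^sub>F N in sequentially. \<omega> \<in> E N} \<in> events"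
      unfolding eventually_sequentially by measurable
    ultimately show ?thesis using E(2) by blast
  qed
  then obtain L where L[measurable]: "\<And>n. L n \<in> events"
    and L': "\<And>n. prob (L n) \<le> 1 / real (Suc n)" "\<And>n. {\<omega> \<in> space M. bad \<omega>} \<subseteq> L n"
    by metis
  have "prob (\<Inter>n. L n) \<le> 1 / real (Suc n)" for n
  proof -
    have "prob (\<Inter>n. L n) \<le> prob (L n)" by (rule finite_measure_mono) auto
    then show ?thesis using L'(1)[of n] by simp
  qed
  then have "prob (\<Inter>n. L n) \<le> 0"
    by (intro LIMSEQ_le_const[OF LIMSEQ_inverse_real_of_nat]) (auto simp: inverse_eq_divide)
  then have "(\<Inter>n. L n) \<in> null_sets M"
    using L by (auto simp: null_sets_def emeasure_eq_measure measure_le_0_iff)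
  then show ?thesis
    by (rule AE_I') (use L'(2) in auto)
qed

text \<open>Read \<open>A i\<close> as an event at time \<open>i\<close> and \<open>B i\<close> as
  its being followed by another one. By \<open>half\<close>, at least half of each
  \<open>prob (A i)\<close> belongs to occurrences that are not followed, and every outcome has at
  most \<open>c\<close> of those.\<close>

lemma (in prob_space) expected_count_le:
  assumes "finite I" and [measurable]: "\<And>i. i \<in> I \<Longrightarrow> A i \<in> events" "\<And>i. i \<in> I \<Longrightarrow> B i \<in> events"
    and half: "\<And>i. i \<in> I \<Longrightarrow> prob (A i \<inter> B i) \<le> prob (A i) / 2"
    and count: "\<And>\<omega>. \<omega> \<in> space M \<Longrightarrow> card {i \<in> I. \<omega> \<in> A i - B i} \<le> c"
  shows "(\<Sum>i\<in>I. prob (A i)) \<le> 2 * real c"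
proof -
  have int: "integrable M (indicator (A i - B i) :: 'a \<Rightarrow> real)" if "i \<in> I" for i
    using that by (intro integrable_real_indicator) (auto simp: less_top[symmetric])
  have "expectation (\<lambda>\<omega>. \<Sum>i\<in>I. indicator (A i - B i) \<omega> :: real) = (\<Sum>i\<in>I. expectation (indicator (A i - B i)))"
    by (rule Bochner_Integration.integral_sum) (rule int)
  also have "\<dots> = (\<Sum>i\<in>I. prob (A i - B i))"
    by (intro sum.cong refl) simp
  finally have "(\<Sum>i\<in>I. prob (A i - B i)) = expectation (\<lambda>\<omega>. \<Sum>i\<in>I. indicator (A i - B i) \<omega>)" ..
  also have "\<dots> \<le> expectation (\<lambda>\<omega>. real c)"
  proof (rule integral_mono)
    show "(\<Sum>i\<in>I. indicator (A i - B i) \<omega>) \<le> real c" if "\<omega> \<in> space M" for \<omega>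
    proof -
      have "(\<Sum>i\<in>I. indicator (A i - B i) \<omega>) = real (card {i \<in> I. \<omega> \<in> A i - B i})"
        using \<open>finite I\<close> by (simp add: indicator_def sum.If_cases Int_def)
      then show ?thesis using count[OF that] by simp
    qed
  qed (auto intro!: Bochner_Integration.integrable_sum int)
  also have "\<dots> = real c" by (simp add: prob_space)
  finally have 1: "(\<Sum>i\<in>I. prob (A i - B i)) \<le> real c" .
  have "prob (A i) / 2 \<le> prob (A i - B i)" if "i \<in> I" for i
    using finite_measure_Diff'[of "A i" "B i"] half[OF that] that by simp
  then have "(\<Sum>i\<in>I. prob (A i) / 2) \<le> (\<Sum>i\<in>I. prob (A i - B i))"
    by (rule sum_mono)
  with 1 show ?thesis by (simp add: sum_divide_distrib[symmetric])
qed

text \<open>Used with \<open>p i\<close> the probability of a past and \<open>q\<close> a bound for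
  that of a future: the union bound then costs the expected number of past events instead of the
  number of indices.\<close>

lemma (in prob_space) prob_UN_le_sum_mult:
  assumes "finite I" and "\<And>i. i \<in> I \<Longrightarrow> A i \<in> events"
    and "\<And>i. i \<in> I \<Longrightarrow> prob (A i) \<le> p i * q" and "(\<Sum>i\<in>I. p i) \<le> c" and "0 \<le> q"
  shows "prob (\<Union>i\<in>I. A i) \<le> c * q"
proof -
  have "prob (\<Union>i\<in>I. A i) \<le> (\<Sum>i\<in>I. prob (A i))"
    using assms by (intro finite_measure_subadditive_finite) auto
  also have "\<dots> \<le> (\<Sum>i\<in>I. p i * q)" using assms by (intro sum_mono)
  also have "\<dots> = (\<Sum>i\<in>I. p i) * q" by (simp add: sum_distrib_right)
  also have "\<dots> \<le> c * q" using assms by (intro mult_right_mono)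
  finally show ?thesis .
qed

section \<open>Dyadic grids\<close>

lemma eventually_dyadic_between:
  fixes u v :: real
  assumes "0 \<le> u" "u < v"
  shows "\<forall>\<^sub>F N in sequentially. \<exists>i::nat. u < real i / 2 ^ N \<and> real i / 2 ^ N < v"
proof -
  have "(\<lambda>N. (1/2)^N :: real) \<longlonglongrightarrow> 0" by (rule LIMSEQ_power_zero) simp
  then have "\<forall>\<^sub>F N in sequentially. (1/2)^N < v - u" using assms by (intro order_tendstoD) auto
  then show ?thesis
  proof eventually_elim
    case (elim N)
    define i where "i = nat (\<lfloor>u * 2 ^ N\<rfloor> + 1)"
    have i: "real i = of_int \<lfloor>u * 2 ^ N\<rfloor> + 1" using assms by (simp add: i_def)
    have "real i > u * 2 ^ N" "real i \<le> u * 2 ^ N + 1" unfolding i by linarith+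
    moreover have "1 < (v - u) * 2 ^ N" using elim by (simp add: field_simps power_divide)
    ultimately show ?case
      by (intro exI[of _ i]) (simp add: field_simps)
  qed
qed

lemma two_power_divide: "m \<le> N \<Longrightarrow> (2::real) ^ N / 2 ^ m = real (2 ^ (N - m))"
  by (simp only: of_nat_power of_nat_numeral) (simp add: power_diff)

lemma tendsto_dyadicI:
  fixes k :: "nat \<Rightarrow> nat"
  assumes "\<forall>\<^sub>F N in sequentially. \<bar>real (k N) / 2 ^ N - y\<bar> \<le> C / 2 ^ N"
  shows "(\<lambda>N. real (k N) / 2 ^ N) \<longlonglongrightarrow> y"
proof -
  have "(\<lambda>N. C * (1/2)^N :: real) \<longlonglongrightarrow> C * 0" by (intro tendsto_intros LIMSEQ_power_zero) simp
  then have "(\<lambda>N. C / 2 ^ N :: real) \<longlonglongrightarrow> 0" by (simp add: power_divide)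
  then have "(\<lambda>N. real (k N) / 2 ^ N - y) \<longlonglongrightarrow> 0"
    by (rule Lim_null_comparison[rotated]) (use assms in simp)
  then show ?thesis by (simp add: LIM_zero_iff)
qed

text \<open>Half of the slope is spent on a drift: \<open>W z = X \<omega> z - c * z\<close> still
  approaches \<open>l - c * y\<close> strictly from below, at rate at least \<open>c\<close>. So
  close to \<open>y\<close> a fine walk has a strict record that is exceeded again within time
  \<open>1/2^m\<close>. At most one record in the window has no successor within
  \<open>1/2^m0\<close>, which bounds the expected number of records by 2 for every fine mesh;
  \<open>R\<close> then makes a successor within \<open>1/2^m\<close> as unlikely as
  desired.\<close>

lemma no_left_slope:
  assumes X: "stat_indep M X \<nu>" and Y: "stat_indep M Y \<nu>" and "c > 0"
    and R: "\<And>\<epsilon>. \<epsilon> > 0 \<Longrightarrow> \<exists>m. \<forall>N\<ge>m. measure M {\<omega> \<in> space M.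
        \<exists>i\<in>{1..2^(N-m)}. walk (Y \<omega>) (1/2^N) i > c * (real i / 2^N)} \<le> \<epsilon>"
    and m0: "\<And>N. N \<ge> m0 \<Longrightarrow> measure M {\<omega> \<in> space M.
        \<exists>i\<in>{1..2^(N-m0)}. walk (Y \<omega>) (1/2^N) i > c * (real i / 2^N)} \<le> 1/2"
  shows "AE \<omega> in M. \<not> (\<exists>y l. 0 < y \<and> y \<le> 1 / 2^m0 \<and> (X \<omega> \<longlongrightarrow> l) (at_left y) \<and>
           (\<forall>z\<in>{0..<y}. X \<omega> z \<le> l - 2 * c * (y - z)))"
proof -
  interpret prob_space M using X by (rule stat_indep_prob_space)
  note [measurable] = measurable_walk[OF X] measurable_walk[OF Y]
  define ex where "ex N m w \<longleftrightarrow> (\<exists>i\<in>{1..2^(N-m)}. w i > c * (real i / 2^N))" for N m :: nat and w :: "nat \<Rightarrow> real"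
  define rec where "rec N k w \<longleftrightarrow> (\<forall>i<k. w i - c * (real i / 2^N) < w k - c * (real k / 2^N))"
    for N k :: nat and w :: "nat \<Rightarrow> real"
  have [measurable]: "Measurable.pred seqM (ex N m)" "Measurable.pred seqM (rec N k)" for N m k
    unfolding ex_def[abs_def] rec_def[abs_def] by measurable
  define w where "w N \<omega> = walk (X \<omega>) (1/2^N)" for N \<omega>
  have [measurable]: "w N \<in> M \<rightarrow>\<^sub>M seqM" for N unfolding w_def by measurable
  have [measurable]: "(\<lambda>\<omega> i. w N \<omega> (k + i) - w N \<omega> k) \<in> M \<rightarrow>\<^sub>M seqM" for N k
    by (intro measurable_PiM_single') auto
  define A where "A N k = {\<omega> \<in> space M. rec N k (w N \<omega>)}" for N k
  define B where "B N m k = {\<omega> \<in> space M. ex N m (\<lambda>i. w N \<omega> (k + i) - w N \<omega> k)}" for N m k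
  have [measurable]: "A N k \<in> events" "B N m k \<in> events" for N m k
    unfolding A_def B_def by measurable
  have AB: "prob (A N k \<inter> B N m k) = prob (A N k) * prob {\<omega> \<in> space M. ex N m (walk (Y \<omega>) (1/2^N))}" for N m k
  proof -
    have "prob {\<omega> \<in> space M. rec N k (w N \<omega>) \<and> ex N m (\<lambda>i. w N \<omega> (k + i) - w N \<omega> k)} =
        prob (A N k) * prob {\<omega> \<in> space M. ex N m (walk (Y \<omega>) (1/2^N))}"
      unfolding A_def w_def by (rule walk_markov[OF X Y]) (auto simp: rec_def)
    moreover have "A N k \<inter> B N m k = {\<omega> \<in> space M. rec N k (w N \<omega>) \<and> ex N m (\<lambda>i. w N \<omega> (k + i) - w N \<omega> k)}"
      by (auto simp: A_def B_def)
    ultimately show ?thesis by simp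
  qed
  have count: "(\<Sum>k\<le>2^(N-m0). prob (A N k)) \<le> 2" if "N \<ge> m0" for N
  proof -
    have "(\<Sum>k\<le>2^(N-m0). prob (A N k)) \<le> 2 * real 1"
    proof (rule expected_count_le)
      show "prob (A N k \<inter> B N m0 k) \<le> prob (A N k) / 2" for k
        unfolding AB using mult_left_mono[OF m0[OF that], of "prob (A N k)"] by (simp add: ex_def)
      show "card {k \<in> {..2^(N-m0)}. \<omega> \<in> A N k - B N m0 k} \<le> 1" (is "card ?S \<le> _") for \<omega>
      proof -
        \<comment> \<open>Of two records the later one lies above the line of slope \<open>c\<close>
          through the earlier one, so the earlier one has a successor.\<close>
        have *: "\<not> k < k'" if "k \<in> ?S" "k' \<in> ?S" for k k'
        proof
          assume "k < k'"
          have "w N \<omega> (k + (k' - k)) - w N \<omega> k > c * (real (k' - k) / 2 ^ N)"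
          proof -
            have "w N \<omega> k - c * (real k / 2 ^ N) < w N \<omega> k' - c * (real k' / 2 ^ N)"
              using \<open>k < k'\<close> that by (auto simp: A_def rec_def)
            then show ?thesis
              using \<open>k < k'\<close> by (simp add: of_nat_diff diff_divide_distrib right_diff_distrib)
          qed
          moreover have "k' - k \<in> {1..2^(N-m0)}" using that \<open>k < k'\<close> by auto
          ultimately have "ex N m0 (\<lambda>i. w N \<omega> (k + i) - w N \<omega> k)" unfolding ex_def by blast
          then show False using that by (auto simp: A_def B_def)
        qed
        have "\<forall>k\<in>?S. \<forall>k'\<in>?S. k = k'"
        proof (intro ballI)
          fix k k' assume "k \<in> ?S" "k' \<in> ?S"
          then show "k = k'" using *[of k k'] *[of k' k] by linarith
        qed
        then show ?thesis
          using card_le_Suc0_iff_eq[of ?S] by simp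
      qed
    qed auto
    then show ?thesis by simp
  qed
  show ?thesis
  proof (rule AE_not_if_liminf_small)
    fix \<epsilon> :: real assume "\<epsilon> > 0"
    obtain m where m: "\<And>N. N \<ge> m \<Longrightarrow> prob {\<omega> \<in> space M. ex N m (walk (Y \<omega>) (1/2^N))} \<le> \<epsilon> / 2"
      using R[of "\<epsilon>/2"] \<open>\<epsilon> > 0\<close> unfolding ex_def by auto
    \<comment> \<open>Coarse meshes get the empty event: only large \<open>N\<close> matter, but the
      bound must hold for all of them.\<close>
    define E where "E N = (if N \<ge> max m m0 then \<Union>k\<le>2^(N-m0). A N k \<inter> B N m k else {})" for N
    have "E N \<in> events" for N by (simp add: E_def)
    moreover have "prob (E N) \<le> \<epsilon>" for N
    proof (cases "N \<ge> max m m0")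
      case True
      have "prob (A N k \<inter> B N m k) \<le> prob (A N k) * (\<epsilon> / 2)" for k
        unfolding AB using m[of N] True by (intro mult_left_mono) auto
      then have "prob (\<Union>k\<le>2^(N-m0). A N k \<inter> B N m k) \<le> 2 * (\<epsilon> / 2)"
        using True count[of N] \<open>\<epsilon> > 0\<close>
        by (intro prob_UN_le_sum_mult[where p="\<lambda>k. prob (A N k)"]) auto
      then show ?thesis using True by (simp add: E_def)
    next
      case False
      then have "E N = {}" unfolding E_def by (rule if_not_P)
      then show ?thesis using \<open>\<epsilon> > 0\<close> by simp
    qed
    moreover have "\<forall>\<^sub>F N in sequentially. \<omega> \<in> E N"
      if "\<omega> \<in> space M" and "0 < y" "y \<le> 1 / 2^m0" and lim: "(X \<omega> \<longlongrightarrow> l) (at_left y)"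
        and le: "\<And>z. z \<in> {0..<y} \<Longrightarrow> X \<omega> z \<le> l - 2 * c * (y - z)" for \<omega> y l
    proof -
      define W where "W z = X \<omega> z - c * z" for z
      have W_le: "W z \<le> l - c * y - c * (y - r)" if "0 \<le> z" "z \<le> r" "r < y" for z r
      proof -
        have "c * (y - r) \<le> c * (y - z)" using \<open>c > 0\<close> that by simp
        moreover have "X \<omega> z \<le> l - 2 * c * (y - z)" using that by (intro le) auto
        ultimately show ?thesis by (simp add: W_def algebra_simps)
      qed
      have "(W \<longlongrightarrow> l - c * y) (at_left y)"
        unfolding W_def using lim by (intro tendsto_intros)
      then have near: "\<exists>z1<y. \<forall>z. z1 < z \<and> z < y \<longrightarrow> \<beta> < W z" if "\<beta> < l - c * y" for \<beta>
        using order_tendstoD(1)[OF \<open>(W \<longlongrightarrow> l - c * y) (at_left y)\<close> that]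
        unfolding eventually_at_left_field by blast
      \<comment> \<open>\<open>r0\<close> keeps the record within \<open>1/2^m\<close> of
        \<open>y\<close>, so that its successor is in reach. Between \<open>z1\<close> and
        \<open>y\<close> the path \<open>W\<close> exceeds all its values on \<open>{0..r0}\<close>,
        and between \<open>z2\<close> and \<open>y\<close> all those on \<open>{0..r}\<close>. A
        grid point between \<open>u\<close> and \<open>r\<close> therefore forces the first maximum
        \<open>k\<close> past \<open>r0\<close>, and a grid point between \<open>max r z2\<close>
        and \<open>y\<close> exceeds that maximum.\<close>
      define r0 where "r0 = max 0 (y - 1/2^m)"
      have r0: "0 \<le> r0" "r0 < y" "y - 1/2^m \<le> r0" using \<open>0 < y\<close> by (auto simp: r0_def)
      obtain z1 where z1: "z1 < y" "\<And>z. z1 < z \<Longrightarrow> z < y \<Longrightarrow> l - c * y - c * (y - r0) < W z"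
        using near[of "l - c * y - c * (y - r0)"] r0 \<open>c > 0\<close> by auto
      define u where "u = max r0 z1"
      obtain r where r: "u < r" "r < y" using dense[of u y] r0 z1 by (auto simp: u_def)
      obtain z2 where z2: "z2 < y" "\<And>z. z2 < z \<Longrightarrow> z < y \<Longrightarrow> l - c * y - c * (y - r) < W z"
        using near[of "l - c * y - c * (y - r)"] r \<open>c > 0\<close> by auto
      have "\<forall>\<^sub>F N in sequentially. \<exists>i::nat. u < real i / 2 ^ N \<and> real i / 2 ^ N < r"
        using r r0 by (intro eventually_dyadic_between) (auto simp: u_def)
      moreover have "\<forall>\<^sub>F N in sequentially. \<exists>i::nat. max r z2 < real i / 2 ^ N \<and> real i / 2 ^ N < y"
        using r r0 z2 by (intro eventually_dyadic_between) (auto simp: u_def)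
      moreover have "\<forall>\<^sub>F N in sequentially. N \<ge> max m m0" by (rule eventually_ge_at_top)
      ultimately show ?thesis
      proof eventually_elim
        case (elim N)
        obtain i1 i2 :: nat where i1: "u < real i1 / 2 ^ N" "real i1 / 2 ^ N < r"
          and i2: "max r z2 < real i2 / 2 ^ N" "real i2 / 2 ^ N < y" using elim by auto
        define V where "V i = W (real i / 2 ^ N)" for i
        have wV: "w N \<omega> i - c * (real i / 2 ^ N) = V i - X \<omega> 0" for i
          by (simp add: w_def walk_def V_def W_def)
        define Mx where "Mx = Max (V ` {..i1})"
        \<comment> \<open>The least index of the maximum makes the inequalities before
          \<open>k\<close> strict, as \<open>rec\<close> demands.\<close>
        define k where "k = (LEAST i. i \<le> i1 \<and> V i = Mx)"
        have "Mx \<in> V ` {..i1}" unfolding Mx_def by (rule Max_in) auto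
        then obtain i where "i \<le> i1 \<and> V i = Mx" by auto
        then have k: "k \<le> i1 \<and> V k = Mx"
          unfolding k_def by (rule LeastI[where P="\<lambda>i. i \<le> i1 \<and> V i = Mx"])
        have "V i < Mx" if "i < k" for i
        proof -
          have "V i \<le> Mx" using that k unfolding Mx_def by (intro Max_ge) auto
          moreover have "V i \<noteq> Mx" using not_less_Least[of i "\<lambda>i. i \<le> i1 \<and> V i = Mx"] that k
            by (auto simp: k_def)
          ultimately show ?thesis by simp
        qed
        then have rec: "rec N k (w N \<omega>)" using k unfolding rec_def wV by simp
        have "V i1 \<le> Mx" unfolding Mx_def by (intro Max_ge) auto
        then have "V i1 \<le> V k" using k by simp
        moreover have "V i1 > l - c * y - c * (y - r0)"
          unfolding V_def using i1 r by (intro z1) (auto simp: u_def)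
        ultimately have gt: "real k / 2 ^ N > r0"
          using W_le[of "real k / 2 ^ N" r0] r0 by (cases "real k / 2 ^ N \<le> r0") (auto simp: V_def)
        have kr: "real k / 2 ^ N \<le> r"
        proof -
          have "real k / 2 ^ N \<le> real i1 / 2 ^ N" using k by (intro divide_right_mono) auto
          then show ?thesis using i1 by simp
        qed
        have "V k < V i2"
        proof -
          have "V k \<le> l - c * y - c * (y - r)" unfolding V_def using kr r by (intro W_le) auto
          also have "\<dots> < V i2" unfolding V_def using i2 by (intro z2) auto
          finally show ?thesis .
        qed
        moreover have "real k < real i2" using kr i2 by (simp add: field_simps)
        then have "k < i2" by simp
        ultimately have "c * (real (i2 - k) / 2 ^ N) < w N \<omega> (k + (i2 - k)) - w N \<omega> k"
          using wV[of k] wV[of i2] by (simp add: of_nat_diff diff_divide_distrib right_diff_distrib)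
        moreover have "i2 - k \<le> 2 ^ (N - m)"
        proof -
          have "real i2 / 2 ^ N - real k / 2 ^ N < 1 / 2 ^ m" using i2 gt r0 by linarith
          then have "real (i2 - k) < 2 ^ N / 2 ^ m" using \<open>k < i2\<close> by (simp add: of_nat_diff field_simps)
          also have "\<dots> = real (2 ^ (N - m))" using elim by (intro two_power_divide) auto
          finally show ?thesis by simp
        qed
        ultimately have ex: "ex N m (\<lambda>i. w N \<omega> (k + i) - w N \<omega> k)"
          unfolding ex_def using \<open>k < i2\<close> by (intro bexI[of _ "i2 - k"]) auto
        have "k \<le> 2 ^ (N - m0)"
        proof -
          have "real k / 2 ^ N \<le> 1 / 2 ^ m0" using kr r \<open>y \<le> 1 / 2^m0\<close> by linarith
          then have "real k \<le> 2 ^ N / 2 ^ m0" by (simp add: field_simps)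
          also have "\<dots> = real (2 ^ (N - m0))" using elim by (intro two_power_divide) auto
          finally show ?thesis by simp
        qed
        then show "\<omega> \<in> E N"
          using rec ex elim \<open>\<omega> \<in> space M\<close> by (auto simp: E_def A_def B_def)
      qed
    qed
    ultimately show "\<exists>E::nat \<Rightarrow> 'a set. (\<forall>N. E N \<in> events \<and> prob (E N) \<le> \<epsilon>) \<and>
      (\<forall>\<omega>\<in>space M. (\<exists>y l. 0 < y \<and> y \<le> 1 / 2^m0 \<and> (X \<omega> \<longlongrightarrow> l) (at_left y) \<and>
           (\<forall>z\<in>{0..<y}. X \<omega> z \<le> l - 2 * c * (y - z))) \<longrightarrow> (\<forall>\<^sub>F N in sequentially. \<omega> \<in> E N))"
      by (intro exI[of _ E]) blast
  qed
qed

section \<open>Jumps seen on a grid\<close>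

lemma walk_refine:
  assumes "N0 \<le> N"
  shows "walk f (1/2^N) (i * 2^(N-N0)) = walk f (1/2^N0) i"
proof -
  have "(2::real)^N = 2^N0 * 2^(N-N0)"
    using assms by (simp flip: power_add)
  then show ?thesis by (simp add: walk_def)
qed

lemma walk_diff: "walk f \<delta> i - walk f \<delta> j = f (real i * \<delta>) - f (real j * \<delta>)"
  by (simp add: walk_def)

text \<open>Two mesh steps, because one may end exactly at the jump time: with
  \<open>k / 2^N < y \<le> (k + 1) / 2^N\<close> only \<open>k + 2\<close> is sure to lie strictly
  to the right of \<open>y\<close>, and the one-sided limits say nothing about the value at
  \<open>y\<close> itself.\<close>

definition jumps :: "real \<Rightarrow> nat \<Rightarrow> (nat \<Rightarrow> real) \<Rightarrow> bool" where
  "jumps \<gamma> k w \<longleftrightarrow> \<bar>w (k + 2) - w k\<bar> > \<gamma>"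

definition oscillates :: "real \<Rightarrow> nat \<Rightarrow> (nat \<Rightarrow> real) \<Rightarrow> bool" where
  "oscillates \<gamma> l w \<longleftrightarrow> (\<exists>i\<le>l. \<exists>j\<le>l. \<bar>w i - w j\<bar> > \<gamma>)"

text \<open>The walk is read at every \<open>r\<close>-th index, so the times \<open>i / 2^n\<close>
  stay fixed while the mesh is refined, and by \<open>below_refine\<close> so does the event. The
  slack \<open>q\<close> absorbs the distance between a grid point and the jump or return time that
  it replaces.\<close>

definition below :: "nat \<Rightarrow> nat \<Rightarrow> real \<Rightarrow> nat \<Rightarrow> (nat \<Rightarrow> real) \<Rightarrow> bool" where
  "below n r q m w \<longleftrightarrow> (\<forall>i\<in>{1..2^(n-m)}. w (i * r) \<le> (real i / 2^n)\<^sup>2 / 2 + q)"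

lemma measurable_walk_preds[measurable]:
  "Measurable.pred seqM (jumps \<gamma> k)" "Measurable.pred seqM (oscillates \<gamma> l)"
  "Measurable.pred seqM (below n r q m)"
  unfolding jumps_def[abs_def] oscillates_def[abs_def] below_def[abs_def] by measurable

lemma below_refine:
  "N0 \<le> N \<Longrightarrow> below N0 (2^(N-N0)) q m (walk f (1/2^N)) \<longleftrightarrow> below N0 1 q m (walk f (1/2^N0))"
  by (simp add: below_def walk_refine)

text \<open>Two consecutive indices can see the same jump, so up to two of them are not followed by
  an oscillation; this gives the bound 2 * 2. The future starts at \<open>k + 2\<close>, the last
  index that \<open>jumps\<close> reads.\<close>

lemma jump_count:
  assumes X: "stat_indep M X \<nu>" and Y: "stat_indep M Y \<nu>"
    and osc: "measure M {\<omega> \<in> space M. oscillates \<gamma> l (walk (Y \<omega>) (1/2^N))} \<le> 1/2"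
  shows "(\<Sum>k<l. measure M {\<omega> \<in> space M. jumps \<gamma> k (walk (X \<omega>) (1/2^N))}) \<le> 4"
proof -
  interpret prob_space M using X by (rule stat_indep_prob_space)
  note [measurable] = measurable_walk[OF X] measurable_walk[OF Y]
  define w where "w \<omega> = walk (X \<omega>) (1/2^N)" for \<omega>
  have [measurable]: "w \<in> M \<rightarrow>\<^sub>M seqM" unfolding w_def by measurable
  have [measurable]: "(\<lambda>\<omega> i. w \<omega> (k + i) - w \<omega> k) \<in> M \<rightarrow>\<^sub>M seqM" for k
    by (intro measurable_PiM_single') auto
  define A where "A k = {\<omega> \<in> space M. jumps \<gamma> k (w \<omega>)}" for k
  define B where "B k = {\<omega> \<in> space M. oscillates \<gamma> l (\<lambda>i. w \<omega> (k + 2 + i) - w \<omega> (k + 2))}" for k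
  have [measurable]: "A k \<in> events" "B k \<in> events" for k
    unfolding A_def B_def by measurable
  have AB: "prob (A k \<inter> B k) = prob (A k) * prob {\<omega> \<in> space M. oscillates \<gamma> l (walk (Y \<omega>) (1/2^N))}" for k
  proof -
    have "prob {\<omega> \<in> space M. jumps \<gamma> k (w \<omega>) \<and> oscillates \<gamma> l (\<lambda>i. w \<omega> (k + 2 + i) - w \<omega> (k + 2))} =
        prob (A k) * prob {\<omega> \<in> space M. oscillates \<gamma> l (walk (Y \<omega>) (1/2^N))}"
      unfolding A_def w_def by (rule walk_markov[OF X Y]) (auto simp: jumps_def)
    moreover have "A k \<inter> B k = {\<omega> \<in> space M. jumps \<gamma> k (w \<omega>) \<and> oscillates \<gamma> l (\<lambda>i. w \<omega> (k + 2 + i) - w \<omega> (k + 2))}"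
      by (auto simp: A_def B_def)
    ultimately show ?thesis by simp
  qed
  have "(\<Sum>k\<in>{..<l}. prob (A k)) \<le> 2 * real 2"
  proof (rule expected_count_le)
    show "prob (A k \<inter> B k) \<le> prob (A k) / 2" for k
      unfolding AB using mult_left_mono[OF osc, of "prob (A k)"] by simp
    show "card {k \<in> {..<l}. \<omega> \<in> A k - B k} \<le> 2" (is "card ?S \<le> _") for \<omega>
    proof -
      \<comment> \<open>If \<open>k' \<ge> k + 2\<close>, both values compared by
        \<open>jumps\<close> at \<open>k'\<close> belong to the walk restarted at
        \<open>k + 2\<close>, and they lie within its first \<open>l\<close> steps because
        \<open>k' < l\<close>.\<close>
      have gap: "k' < k + 2" if "k \<in> ?S" "k' \<in> ?S" for k k'
      proof (rule ccontr)
        assume "\<not> k' < k + 2"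
        define i where "i = k' - (k + 2)"
        have k': "k' = k + 2 + i" "i + 2 \<le> l" using \<open>\<not> k' < k + 2\<close> that by (auto simp: i_def)
        have "jumps \<gamma> k' (w \<omega>)" using that by (simp add: A_def)
        then have "\<bar>(w \<omega> (k + 2 + (i + 2)) - w \<omega> (k + 2)) - (w \<omega> (k + 2 + i) - w \<omega> (k + 2))\<bar> > \<gamma>"
          by (simp add: jumps_def k' add.assoc)
        then have "oscillates \<gamma> l (\<lambda>i. w \<omega> (k + 2 + i) - w \<omega> (k + 2))"
          unfolding oscillates_def using k' by (intro exI[of _ "i + 2"] conjI exI[of _ i]) auto
        then show False using that by (auto simp: A_def B_def)
      qed
      show ?thesis
      proof (cases "?S = {}")
        case False
        have fin: "finite ?S" by simp
        have "Min ?S \<in> ?S" using fin False by (rule Min_in)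
        have "?S \<subseteq> {Min ?S, Suc (Min ?S)}"
        proof
          fix k assume "k \<in> ?S"
          then have "Min ?S \<le> k" using fin by (intro Min_le)
          moreover have "k < Min ?S + 2" using gap[OF \<open>Min ?S \<in> ?S\<close> \<open>k \<in> ?S\<close>] .
          ultimately show "k \<in> {Min ?S, Suc (Min ?S)}" by auto
        qed
        then have "card ?S \<le> card {Min ?S, Suc (Min ?S)}" by (intro card_mono) auto
        then show ?thesis by simp
      next
        case True
        show ?thesis unfolding True by simp
      qed
    qed
  qed auto
  then show ?thesis by (simp add: A_def w_def)
qed

lemma dyadic_below_exists:
  assumes "(y::real) > 0"
  obtains k :: "nat \<Rightarrow> nat" where "\<And>N. real (k N) / 2^N < y" "\<And>N. y \<le> (real (k N) + 1) / 2^N"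
proof -
  have "\<exists>k::nat. real k / 2^N < y \<and> y \<le> (real k + 1) / 2^N" for N
  proof -
    have "\<lceil>y * 2^N\<rceil> \<ge> 1" using assms by simp
    then have "real (nat (\<lceil>y * 2^N\<rceil> - 1)) = of_int \<lceil>y * 2^N\<rceil> - 1" by simp
    moreover have "of_int \<lceil>y * 2^N\<rceil> - 1 < y * 2^N" "y * 2^N \<le> of_int \<lceil>y * 2^N\<rceil>" by linarith+
    ultimately show ?thesis
      by (intro exI[of _ "nat (\<lceil>y * 2^N\<rceil> - 1)"]) (simp add: field_simps)
  qed
  then show ?thesis using that by metis
qed

lemma dyadic_neighbours:
  fixes k :: "nat \<Rightarrow> nat" and y :: real
  assumes "\<And>N. real (k N) / 2^N < y" "\<And>N. y \<le> (real (k N) + 1) / 2^N"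
  shows "filterlim (\<lambda>N. real (k N) / 2^N) (at_left y) sequentially"
    and "filterlim (\<lambda>N. real (k N + 2) / 2^N) (at_right y) sequentially"
proof -
  have 1: "(\<lambda>N. real (k N) / 2^N) \<longlonglongrightarrow> y"
    by (rule tendsto_dyadicI[where C=1], rule always_eventually)
      (use assms in \<open>simp add: abs_real_def add_divide_distrib algebra_simps\<close>)
  then show "filterlim (\<lambda>N. real (k N) / 2^N) (at_left y) sequentially"
    using assms(1) by (simp add: filterlim_at less_imp_neq)
  have gt: "y < real (k N + 2) / 2^N" for N
  proof -
    have "(real (k N) + 1) / 2^N < real (k N + 2) / 2^N" by (simp add: divide_strict_right_mono)
    with assms(2)[of N] show ?thesis by (rule order.strict_trans1)
  qed
  have "\<bar>real (k N + 2) / 2^N - y\<bar> \<le> 2 / 2^N" for N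
    using gt[of N] assms(1)[of N] by (simp add: abs_real_def add_divide_distrib)
  then have "(\<lambda>N. real (k N + 2) / 2^N) \<longlonglongrightarrow> y"
    by (intro tendsto_dyadicI[where C=2] always_eventually) auto
  then show "filterlim (\<lambda>N. real (k N + 2) / 2^N) (at_right y) sequentially"
    using gt by (simp add: filterlim_at less_imp_neq[symmetric] order.strict_implies_not_eq)
qed

text \<open>The expected number of grid jumps is at most 4 for every fine mesh, and what follows
  each of them is a fresh walk, which stays below the parabola with slack with probability at most
  \<open>\<epsilon> / 4\<close>. The one-sided limits \<open>a\<close> and \<open>b\<close> stand in
  for values, since the paths of \<open>X\<close> need not be right-continuous.\<close>

lemma jump_not_below_parabola:
  assumes X: "stat_indep M X \<nu>" and Y: "stat_indep M Y \<nu>"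
    and osc: "\<And>N. N \<ge> m0 \<Longrightarrow>
      measure M {\<omega> \<in> space M. oscillates \<gamma> (2^(N-m0)) (walk (Y \<omega>) (1/2^N))} \<le> 1/2"
    and R: "\<And>\<epsilon>. \<epsilon> > 0 \<Longrightarrow> \<exists>n\<ge>m. \<exists>q>0.
      measure M {\<omega> \<in> space M. below n 1 q m (walk (Y \<omega>) (1/2^n))} \<le> \<epsilon>"
  shows "AE \<omega> in M. \<not> (\<exists>y a b. 0 < y \<and> y < 1/2^m0 \<and> (X \<omega> \<longlongrightarrow> a) (at_left y) \<and>
      (X \<omega> \<longlongrightarrow> b) (at_right y) \<and> \<bar>b - a\<bar> > \<gamma> \<and> (\<forall>h\<in>{0<..2/2^m}. X \<omega> (y + h) \<le> b + h\<^sup>2 / 2))"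
proof -
  interpret prob_space M using X by (rule stat_indep_prob_space)
  note [measurable] = measurable_walk[OF X] measurable_walk[OF Y]
  define w where "w N \<omega> = walk (X \<omega>) (1/2^N)" for N \<omega>
  have [measurable]: "w N \<in> M \<rightarrow>\<^sub>M seqM" for N unfolding w_def by measurable
  have [measurable]: "(\<lambda>\<omega> i. w N \<omega> (k + i) - w N \<omega> k) \<in> M \<rightarrow>\<^sub>M seqM" for N k
    by (intro measurable_PiM_single') auto
  show ?thesis
  proof (rule AE_not_if_liminf_small)
    fix \<epsilon> :: real assume "\<epsilon> > 0"
    obtain n q where n: "n \<ge> m" "q > 0"
      and small: "prob {\<omega> \<in> space M. below n 1 q m (walk (Y \<omega>) (1/2^n))} \<le> \<epsilon> / 4"
      using R[of "\<epsilon>/4"] \<open>\<epsilon> > 0\<close> by auto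
    define C where "C N k = {\<omega> \<in> space M. jumps \<gamma> k (w N \<omega>) \<and>
      below n (2^(N-n)) q m (\<lambda>i. w N \<omega> (k + 2 + i) - w N \<omega> (k + 2))}" for N k
    have [measurable]: "C N k \<in> events" for N k unfolding C_def by measurable
    define E where "E N = (if N \<ge> max n m0 then \<Union>k<2^(N-m0). C N k else {})" for N
    have "E N \<in> events" for N by (simp add: E_def)
    moreover have "prob (E N) \<le> \<epsilon>" for N
    proof (cases "N \<ge> max n m0")
      case True
      have "prob (C N k) = prob {\<omega> \<in> space M. jumps \<gamma> k (w N \<omega>)} *
          prob {\<omega> \<in> space M. below n (2^(N-n)) q m (walk (Y \<omega>) (1/2^N))}" for k
        unfolding C_def w_def by (rule walk_markov[OF X Y]) (auto simp: jumps_def)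
      then have "prob (C N k) \<le> prob {\<omega> \<in> space M. jumps \<gamma> k (w N \<omega>)} * (\<epsilon> / 4)" for k
        using True small by (simp only: below_refine) (intro mult_left_mono, auto simp: below_refine)
      moreover have "(\<Sum>k<2^(N-m0). prob {\<omega> \<in> space M. jumps \<gamma> k (w N \<omega>)}) \<le> 4"
        unfolding w_def using True by (intro jump_count[OF X Y] osc) auto
      ultimately have "prob (\<Union>k<2^(N-m0). C N k) \<le> 4 * (\<epsilon> / 4)"
        using \<open>\<epsilon> > 0\<close> by (intro prob_UN_le_sum_mult[where p="\<lambda>k. prob {\<omega> \<in> space M. jumps \<gamma> k (w N \<omega>)}"]) auto
      then show ?thesis using True by (simp add: E_def)
    next
      case False
      then have "E N = {}" unfolding E_def by (rule if_not_P)
      then show ?thesis using \<open>\<epsilon> > 0\<close> by simp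
    qed
    moreover have "\<forall>\<^sub>F N in sequentially. \<omega> \<in> E N"
      if "\<omega> \<in> space M" and y: "0 < y" "y < 1/2^m0" and a: "(X \<omega> \<longlongrightarrow> a) (at_left y)"
        and b: "(X \<omega> \<longlongrightarrow> b) (at_right y)" and ab: "\<bar>b - a\<bar> > \<gamma>"
        and le: "\<And>h. h \<in> {0<..2/2^m} \<Longrightarrow> X \<omega> (y + h) \<le> b + h\<^sup>2 / 2" for \<omega> y a b
    proof -
      obtain k :: "nat \<Rightarrow> nat" where k: "\<And>N. real (k N) / 2^N < y" "\<And>N. y \<le> (real (k N) + 1) / 2^N"
        using dyadic_below_exists[OF y(1)] by blast
      note nb = dyadic_neighbours[of k y, OF k]
      define t where "t N = real (k N + 2) / 2^N" for N
      have Xa: "(\<lambda>N. X \<omega> (real (k N) / 2^N)) \<longlonglongrightarrow> a" using filterlim_compose[OF a nb(1)] .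
      have Xb: "(\<lambda>N. X \<omega> (t N)) \<longlonglongrightarrow> b" using filterlim_compose[OF b nb(2)] by (simp add: t_def)
      have ty: "t \<longlonglongrightarrow> y"
        using nb(2) unfolding filterlim_at t_def by simp
      have "\<forall>\<^sub>F N in sequentially. real (k N + 2) / 2^N \<in> {y<..} \<and> real (k N + 2) / 2^N \<noteq> y"
        using nb(2) unfolding filterlim_at by simp
      then have t_gt: "\<forall>\<^sub>F N in sequentially. t N > y"
        by eventually_elim (simp add: t_def)
      have "(\<lambda>N. \<bar>X \<omega> (t N) - X \<omega> (real (k N) / 2^N)\<bar>) \<longlonglongrightarrow> \<bar>b - a\<bar>"
        by (intro tendsto_intros Xa Xb)
      then have "\<forall>\<^sub>F N in sequentially. \<bar>X \<omega> (t N) - X \<omega> (real (k N) / 2^N)\<bar> > \<gamma>"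
        using ab by (rule order_tendstoD)
      moreover have "\<forall>\<^sub>F N in sequentially. \<forall>i\<in>{1..2^(n-m)}.
          X \<omega> (t N + real i / 2^n) - X \<omega> (t N) \<le> (real i / 2^n)\<^sup>2 / 2 + q"
      proof (rule eventually_ball_finite, simp, rule ballI)
        fix i :: nat assume i: "i \<in> {1..2^(n-m)}"
        define s where "s = real i / 2^n"
        have "s > 0" using i by (simp add: s_def)
        have "s \<le> 1/2^m"
        proof -
          have "real i \<le> real (2^(n-m))" using i by (simp only: of_nat_le_iff) simp
          also have "\<dots> = 2^n / 2^m" using n by (intro two_power_divide[symmetric])
          finally show ?thesis by (simp add: s_def field_simps)
        qed
        \<comment> \<open>The limit is half the square of \<open>s\<close>, strictly below the bound
          thanks to \<open>q\<close>; this absorbs the errors made by replacing \<open>y\<close> by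
          \<open>t N\<close> and \<open>b\<close> by \<open>X \<omega> (t N)\<close>.\<close>
        have "(\<lambda>N. b - X \<omega> (t N) + (t N + s - y)\<^sup>2 / 2) \<longlonglongrightarrow> b - b + (y + s - y)\<^sup>2 / 2"
          by (intro tendsto_intros Xb ty) auto
        then have "\<forall>\<^sub>F N in sequentially. b - X \<omega> (t N) + (t N + s - y)\<^sup>2 / 2 < s\<^sup>2 / 2 + q"
          using n by (intro order_tendstoD) auto
        \<comment> \<open>Together with \<open>s \<le> 1/2^m\<close> this keeps the time elapsed
          since the jump below \<open>2/2^m\<close>, the range of \<open>h\<close> in the
          statement.\<close>
        moreover have "\<forall>\<^sub>F N in sequentially. t N < y + 1/2^m"
          using ty by (rule order_tendstoD) simp
        ultimately show "\<forall>\<^sub>F N in sequentially. X \<omega> (t N + real i / 2^n) - X \<omega> (t N) \<le> (real i / 2^n)\<^sup>2 / 2 + q"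
          using t_gt
        proof eventually_elim
          case (elim N)
          have "X \<omega> (y + (t N + s - y)) \<le> b + (t N + s - y)\<^sup>2 / 2"
            using elim \<open>s > 0\<close> \<open>s \<le> 1/2^m\<close> by (intro le) auto
          then show ?case using elim by (simp add: s_def)
        qed
      qed
      moreover have "\<forall>\<^sub>F N in sequentially. N \<ge> max n m0" by (rule eventually_ge_at_top)
      ultimately show ?thesis
      proof eventually_elim
        case (elim N)
        have N: "n \<le> N" "m0 \<le> N" using elim by auto
        have "real (k N) < 2^N / 2^m0"
        proof -
          have "real (k N) / 2^N < 1/2^m0" using k(1)[of N] y by linarith
          then show ?thesis by (simp add: field_simps)
        qed
        also have "\<dots> = real (2^(N-m0))" using N by (intro two_power_divide)
        finally have "k N < 2^(N-m0)" by (simp only: of_nat_less_iff)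
        moreover have "jumps \<gamma> (k N) (w N \<omega>)"
          using elim(1) unfolding jumps_def w_def walk_diff by (simp add: t_def)
        moreover have "below n (2^(N-n)) q m (\<lambda>i. w N \<omega> (k N + 2 + i) - w N \<omega> (k N + 2))"
        proof -
          have "real (k N + 2 + i * 2^(N-n)) * (1 / 2^N) = t N + real i / 2^n" for i
          proof -
            have "(2::real)^N = 2^n * 2^(N-n)" using N by (simp flip: power_add)
            then show ?thesis by (simp add: t_def add_divide_distrib)
          qed
          moreover have "real (k N + 2) * (1 / 2^N) = t N" by (simp add: t_def)
          ultimately show ?thesis
            using elim(2) unfolding below_def w_def walk_diff by metis
        qed
        ultimately show "\<omega> \<in> E N"
          using N \<open>\<omega> \<in> space M\<close> by (auto simp: E_def C_def)
      qed
    qed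
    ultimately show "\<exists>E::nat \<Rightarrow> 'a set. (\<forall>N. E N \<in> events \<and> prob (E N) \<le> \<epsilon>) \<and>
      (\<forall>\<omega>\<in>space M. (\<exists>y a b. 0 < y \<and> y < 1/2^m0 \<and> (X \<omega> \<longlongrightarrow> a) (at_left y) \<and>
      (X \<omega> \<longlongrightarrow> b) (at_right y) \<and> \<bar>b - a\<bar> > \<gamma> \<and> (\<forall>h\<in>{0<..2/2^m}. X \<omega> (y + h) \<le> b + h\<^sup>2 / 2)) \<longrightarrow>
        (\<forall>\<^sub>F N in sequentially. \<omega> \<in> E N))"
      by (intro exI[of _ E]) blast
  qed
qed

section \<open>Return to the level before a jump\<close>

definition hits :: "nat \<Rightarrow> real \<Rightarrow> nat \<Rightarrow> nat \<Rightarrow> (nat \<Rightarrow> real) \<Rightarrow> bool" where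
  "hits N \<theta> j i w \<longleftrightarrow> w j - w i \<le> \<theta> + ((real i - real j) / 2^N)\<^sup>2 / 2"

text \<open>\<open>j\<close> will be the grid point just before the jump, so \<open>w j\<close> is
  close to the level to be regained, and the search starts at \<open>j + 2\<close>, past the jump.
  The tolerance \<open>\<theta>\<close> is there because the path on the grid may miss the exact
  level by a little.\<close>

definition first_hit :: "nat \<Rightarrow> real \<Rightarrow> nat \<Rightarrow> nat \<Rightarrow> (nat \<Rightarrow> real) \<Rightarrow> bool" where
  "first_hit N \<theta> j k w \<longleftrightarrow> j + 2 \<le> k \<and> hits N \<theta> j k w \<and> (\<forall>i\<in>{j + 2..<k}. \<not> hits N \<theta> j i w)"

lemma measurable_hits[measurable]:
  "Measurable.pred seqM (hits N \<theta> j i)" "Measurable.pred seqM (first_hit N \<theta> j k)"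
  unfolding first_hit_def[abs_def] hits_def[abs_def] by measurable

lemma first_hit_unique:
  assumes "first_hit N \<theta> j k w" "first_hit N \<theta> j k' w"
  shows "k = k'"
proof -
  have "\<not> k < k'" if "first_hit N \<theta> j k w" "first_hit N \<theta> j k' w" for k k'
    using that by (auto simp: first_hit_def)
  then show ?thesis using assms by (meson linorder_neqE_nat)
qed

text \<open>A point as below would be reached from the jump at \<open>\<sigma>\<close> by a stopping time: it is the first
time after \<open>\<sigma>\<close> at which the path plus \<open>(t - \<sigma>)\<^sup>2 / 2\<close> climbs back to the level before the jump,
since \<open>(t - \<sigma>)\<^sup>2 / 2 + (t - y)\<^sup>2 / 2 - (y - \<sigma>)\<^sup>2 / 2 = (t - \<sigma>) (t - y) < 0\<close> in between.\<close>

lemma jump_no_parabolic_return: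
  assumes X: "stat_indep M X \<nu>" and Y: "stat_indep M Y \<nu>"
    and osc: "\<And>N. N \<ge> m0 \<Longrightarrow>
      measure M {\<omega> \<in> space M. oscillates \<gamma> (2^(N-m0)) (walk (Y \<omega>) (1/2^N))} \<le> 1/2"
    and R: "\<And>\<epsilon>. \<epsilon> > 0 \<Longrightarrow> \<exists>n. \<exists>q>0.
      measure M {\<omega> \<in> space M. below n 1 q 0 (walk (Y \<omega>) (1/2^n))} \<le> \<epsilon>"
    and "0 \<le> \<gamma>"
  shows "AE \<omega> in M. \<not> (\<exists>\<sigma> y a b. 0 < \<sigma> \<and> \<sigma> < 1/2^m0 \<and> \<sigma> < y \<and> y < real L \<and>
      (X \<omega> \<longlongrightarrow> a) (at_left \<sigma>) \<and> (X \<omega> \<longlongrightarrow> b) (at_right \<sigma>) \<and> a - b > \<gamma> \<and>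
      isCont (X \<omega>) y \<and> X \<omega> y = a - (y - \<sigma>)\<^sup>2 / 2 \<and> (\<forall>t>\<sigma>. X \<omega> t \<le> X \<omega> y + (t - y)\<^sup>2 / 2))"
proof -
  interpret prob_space M using X by (rule stat_indep_prob_space)
  note [measurable] = measurable_walk[OF X] measurable_walk[OF Y]
  define w where "w N \<omega> = walk (X \<omega>) (1/2^N)" for N \<omega>
  have [measurable]: "w N \<in> M \<rightarrow>\<^sub>M seqM" for N unfolding w_def by measurable
  have [measurable]: "(\<lambda>\<omega> i. w N \<omega> (k + i) - w N \<omega> k) \<in> M \<rightarrow>\<^sub>M seqM" for N k
    by (intro measurable_PiM_single') auto
  show ?thesis
  proof (rule AE_not_if_liminf_small)
    fix \<epsilon> :: real assume "\<epsilon> > 0"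
    obtain n q where "q > 0"
      and small: "prob {\<omega> \<in> space M. below n 1 q 0 (walk (Y \<omega>) (1/2^n))} \<le> \<epsilon> / 4"
      using R[of "\<epsilon>/4"] \<open>\<epsilon> > 0\<close> by auto
    define S where "S \<theta> N p = {\<omega> \<in> space M. jumps \<gamma> (fst p) (w N \<omega>) \<and> first_hit N \<theta> (fst p) (snd p) (w N \<omega>)}"
      for \<theta> N and p :: "nat \<times> nat"
    define C where "C \<theta> N p = {\<omega> \<in> space M. (jumps \<gamma> (fst p) (w N \<omega>) \<and> first_hit N \<theta> (fst p) (snd p) (w N \<omega>)) \<and>
      below n (2^(N-n)) q 0 (\<lambda>i. w N \<omega> (snd p + i) - w N \<omega> (snd p))}" for \<theta> N and p :: "nat \<times> nat"
    have [measurable]: "S \<theta> N p \<in> events" "C \<theta> N p \<in> events" for \<theta> N p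
      unfolding S_def C_def by measurable
    define I where "I N = {..<2^(N-m0)::nat} \<times> {..L * 2^N}" for N
    have fin: "finite (I N)" for N by (simp add: I_def)
    define E where "E \<theta> N = (if N \<ge> max n m0 then \<Union>p\<in>I N. C \<theta> N p else {})" for \<theta> N
    have E[measurable]: "E \<theta> N \<in> events" for \<theta> N using fin by (simp add: E_def)
    have prob_E: "prob (E \<theta> N) \<le> \<epsilon>" for \<theta> N
    proof (cases "N \<ge> max n m0")
      case True
      have "prob (C \<theta> N p) \<le> prob (S \<theta> N p) * (\<epsilon> / 4)" for p
      proof (cases "fst p + 2 \<le> snd p")
        \<comment> \<open>\<open>jumps\<close> reads the walk up to \<open>fst p + 2\<close>. It
          belongs to the past of \<open>snd p\<close> in this case only; otherwise there is no first
          return.\<close>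
        case le: True
        have "prob (C \<theta> N p) = prob (S \<theta> N p) *
            prob {\<omega> \<in> space M. below n (2^(N-n)) q 0 (walk (Y \<omega>) (1/2^N))}"
          unfolding C_def S_def w_def
        proof (rule walk_markov[OF X Y])
          show "jumps \<gamma> (fst p) v \<and> first_hit N \<theta> (fst p) (snd p) v \<longleftrightarrow>
              jumps \<gamma> (fst p) u \<and> first_hit N \<theta> (fst p) (snd p) u"
            if "\<And>i. i \<le> snd p \<Longrightarrow> v i = u i" for v u
            using le that by (auto simp: jumps_def first_hit_def hits_def)
        qed auto
        also have "\<dots> \<le> prob (S \<theta> N p) * (\<epsilon> / 4)"
          using True small by (intro mult_left_mono) (auto simp: below_refine)
        finally show ?thesis .
      next
        case False
        then have "C \<theta> N p = {}" by (auto simp: C_def first_hit_def)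
        then show ?thesis using \<open>\<epsilon> > 0\<close> by simp
      qed
      moreover have "(\<Sum>p\<in>I N. prob (S \<theta> N p)) \<le> 4"
      proof -
        \<comment> \<open>For one jump index, first returns at different \<open>k\<close> are
          disjoint events, so in expectation there are no more pairs than jumps.\<close>
        have "(\<Sum>k\<le>L * 2^N. prob (S \<theta> N (j, k))) \<le> prob {\<omega> \<in> space M. jumps \<gamma> j (w N \<omega>)}" for j
        proof -
          have "disjoint_family_on (\<lambda>k. S \<theta> N (j, k)) {..L * 2^N}"
            unfolding disjoint_family_on_def S_def using first_hit_unique by fastforce
          then have "(\<Sum>k\<le>L * 2^N. prob (S \<theta> N (j, k))) = prob (\<Union>k\<le>L * 2^N. S \<theta> N (j, k))"
            by (intro finite_measure_finite_Union[symmetric]) auto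
          also have "\<dots> \<le> prob {\<omega> \<in> space M. jumps \<gamma> j (w N \<omega>)}"
            by (rule finite_measure_mono) (auto simp: S_def)
          finally show ?thesis .
        qed
        then have "(\<Sum>p\<in>I N. prob (S \<theta> N p)) \<le> (\<Sum>j<2^(N-m0). prob {\<omega> \<in> space M. jumps \<gamma> j (w N \<omega>)})"
          unfolding I_def by (subst sum.cartesian_product[of "\<lambda>j k. prob (S \<theta> N (j, k))", simplified, symmetric])
            (rule sum_mono)
        also have "\<dots> \<le> 4"
          unfolding w_def using True by (intro jump_count[OF X Y] osc) auto
        finally show ?thesis .
      qed
      ultimately have "prob (\<Union>p\<in>I N. C \<theta> N p) \<le> 4 * (\<epsilon> / 4)"
        using \<open>\<epsilon> > 0\<close> fin by (intro prob_UN_le_sum_mult[where p="\<lambda>p. prob (S \<theta> N p)"]) auto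
      then show ?thesis using True by (simp add: E_def)
    next
      case False
      then have "E \<theta> N = {}" unfolding E_def by (rule if_not_P)
      then show ?thesis using \<open>\<epsilon> > 0\<close> by simp
    qed
    \<comment> \<open>Two limits in this order: for a fixed tolerance the mesh tends to 0, and only
      then does the tolerance. How small it has to be depends on the path, through
      \<open>\<theta>0\<close> below.\<close>
    define F where "F r = {\<omega> \<in> space M. \<forall>\<^sub>F N in sequentially. \<omega> \<in> E (1 / real (Suc r)) N}" for r
    have "F r \<in> events" for r
      unfolding F_def eventually_sequentially by measurable
    moreover have "prob (F r) \<le> \<epsilon>" for r
      unfolding F_def by (rule prob_liminf_le) (auto simp: prob_E)
    moreover have "\<forall>\<^sub>F r in sequentially. \<omega> \<in> F r"
      if "\<omega> \<in> space M" and \<sigma>: "0 < \<sigma>" "\<sigma> < 1/2^m0" "\<sigma> < y" "y < real L"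
        and a: "(X \<omega> \<longlongrightarrow> a) (at_left \<sigma>)" and b: "(X \<omega> \<longlongrightarrow> b) (at_right \<sigma>)" and ab: "a - b > \<gamma>"
        and cont: "isCont (X \<omega>) y" and Xy: "X \<omega> y = a - (y - \<sigma>)\<^sup>2 / 2"
        and le: "\<And>t. t > \<sigma> \<Longrightarrow> X \<omega> t \<le> X \<omega> y + (t - y)\<^sup>2 / 2" for \<omega> \<sigma> y a b
    proof -
      have "\<forall>\<^sub>F t in nhds y. \<bar>X \<omega> t - X \<omega> y\<bar> < q / 4"
      proof -
        have "(X \<omega> \<longlongrightarrow> X \<omega> y) (nhds y)"
          using cont by (simp add: continuous_within tendsto_at_iff_tendsto_nhds)
        then show ?thesis
          using \<open>q > 0\<close> tendstoD[of "X \<omega>" "X \<omega> y" "nhds y" "q / 4"] by (simp add: dist_real_def)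
      qed
      then obtain d where d: "d > 0" "\<And>t. \<bar>t - y\<bar> < d \<Longrightarrow> \<bar>X \<omega> t - X \<omega> y\<bar> < q / 4"
        by (auto simp: eventually_nhds_metric dist_real_def)
      \<comment> \<open>\<open>d\<close> keeps the path within \<open>q / 4\<close> of its value at
        \<open>y\<close>; 1 and \<open>q / 8\<close> make the shift of the parabola cost at most
        \<open>q / 4\<close>; \<open>(y - \<sigma>) / 2\<close> keeps the times considered to the
        right of \<open>\<sigma>\<close>.\<close>
      define \<xi> where "\<xi> = min (min d 1) (min (q / 8) ((y - \<sigma>) / 2))"
      have \<xi>: "\<xi> > 0" "\<xi> \<le> d" "\<xi> \<le> 1" "\<xi> \<le> q / 8" "\<xi> \<le> (y - \<sigma>) / 2"
        using d \<open>q > 0\<close> \<sigma> by (auto simp: \<xi>_def min_def)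
      have post: "X \<omega> (t + s) - X \<omega> t \<le> s\<^sup>2 / 2 + q" if t: "\<bar>t - y\<bar> < \<xi>" and s: "0 < s" "s \<le> 1" for t s
      proof -
        have "(t + s - y)\<^sup>2 = s\<^sup>2 + 2 * s * (t - y) + (t - y)\<^sup>2"
          by (simp add: power2_eq_square algebra_simps)
        moreover have "2 * s * (t - y) \<le> 2 * \<xi>"
        proof -
          have "s * (t - y) \<le> s * \<bar>t - y\<bar>" using s by (intro mult_left_mono) auto
          also have "\<dots> \<le> 1 * \<xi>" using s t by (intro mult_mono) auto
          finally show ?thesis by simp
        qed
        moreover have "(t - y)\<^sup>2 \<le> \<xi>"
        proof -
          have "\<bar>t - y\<bar> * \<bar>t - y\<bar> \<le> \<xi> * 1" using t \<xi> by (intro mult_mono) auto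
          then show ?thesis by (simp add: power2_eq_square abs_mult[symmetric])
        qed
        ultimately have "(t + s - y)\<^sup>2 / 2 \<le> s\<^sup>2 / 2 + q / 4" using \<xi> by linarith
        moreover have "X \<omega> (t + s) \<le> X \<omega> y + (t + s - y)\<^sup>2 / 2"
        proof (rule le)
          have "t > y - \<xi>" using t by linarith
          then show "t + s > \<sigma>" using \<xi>(5) s \<sigma> by (simp add: field_simps)
        qed
        moreover have "\<bar>X \<omega> t - X \<omega> y\<bar> < q / 4" using t \<xi> by (intro d) auto
        ultimately show ?thesis using \<open>q > 0\<close> by linarith
      qed
      have "\<forall>\<^sub>F t in at_right \<sigma>. X \<omega> t + (t - \<sigma>)\<^sup>2 / 2 < (a + b) / 2"
      proof -
        have "((\<lambda>t. X \<omega> t + (t - \<sigma>)\<^sup>2 / 2) \<longlongrightarrow> b + (\<sigma> - \<sigma>)\<^sup>2 / 2) (at_right \<sigma>)"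
          by (intro tendsto_intros b) auto
        then show ?thesis using ab \<open>0 \<le> \<gamma>\<close> by (intro order_tendstoD) auto
      qed
      then obtain z where z: "z > \<sigma>" "\<And>t. \<sigma> < t \<Longrightarrow> t < z \<Longrightarrow> X \<omega> t + (t - \<sigma>)\<^sup>2 / 2 < (a + b) / 2"
        unfolding eventually_at_right_field by blast
      \<comment> \<open>How far the path plus the parabola centred at \<open>\<sigma>\<close> stays
        below the level \<open>a\<close> until \<open>y - \<xi>\<close>: before \<open>z\<close>
        because of the jump, from \<open>z\<close> on because of the product
        \<open>(t - \<sigma>) * (y - t)\<close>.\<close>
      define \<theta>0 where "\<theta>0 = min ((a - b) / 2) ((z - \<sigma>) * \<xi>)"
      have \<theta>0: "\<theta>0 \<le> (a - b) / 2" "\<theta>0 \<le> (z - \<sigma>) * \<xi>"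
        unfolding \<theta>0_def by (rule min.cobounded1, rule min.cobounded2)
      have "\<theta>0 > 0" using z \<xi> ab \<open>0 \<le> \<gamma>\<close> by (auto simp: \<theta>0_def)
      have gap: "X \<omega> t + (t - \<sigma>)\<^sup>2 / 2 \<le> a - \<theta>0" if t: "\<sigma> < t" "t \<le> y - \<xi>" for t
      proof (cases "t < z")
        case True
        then have "X \<omega> t + (t - \<sigma>)\<^sup>2 / 2 < (a + b) / 2" using t by (intro z)
        also have "\<dots> = a - (a - b) / 2" by (simp add: field_simps)
        also have "\<dots> \<le> a - \<theta>0" using \<theta>0(1) by linarith
        finally show ?thesis by simp
      next
        case False
        have "X \<omega> t + (t - \<sigma>)\<^sup>2 / 2 \<le> a - (y - \<sigma>)\<^sup>2 / 2 + (t - y)\<^sup>2 / 2 + (t - \<sigma>)\<^sup>2 / 2"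
          using le[OF t(1)] Xy by simp
        also have "\<dots> = a - (t - \<sigma>) * (y - t)"
          by (simp add: power2_eq_square field_simps)
        also have "\<dots> \<le> a - (z - \<sigma>) * \<xi>"
          using False t \<xi> z mult_mono[of "z - \<sigma>" "t - \<sigma>" \<xi> "y - t"] by simp
        also have "\<dots> \<le> a - \<theta>0" using \<theta>0(2) by linarith
        finally show ?thesis .
      qed
      obtain j :: "nat \<Rightarrow> nat" where j: "\<And>N. real (j N) / 2^N < \<sigma>" "\<And>N. \<sigma> \<le> (real (j N) + 1) / 2^N"
        using dyadic_below_exists[OF \<sigma>(1)] by blast
      have "y > 0" using \<sigma> by simp
      obtain g :: "nat \<Rightarrow> nat" where g: "\<And>N. real (g N) / 2^N < y" "\<And>N. y \<le> (real (g N) + 1) / 2^N"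
        using dyadic_below_exists[OF \<open>y > 0\<close>] by blast
      note nj = dyadic_neighbours[of j \<sigma>, OF j] and ng = dyadic_neighbours[of g y, OF g]
      define u where "u N = real (j N) / 2^N" for N
      define v where "v N = real (g N) / 2^N" for N
      have u: "u \<longlonglongrightarrow> \<sigma>" and v: "v \<longlonglongrightarrow> y" and u2: "(\<lambda>N. real (j N + 2) / 2^N) \<longlonglongrightarrow> \<sigma>"
        using nj ng unfolding filterlim_at u_def v_def by auto
      have Xu: "(\<lambda>N. X \<omega> (u N)) \<longlonglongrightarrow> a" using filterlim_compose[OF a nj(1)] by (simp add: u_def)
      have Xu2: "(\<lambda>N. X \<omega> (real (j N + 2) / 2^N)) \<longlonglongrightarrow> b" using filterlim_compose[OF b nj(2)] .
      have Xv: "(\<lambda>N. X \<omega> (v N)) \<longlonglongrightarrow> X \<omega> y" using cont v by (rule isCont_tendsto_compose)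
      have u2_gt: "real (j N + 2) / 2^N > \<sigma>" for N
      proof -
        have "(real (j N) + 1) / 2^N < real (j N + 2) / 2^N" by (simp add: divide_strict_right_mono)
        with j(2)[of N] show ?thesis by (rule order.strict_trans1)
      qed
      have evE: "\<forall>\<^sub>F N in sequentially. \<omega> \<in> E \<theta> N" if \<theta>: "0 < \<theta>" "\<theta> < \<theta>0" for \<theta>
      proof -
        \<comment> \<open>Grid errors of size \<open>\<eta>\<close> occur twice in each comparison:
          \<open>2 * \<eta> \<le> \<theta>\<close> lets the grid point just before \<open>y\<close>
          count as a return, and \<open>2 * \<eta> \<le> \<theta>0 - \<theta>\<close> excludes
          returns up to \<open>y - \<xi>\<close>.\<close>
        define \<eta> where "\<eta> = min \<theta> (\<theta>0 - \<theta>) / 2"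
        have \<eta>: "\<eta> > 0" "2 * \<eta> \<le> \<theta>" "2 * \<eta> \<le> \<theta>0 - \<theta>" using \<theta> by (auto simp: \<eta>_def)
        have "(\<lambda>N. (\<bar>X \<omega> (u N) - X \<omega> (real (j N + 2) / 2^N)\<bar>)) \<longlonglongrightarrow> \<bar>a - b\<bar>"
          by (intro tendsto_intros Xu Xu2)
        then have "\<forall>\<^sub>F N in sequentially. \<bar>X \<omega> (u N) - X \<omega> (real (j N + 2) / 2^N)\<bar> > \<gamma>"
          by (rule order_tendstoD(1)) (use ab in linarith)
        moreover have "\<forall>\<^sub>F N in sequentially. \<bar>X \<omega> (u N) - a\<bar> < \<eta>"
          using tendstoD[OF Xu \<eta>(1)] by (simp add: dist_real_def)
        moreover have "\<forall>\<^sub>F N in sequentially. X \<omega> (v N) + (v N - u N)\<^sup>2 / 2 > a - \<eta>"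
        proof -
          have "(\<lambda>N. X \<omega> (v N) + (v N - u N)\<^sup>2 / 2) \<longlonglongrightarrow> X \<omega> y + (y - \<sigma>)\<^sup>2 / 2"
            by (intro tendsto_intros Xv u v) auto
          then show ?thesis using Xy \<eta> by (intro order_tendstoD) auto
        qed
        moreover have "\<forall>\<^sub>F N in sequentially. v N > (y + \<sigma>) / 2"
          using v \<sigma> by (intro order_tendstoD) auto
        moreover have "\<forall>\<^sub>F N in sequentially. real (j N + 2) / 2^N < (y + \<sigma>) / 2"
          using u2 \<sigma> by (intro order_tendstoD) auto
        moreover have "\<forall>\<^sub>F N in sequentially. (\<sigma> - u N) * (2 * (y - \<sigma>) + (\<sigma> - u N)) < 2 * \<eta>"
        proof -
          have "(\<lambda>N. (\<sigma> - u N) * (2 * (y - \<sigma>) + (\<sigma> - u N))) \<longlonglongrightarrow> (\<sigma> - \<sigma>) * (2 * (y - \<sigma>) + (\<sigma> - \<sigma>))"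
            by (intro tendsto_intros u)
          then show ?thesis using \<eta> by (intro order_tendstoD) auto
        qed
        moreover have "\<forall>\<^sub>F N in sequentially. N \<ge> max n m0" by (rule eventually_ge_at_top)
        ultimately show ?thesis
        proof eventually_elim
          case (elim N)
          have N: "n \<le> N" "m0 \<le> N" using elim by auto
          have hits: "hits N \<theta> (j N) i (w N \<omega>) \<longleftrightarrow>
              X \<omega> (u N) - \<theta> \<le> X \<omega> (real i / 2^N) + (real i / 2^N - u N)\<^sup>2 / 2" for i
            by (auto simp: hits_def w_def walk_def u_def diff_divide_distrib)
          have no_hit: "\<not> hits N \<theta> (j N) i (w N \<omega>)" if "j N + 2 \<le> i" "real i / 2^N \<le> y - \<xi>" for i
          proof -
            define t where "t = real i / 2^N"
            have "real (j N + 2) / 2^N \<le> t"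
              unfolding t_def using that(1) by (intro divide_right_mono) auto
            then have "\<sigma> < t" using u2_gt[of N] by simp
            have "t \<le> y" using that(2) \<xi> by (simp add: t_def)
            have "\<sigma> - u N > 0" using j(1) by (simp add: u_def)
            have "(t - u N)\<^sup>2 = (t - \<sigma>)\<^sup>2 + (\<sigma> - u N) * (2 * (t - \<sigma>) + (\<sigma> - u N))"
              by (simp add: power2_eq_square algebra_simps)
            also have "\<dots> \<le> (t - \<sigma>)\<^sup>2 + (\<sigma> - u N) * (2 * (y - \<sigma>) + (\<sigma> - u N))"
              using \<open>\<sigma> - u N > 0\<close> \<open>t \<le> y\<close> by (intro add_left_mono mult_left_mono) auto
            finally have "(t - u N)\<^sup>2 / 2 < (t - \<sigma>)\<^sup>2 / 2 + \<eta>" using elim by simp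
            moreover have "X \<omega> t + (t - \<sigma>)\<^sup>2 / 2 \<le> a - \<theta>0"
              using \<open>\<sigma> < t\<close> that(2) by (intro gap) (simp_all add: t_def)
            moreover have "a < X \<omega> (u N) + \<eta>" using elim(2) by linarith
            ultimately have "X \<omega> t + (t - u N)\<^sup>2 / 2 < X \<omega> (u N) - \<theta>" using \<eta> by linarith
            then show ?thesis unfolding hits t_def by simp
          qed
          have "real (j N + 2) / 2^N < real (g N) / 2^N" using elim(4,5) unfolding v_def by linarith
          then have "real (j N + 2) < real (g N)" by (simp add: divide_less_cancel)
          then have "j N + 2 \<le> g N" by simp
          moreover have "hits N \<theta> (j N) (g N) (w N \<omega>)"
            unfolding hits using elim(2,3) \<eta> unfolding v_def by linarith
          ultimately have ex: "\<exists>i. j N + 2 \<le> i \<and> hits N \<theta> (j N) i (w N \<omega>)" by blast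
          define k where "k = (LEAST i. j N + 2 \<le> i \<and> hits N \<theta> (j N) i (w N \<omega>))"
          have k: "j N + 2 \<le> k \<and> hits N \<theta> (j N) k (w N \<omega>)"
            unfolding k_def using ex by (rule LeastI_ex)
          have "k \<le> g N"
            unfolding k_def using \<open>j N + 2 \<le> g N\<close> \<open>hits N \<theta> (j N) (g N) (w N \<omega>)\<close> by (intro Least_le conjI)
          have first: "first_hit N \<theta> (j N) k (w N \<omega>)"
            unfolding first_hit_def using k
          proof (intro conjI ballI notI)
            fix i assume i: "i \<in> {j N + 2..<k}" "hits N \<theta> (j N) i (w N \<omega>)"
            then have "k \<le> i" unfolding k_def by (intro Least_le) auto
            with i show False by simp
          qed auto
          have "real k / 2^N \<le> real (g N) / 2^N"
            using \<open>k \<le> g N\<close> by (intro divide_right_mono) auto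
          then have k_lt: "real k / 2^N < y" using g(1)[of N] by linarith
          moreover have "real k / 2^N > y - \<xi>" using no_hit[of k] k by linarith
          ultimately have near: "\<bar>real k / 2^N - y\<bar> < \<xi>" by simp
          have "real (j N) < 2^N / 2^m0"
          proof -
            have "real (j N) / 2^N < 1/2^m0" using j(1)[of N] \<sigma> by linarith
            then show ?thesis by (simp add: field_simps)
          qed
          also have "\<dots> = real (2^(N-m0))" using N by (intro two_power_divide)
          finally have "j N < 2^(N-m0)" by (simp only: of_nat_less_iff)
          moreover have "k \<le> L * 2^N"
          proof -
            have "real k / 2^N \<le> real L" using k_lt \<sigma> by simp
            then have "real k \<le> real (L * 2^N)" by (simp add: field_simps)
            then show ?thesis by (simp only: of_nat_le_iff)
          qed
          moreover have "jumps \<gamma> (j N) (w N \<omega>)"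
            using elim(1) unfolding jumps_def w_def walk_diff u_def by (simp add: abs_minus_commute)
          moreover have "below n (2^(N-n)) q 0 (\<lambda>i. w N \<omega> (k + i) - w N \<omega> k)"
            unfolding below_def
          proof
            fix i :: nat assume i: "i \<in> {1..2^(n-0)}"
            have "(2::real)^N = 2^n * 2^(N-n)" using N by (simp flip: power_add)
            then have eq: "real (k + i * 2^(N-n)) * (1 / 2^N) = real k / 2^N + real i / 2^n"
              by (simp add: add_divide_distrib)
            have "real i \<le> real (2^n)" using i by (simp only: of_nat_le_iff) simp
            then have "X \<omega> (real k / 2^N + real i / 2^n) - X \<omega> (real k / 2^N) \<le> (real i / 2^n)\<^sup>2 / 2 + q"
              using i by (intro post near) auto
            then show "w N \<omega> (k + i * 2^(N-n)) - w N \<omega> k \<le> (real i / 2^n)\<^sup>2 / 2 + q"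
              unfolding w_def walk_diff eq by simp
          qed
          ultimately have "\<omega> \<in> C \<theta> N (j N, k)" "(j N, k) \<in> I N"
            using first \<open>\<omega> \<in> space M\<close> by (auto simp: C_def I_def)
          then show "\<omega> \<in> E \<theta> N" using N by (auto simp: E_def)
        qed
      qed
      have "\<forall>\<^sub>F r in sequentially. 1 / real (Suc r) < \<theta>0"
        using order_tendstoD(2)[OF LIMSEQ_inverse_real_of_nat \<open>\<theta>0 > 0\<close>] by (simp add: inverse_eq_divide)
      then show ?thesis
        by eventually_elim (use evE \<open>\<omega> \<in> space M\<close> in \<open>auto simp: F_def\<close>)
    qed
    ultimately show "\<exists>E::nat \<Rightarrow> 'a set. (\<forall>N. E N \<in> events \<and> prob (E N) \<le> \<epsilon>) \<and>
      (\<forall>\<omega>\<in>space M. (\<exists>\<sigma> y a b. 0 < \<sigma> \<and> \<sigma> < 1/2^m0 \<and> \<sigma> < y \<and> y < real L \<and>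
      (X \<omega> \<longlongrightarrow> a) (at_left \<sigma>) \<and> (X \<omega> \<longlongrightarrow> b) (at_right \<sigma>) \<and> a - b > \<gamma> \<and>
      isCont (X \<omega>) y \<and> X \<omega> y = a - (y - \<sigma>)\<^sup>2 / 2 \<and> (\<forall>t>\<sigma>. X \<omega> t \<le> X \<omega> y + (t - y)\<^sup>2 / 2)) \<longrightarrow>
        (\<forall>\<^sub>F N in sequentially. \<omega> \<in> E N))"
      by (intro exI[of _ F]) blast
  qed
qed

section \<open>Typical behaviour at the origin\<close>

text \<open>A discrete maximal inequality by greedy covering. The first bad start \<open>s\<close>
  owns a run of \<open>i\<close> terms with sum above \<open>a * i\<close>; the run contains at most
  \<open>i\<close> bad starts, and the count continues behind it. The runs are disjoint, so their
  sums add up; they may reach past \<open>n\<close> by at most \<open>l\<close>.\<close>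

lemma card_rising_le:
  fixes v :: "nat \<Rightarrow> real"
  assumes v: "\<And>r. v r \<ge> 0"
  shows "a * real (card {j\<in>{s..<n}. \<exists>i\<in>{1..l}. a * real i < (\<Sum>r\<in>{j..<j+i}. v r)}) \<le> (\<Sum>r\<in>{s..<n+l}. v r)"
    (is "a * real (card (?B s)) \<le> _")
proof (induction "n - s" arbitrary: s rule: less_induct)
  case less
  show ?case
  proof (cases "s < n")
    case True
    show ?thesis
    proof (cases "s \<in> ?B s")
      case False
      then have "?B s = ?B (Suc s)"
        by (auto simp: le_eq_less_or_eq Suc_le_eq)
      then have "a * real (card (?B s)) \<le> (\<Sum>r\<in>{Suc s..<n+l}. v r)"
        using less[of "Suc s"] True by simp
      also have "\<dots> \<le> (\<Sum>r\<in>{s..<n+l}. v r)"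
        using v by (intro sum_mono2) auto
      finally show ?thesis .
    next
      case True
      then obtain i where i: "i \<in> {1..l}" "a * real i < (\<Sum>r\<in>{s..<s+i}. v r)" by blast
      have "?B s \<subseteq> {s..<s+i} \<union> ?B (s + i)" by auto
      then have "card (?B s) \<le> card ({s..<s+i} \<union> ?B (s + i))" by (intro card_mono) auto
      also have "\<dots> \<le> i + card (?B (s + i))"
        using card_Un_le[of "{s..<s+i}" "?B (s + i)"] by simp
      finally have c: "card (?B s) \<le> i + card (?B (s + i))" .
      have IH: "a * real (card (?B (s + i))) \<le> (\<Sum>r\<in>{s+i..<n+l}. v r)"
        using i \<open>s < n\<close> by (intro less) auto
      have split: "(\<Sum>r\<in>{s..<n+l}. v r) = (\<Sum>r\<in>{s..<s+i}. v r) + (\<Sum>r\<in>{s+i..<n+l}. v r)"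
        using i \<open>s < n\<close> by (intro sum.atLeastLessThan_concat[symmetric]) auto
      show ?thesis
      proof (cases "a \<ge> 0")
        case True
        have "a * real (card (?B s)) \<le> a * (real i + real (card (?B (s + i))))"
          using c True by (intro mult_left_mono) (auto simp flip: of_nat_add)
        then show ?thesis using i IH split by (simp add: distrib_left)
      next
        case False
        then have "a * real (card (?B s)) \<le> 0" by (simp add: mult_nonpos_nonneg)
        also have "0 \<le> (\<Sum>r\<in>{s..<n+l}. v r)" using v by (intro sum_nonneg)
        finally show ?thesis .
      qed
    qed
  next
    case False
    then have "?B s = {}" by auto
    then show ?thesis using v by (simp only: card.empty) (simp add: sum_nonneg)
  qed
qed

text \<open>Removing finitely many jumps leaves a function of arbitrarily small variation; the rising-sun
estimate bounds the bad starting points for the remainder, and the removed jumps spoil few others.\<close>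

lemma pure_jump_slopes_rare:
  fixes f J :: "real \<Rightarrow> real"
  assumes f: "\<And>x. x \<ge> 0 \<Longrightarrow> (J has_sum f x - f 0) {0<..x}"
    and "c > 0" "\<epsilon> > 0"
  shows "\<exists>m0. \<forall>m\<ge>m0. \<forall>N\<ge>m. real (card {j\<in>{..<2^N}. \<exists>i\<in>{1..2^(N-m)}.
      walk f (1/2^N) (j + i) - walk f (1/2^N) j > c * (real i / 2^N)}) \<le> \<epsilon> * 2^N"
proof -
  \<comment> \<open>Starts lie in \<open>{0..<1}\<close> and windows have length at most 1, so jumps
    up to time 2 matter.\<close>
  define A where "A = {0<..2::real}"
  define g where "g u = \<bar>J u\<bar>" for u
  have JA: "J summable_on {0<..x}" if "x \<ge> 0" for x
    using f[OF that] by (rule has_sum_imp_summable)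
  have gA: "g summable_on B" if "B \<subseteq> A" for B
  proof -
    have "J summable_on B" using JA[of 2] that by (auto simp: A_def intro: summable_on_subset_banach)
    then show ?thesis
      using summable_on_iff_abs_summable_on_real[of J B] by (simp add: g_def[abs_def])
  qed
  \<comment> \<open>Half of \<open>\<epsilon>\<close> is reserved for each kind of bad start. At
    slope \<open>c\<close>, a variation of \<open>\<epsilon> * c / 2\<close> allows at most the
    fraction \<open>\<epsilon> / 2\<close> of the starts.\<close>
  define \<kappa> where "\<kappa> = \<epsilon> * c / 2"
  have "\<kappa> > 0" using assms by (simp add: \<kappa>_def)
  obtain F where F: "finite F" "F \<subseteq> A" "dist (sum g F) (infsum g A) \<le> \<kappa>"
    using infsum_finite_approximation[OF gA[of A] \<open>\<kappa> > 0\<close>] by auto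
  have tail: "infsum g (A - F) \<le> \<kappa>"
  proof -
    have "infsum g (F \<union> (A - F)) = infsum g F + infsum g (A - F)"
      using F by (intro infsum_Un_disjoint gA) auto
    moreover have "F \<union> (A - F) = A" using F by auto
    ultimately have "infsum g A = sum g F + infsum g (A - F)" using F by simp
    then show ?thesis using F(3) by (simp add: dist_real_def)
  qed
  define V where "V x = infsum g ({0<..x} - F)" for x
  have V_diff: "V x - V y = infsum g ({y<..x} - F)" if "0 \<le> y" "y \<le> x" "x \<le> 2" for x y
  proof -
    have "{0<..x} - F = ({0<..y} - F) \<union> ({y<..x} - F)" using that by auto
    then have "V x = V y + infsum g ({y<..x} - F)"
      unfolding V_def using that by (simp only:) (intro infsum_Un_disjoint gA, auto simp: A_def)
    then show ?thesis by simp
  qed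
  have f_diff: "f x - f y \<le> V x - V y" if xy: "0 \<le> y" "y \<le> x" "x \<le> 2" and "{y<..x} \<inter> F = {}" for x y
  proof -
    have "J summable_on {y<..x}"
      using xy by (intro summable_on_subset_banach[OF JA[of 2]]) auto
    then have "infsum J ({0<..y} \<union> {y<..x}) = infsum J {0<..y} + infsum J {y<..x}"
      using xy by (intro infsum_Un_disjoint JA) auto
    moreover have "{0<..y} \<union> {y<..x} = {0<..x}" using xy by auto
    moreover have "infsum J {0<..x} = f x - f 0" "infsum J {0<..y} = f y - f 0"
      using xy by (auto intro!: infsumI f)
    ultimately have "f x - f y = infsum J {y<..x}" by simp
    also have "\<dots> \<le> infsum g {y<..x}"
      using \<open>J summable_on {y<..x}\<close> xy by (intro infsum_mono gA) (auto simp: g_def A_def)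
    also have "{y<..x} = {y<..x} - F" using that by auto
    finally show ?thesis using V_diff[OF xy] by simp
  qed
  have V_nonneg: "0 \<le> V x - V y" if "0 \<le> y" "y \<le> x" "x \<le> 2" for x y
    unfolding V_diff[OF that] by (rule infsum_nonneg) (simp add: g_def)
  obtain m0 where m0: "real (card F) / 2^m0 < \<epsilon> / 2"
  proof -
    have "(\<lambda>m. real (card F) * (1/2)^m) \<longlonglongrightarrow> real (card F) * 0"
      by (intro tendsto_intros LIMSEQ_power_zero) simp
    then have "\<forall>\<^sub>F m in sequentially. real (card F) * (1/2)^m < \<epsilon> / 2"
      using \<open>\<epsilon> > 0\<close> by (intro order_tendstoD) auto
    then show ?thesis using that by (auto simp: eventually_sequentially power_divide)
  qed
  show ?thesis
  proof (intro exI[of _ m0] allI impI)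
    fix m N :: nat assume m: "m0 \<le> m" "m \<le> N"
    define l where "l = (2::nat)^(N-m)"
    \<comment> \<open>Set to 0 outside the range where \<open>V\<close> is known to increase,
      because the maximal inequality wants all terms nonnegative.\<close>
    define v where "v r = (if r < 2^N + l then V (real (Suc r) / 2^N) - V (real r / 2^N) else 0)" for r
    have l_le: "l \<le> 2^N" by (simp add: l_def)
    have in2: "real r / 2^N \<le> 2" if "r \<le> 2^N + l" for r
    proof -
      have "real r \<le> real (2^N + 2^N)" using that l_le by (simp only: of_nat_le_iff)
      then show ?thesis by (simp add: field_simps)
    qed
    have v_nonneg: "v r \<ge> 0" for r
    proof (cases "r < 2^N + l")
      case True
      have "0 \<le> V (real (Suc r) / 2^N) - V (real r / 2^N)"
        using in2[of "Suc r"] True by (intro V_nonneg divide_right_mono) auto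
      then show ?thesis unfolding v_def by (simp only: True if_True)
    qed (simp add: v_def)
    have v_sum: "(\<Sum>r\<in>{j..<j+i}. v r) = V (real (j + i) / 2^N) - V (real j / 2^N)" if "j + i \<le> 2^N + l" for i j
    proof -
      have "(\<Sum>r\<in>{j..<j+i}. v r) = (\<Sum>r\<in>{j..<j+i}. V (real (Suc r) / 2^N) - V (real r / 2^N))"
        using that by (intro sum.cong) (auto simp: v_def)
      also have "\<dots> = V (real (j + i) / 2^N) - V (real j / 2^N)"
        by (rule sum_Suc_diff') simp
      finally show ?thesis .
    qed
    define B where "B = {j\<in>{..<2^N}. \<exists>i\<in>{1..l}. walk f (1/2^N) (j + i) - walk f (1/2^N) j > c * (real i / 2^N)}"
    define R where "R = {j\<in>{0..<2^N}. \<exists>i\<in>{1..l}. c / 2^N * real i < (\<Sum>r\<in>{j..<j+i}. v r)}"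
    \<comment> \<open>Starts whose window contains the removed jump at \<open>u\<close>: at most
      \<open>l\<close> of them, a fraction \<open>1 / 2^m\<close> of all starts.\<close>
    define H where "H u = {j::nat. real j < u * 2^N \<and> u * 2^N \<le> real j + real l}" for u
    have H: "finite (H u) \<and> card (H u) \<le> l" for u
    proof (cases "H u = {}")
      case False
      then obtain j where "j \<in> H u" by blast
      define j0 where "j0 = (LEAST j. j \<in> H u)"
      have j0: "j0 \<in> H u" unfolding j0_def using \<open>j \<in> H u\<close> by (rule LeastI)
      have "H u \<subseteq> {j0..<j0 + l}"
      proof
        fix k assume k: "k \<in> H u"
        have "j0 \<le> k" unfolding j0_def using k by (rule Least_le)
        moreover have "real k < real j0 + real l" using k j0 unfolding H_def by simp
        ultimately show "k \<in> {j0..<j0 + l}" by simp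
      qed
      then show ?thesis using card_mono[of "{j0..<j0 + l}" "H u"] finite_subset by fastforce
    qed simp
    have "B \<subseteq> R \<union> (\<Union>u\<in>F. H u)"
    proof
      fix j assume "j \<in> B"
      then obtain i where i: "i \<in> {1..l}" "walk f (1/2^N) (j + i) - walk f (1/2^N) j > c * (real i / 2^N)"
        and j: "j < 2^N" by (auto simp: B_def)
      show "j \<in> R \<union> (\<Union>u\<in>F. H u)"
      proof (cases "{real j / 2^N<..real (j + i) / 2^N} \<inter> F = {}")
        case True
        have "c * (real i / 2^N) < f (real (j + i) / 2^N) - f (real j / 2^N)"
          using i by (simp add: walk_diff)
        also have "\<dots> \<le> V (real (j + i) / 2^N) - V (real j / 2^N)"
          using True i j by (intro f_diff in2) (auto intro!: divide_right_mono)
        also have "\<dots> = (\<Sum>r\<in>{j..<j+i}. v r)" using i j by (intro v_sum[symmetric]) auto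
        finally have "j \<in> R" using i j by (auto simp: R_def)
        then show ?thesis by simp
      next
        case False
        then obtain u where u: "u \<in> F" "real j / 2^N < u" "u \<le> real (j + i) / 2^N" by auto
        have "real j < u * 2^N" "u * 2^N \<le> real (j + i)" using u by (simp_all add: field_simps)
        then have "j \<in> H u" using i by (simp add: H_def)
        then show ?thesis using u by blast
      qed
    qed
    then have "card B \<le> card (R \<union> (\<Union>u\<in>F. H u))"
      using F H by (intro card_mono) (auto simp: R_def)
    also have "\<dots> \<le> card R + card (\<Union>u\<in>F. H u)" by (rule card_Un_le)
    also have "card (\<Union>u\<in>F. H u) \<le> (\<Sum>u\<in>F. card (H u))" using F by (intro card_UN_le)
    also have "\<dots> \<le> (\<Sum>u\<in>F. l)" using H by (intro sum_mono) auto
    finally have "card B \<le> card R + card F * l" by simp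
    then have "real (card B) \<le> real (card R + card F * l)" by (simp only: of_nat_le_iff)
    then have 1: "real (card B) \<le> real (card R) + real (card F) * real l" by simp
    have "c / 2^N * real (card R) \<le> (\<Sum>r\<in>{0..<2^N+l}. v r)"
      unfolding R_def by (rule card_rising_le) (rule v_nonneg)
    also have "\<dots> = V (real (2^N+l) / 2^N) - V (real 0 / 2^N)"
      using v_sum[of 0 "2^N+l"] by simp
    also have "\<dots> = infsum g ({real 0 / 2^N<..real (2^N+l) / 2^N} - F)"
      by (rule V_diff) (use in2[of "2^N+l"] in auto)
    also have "\<dots> \<le> infsum g (A - F)"
      using in2[of "2^N+l"] by (intro infsum_mono2 gA) (auto simp: A_def g_def)
    also have "\<dots> \<le> \<kappa>" by (rule tail)
    finally have 2: "real (card R) \<le> \<epsilon> / 2 * 2^N"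
      using \<open>c > 0\<close> by (simp add: \<kappa>_def field_simps)
    have "real (card F) * real l \<le> \<epsilon> / 2 * 2^N"
    proof -
      have "real l = 2^N / 2^m" unfolding l_def using m by (intro two_power_divide[symmetric])
      also have "\<dots> \<le> 2^N / 2^m0" using m by (intro divide_left_mono) auto
      finally have "real (card F) * real l \<le> real (card F) * (2^N / 2^m0)" by (intro mult_left_mono) auto
      also have "\<dots> = real (card F) / 2^m0 * 2^N" by simp
      also have "\<dots> \<le> \<epsilon> / 2 * 2^N" using m0 by (intro mult_right_mono) auto
      finally show ?thesis .
    qed
    with 1 2 have "real (card B) \<le> \<epsilon> / 2 * 2^N + \<epsilon> / 2 * 2^N" by linarith
    then show "real (card {j\<in>{..<2^N}. \<exists>i\<in>{1..2^(N-m)}.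
      walk f (1/2^N) (j + i) - walk f (1/2^N) j > c * (real i / 2^N)}) \<le> \<epsilon> * 2^N"
      unfolding B_def l_def by simp
  qed
qed

text \<open>By stationarity each grid time is as likely a steep start as the origin, so the
  probability equals the expected fraction of steep starts among the grid times before 1. Along each
  pure jump path this fraction tends to 0, and dominated convergence passes this on to the
  expectation. The argument by contradiction supplies the single sequence of meshes
  \<open>n m\<close> that dominated convergence needs.\<close>

lemma steep_start_rare:
  assumes Y: "stat_indep M Y \<nu>"
    and pure: "AE \<omega> in M. \<exists>J. \<forall>x\<ge>0. (J has_sum Y \<omega> x - Y \<omega> 0) {0<..x}"
    and "c > 0" "\<epsilon> > 0"
  shows "\<exists>m. \<forall>N\<ge>m. measure M {\<omega> \<in> space M.
        \<exists>i\<in>{1..2^(N-m)}. walk (Y \<omega>) (1/2^N) i > c * (real i / 2^N)} \<le> \<epsilon>"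
proof (rule ccontr)
  interpret prob_space M using Y by (rule stat_indep_prob_space)
  note [measurable] = measurable_walk[OF Y]
  define ex where "ex N m w \<longleftrightarrow> (\<exists>i\<in>{1..2^(N-m)}. w i > c * (real i / 2^N))" for N m :: nat and w :: "nat \<Rightarrow> real"
  have [measurable]: "Measurable.pred seqM (ex N m)" for N m
    unfolding ex_def[abs_def] by measurable
  assume "\<not> ?thesis"
  then have "\<forall>m. \<exists>N\<ge>m. prob {\<omega> \<in> space M. ex N m (walk (Y \<omega>) (1/2^N))} > \<epsilon>"
    unfolding ex_def by (simp add: not_le)
  then obtain n where n: "\<And>m. n m \<ge> m" "\<And>m. prob {\<omega> \<in> space M. ex (n m) m (walk (Y \<omega>) (1/2^n m))} > \<epsilon>"
    by metis
  define w where "w m \<omega> = walk (Y \<omega>) (1/2^n m)" for m \<omega>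
  have [measurable]: "w m \<in> M \<rightarrow>\<^sub>M seqM" for m unfolding w_def by measurable
  have [measurable]: "(\<lambda>\<omega> i. w m \<omega> (k + i) - w m \<omega> k) \<in> M \<rightarrow>\<^sub>M seqM" for m k
    by (intro measurable_PiM_single') auto
  define B where "B m j = {\<omega> \<in> space M. ex (n m) m (\<lambda>i. w m \<omega> (j + i) - w m \<omega> j)}" for m j
  have B[measurable]: "B m j \<in> events" for m j unfolding B_def by measurable
  have prob_B: "prob (B m j) > \<epsilon>" for m j
  proof -
    \<comment> \<open>With a trivial past the Markov property reduces to stationarity.\<close>
    have "prob {\<omega> \<in> space M. True \<and> ex (n m) m (\<lambda>i. w m \<omega> (j + i) - w m \<omega> j)} =
        prob {\<omega> \<in> space M. True} * prob {\<omega> \<in> space M. ex (n m) m (walk (Y \<omega>) (1/2^n m))}"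
      unfolding w_def by (rule walk_markov[OF Y Y]) auto
    then show ?thesis using n(2)[of m] by (simp add: B_def prob_space)
  qed
  define D where "D m \<omega> = (\<Sum>j<2^n m. indicator (B m j) \<omega>) / (2^n m :: real)" for m \<omega>
  have [measurable]: "D m \<in> borel_measurable M" for m unfolding D_def by measurable
  have int: "integrable M (indicator (B m j) :: 'a \<Rightarrow> real)" for m j
    by (intro integrable_real_indicator) (auto simp: less_top[symmetric])
  have "expectation (D m) > \<epsilon>" for m
  proof -
    have "expectation (D m) = expectation (\<lambda>\<omega>. \<Sum>j<2^n m. indicator (B m j) \<omega>) / 2^n m"
      unfolding D_def by simp
    also have "expectation (\<lambda>\<omega>. \<Sum>j<2^n m. indicator (B m j) \<omega> :: real) = (\<Sum>j<2^n m. expectation (indicator (B m j)))"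
      by (rule Bochner_Integration.integral_sum) (rule int)
    also have "\<dots> = (\<Sum>j<2^n m. prob (B m j))" by simp
    finally have "expectation (D m) = (\<Sum>j<2^n m. prob (B m j)) / 2^n m" .
    moreover have "(\<Sum>j<(2::nat)^n m. \<epsilon>) < (\<Sum>j<2^n m. prob (B m j))"
      using prob_B by (intro sum_strict_mono) (auto simp: lessThan_empty_iff)
    ultimately show ?thesis by (simp add: pos_less_divide_eq mult.commute)
  qed
  moreover have "(\<lambda>m. expectation (D m)) \<longlonglongrightarrow> expectation (\<lambda>_. 0)"
  proof (rule integral_dominated_convergence[where w="\<lambda>_. 1"])
    have D_card: "D m \<omega> = real (card {j\<in>{..<2^n m}. \<omega> \<in> B m j}) / 2^n m" for m \<omega>
      by (simp add: D_def indicator_def sum.If_cases Int_def)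
    have D1: "D m \<omega> \<le> 1" for m \<omega>
    proof -
      have "card {j\<in>{..<2^n m}. \<omega> \<in> B m j} \<le> card {..<(2::nat)^n m}" by (intro card_mono) auto
      then have "real (card {j\<in>{..<2^n m}. \<omega> \<in> B m j}) \<le> real (2^n m)" by (simp only: of_nat_le_iff card_lessThan)
      then show ?thesis by (simp add: D_card)
    qed
    have D0: "0 \<le> D m \<omega>" for m \<omega> by (simp add: D_card)
    show "AE \<omega> in M. norm (D m \<omega>) \<le> 1" for m using D0 D1 by simp
    show "AE \<omega> in M. (\<lambda>m. D m \<omega>) \<longlonglongrightarrow> 0"
      using pure AE_space
    proof eventually_elim
      case (elim \<omega>)
      then obtain J where J: "\<And>x. x \<ge> 0 \<Longrightarrow> (J has_sum Y \<omega> x - Y \<omega> 0) {0<..x}" by blast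
      show ?case
      proof (rule LIMSEQ_I)
        fix r :: real assume "r > 0"
        obtain m0 where m0: "\<forall>m\<ge>m0. \<forall>N\<ge>m. real (card {j\<in>{..<2^N}. \<exists>i\<in>{1..2^(N-m)}.
            walk (Y \<omega>) (1/2^N) (j + i) - walk (Y \<omega>) (1/2^N) j > c * (real i / 2^N)}) \<le> r / 2 * 2^N"
          using pure_jump_slopes_rare[OF J \<open>c > 0\<close>, of "r / 2"] \<open>r > 0\<close> by auto
        have "norm (D m \<omega> - 0) < r" if "m \<ge> m0" for m
        proof -
          have "{j\<in>{..<2^n m}. \<omega> \<in> B m j} = {j\<in>{..<2^n m}. \<exists>i\<in>{1..2^(n m-m)}.
            walk (Y \<omega>) (1/2^n m) (j + i) - walk (Y \<omega>) (1/2^n m) j > c * (real i / 2^n m)}"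
            using elim by (auto simp: B_def ex_def w_def)
          then have "D m \<omega> \<le> r / 2 * 2^n m / 2^n m"
            unfolding D_card using m0[rule_format, OF that n(1)] by (intro divide_right_mono) auto
          then show ?thesis using D0[of m \<omega>] \<open>r > 0\<close> by simp
        qed
        then show "\<exists>no. \<forall>m\<ge>no. norm (D m \<omega> - 0) < r" by blast
      qed
    qed
  qed auto
  ultimately have "\<epsilon> \<le> expectation (\<lambda>_. 0)"
    by (intro LIMSEQ_le_const[where X="\<lambda>m. expectation (D m)"]) (auto intro: less_imp_le)
  then show False using \<open>\<epsilon> > 0\<close> by simp
qed

text \<open>The union over all meshes \<open>N \<ge> m\<close> makes the estimate uniform in the
  mesh. These unions decrease to the empty set, because right-continuity at 0 keeps each path within
  \<open>\<gamma> / 2\<close> of its start on some interval.\<close>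

lemma oscillation_rare:
  assumes Y: "stat_indep M Y \<nu>"
    and rc: "\<And>\<omega>. \<omega> \<in> space M \<Longrightarrow> (Y \<omega> \<longlongrightarrow> Y \<omega> 0) (at_right 0)"
    and "\<gamma> > 0" "\<epsilon> > 0"
  shows "\<exists>m. \<forall>N\<ge>m. measure M {\<omega> \<in> space M. oscillates \<gamma> (2^(N-m)) (walk (Y \<omega>) (1/2^N))} \<le> \<epsilon>"
proof -
  interpret prob_space M using Y by (rule stat_indep_prob_space)
  note [measurable] = measurable_walk[OF Y]
  define A where "A m N = {\<omega> \<in> space M. oscillates \<gamma> (2^(N-m)) (walk (Y \<omega>) (1/2^N))}" for m N
  have A[measurable]: "A m N \<in> events" for m N unfolding A_def by measurable
  define U where "U m = (\<Union>N\<in>{m..}. A m N)" for m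
  have U[measurable]: "U m \<in> events" for m unfolding U_def by measurable
  have "A (Suc m) N \<subseteq> A m N" for m N
  proof -
    have "(2::nat)^(N - Suc m) \<le> 2^(N-m)" by (intro power_increasing) auto
    then show ?thesis unfolding A_def oscillates_def by (blast intro: le_trans)
  qed
  then have "U (Suc m) \<subseteq> U m" for m unfolding U_def by fastforce
  then have "decseq U" by (rule decseq_SucI)
  have "\<omega> \<notin> (\<Inter>m. U m)" for \<omega>
  proof
    assume *: "\<omega> \<in> (\<Inter>m. U m)"
    then have "\<omega> \<in> space M" using sets.sets_into_space[OF U] by blast
    then have "\<forall>\<^sub>F s in at_right 0. dist (Y \<omega> s) (Y \<omega> 0) < \<gamma> / 2"
      using tendstoD[OF rc[OF \<open>\<omega> \<in> space M\<close>], of "\<gamma> / 2"] \<open>\<gamma> > 0\<close> by simp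
    then obtain d where d: "d > 0" "\<And>s. 0 < s \<Longrightarrow> s < d \<Longrightarrow> \<bar>Y \<omega> s - Y \<omega> 0\<bar> < \<gamma> / 2"
      unfolding eventually_at_right_field dist_real_def by blast
    obtain m where m: "(1/2)^m < d" using real_arch_pow_inv[of d "1/2"] d by auto
    obtain N where N: "N \<ge> m" "\<omega> \<in> A m N" using * by (auto simp: U_def)
    have small: "\<bar>walk (Y \<omega>) (1/2^N) i\<bar> < \<gamma> / 2" if "i \<le> 2^(N-m)" for i
    proof (cases "i = 0")
      case False
      have "real i \<le> real (2^(N-m))" using that by (simp only: of_nat_le_iff)
      also have "\<dots> = 2^N / 2^m" using N by (intro two_power_divide[symmetric])
      finally have "real i / 2^N \<le> (1/2)^m" by (simp add: field_simps power_divide)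
      then show ?thesis using d(2)[of "real i / 2^N"] m False by (simp add: walk_def)
    qed (use \<open>\<gamma> > 0\<close> in \<open>simp add: walk_def\<close>)
    obtain i j where "i \<le> 2^(N-m)" "j \<le> 2^(N-m)" "\<bar>walk (Y \<omega>) (1/2^N) i - walk (Y \<omega>) (1/2^N) j\<bar> > \<gamma>"
      using N by (auto simp: A_def oscillates_def)
    then show False using small[of i] small[of j] by linarith
  qed
  then have "(\<Inter>m. U m) = {}" by blast
  moreover have "(\<lambda>m. prob (U m)) \<longlonglongrightarrow> prob (\<Inter>m. U m)"
    using \<open>decseq U\<close> by (intro finite_Lim_measure_decseq) auto
  ultimately have "\<forall>\<^sub>F m in sequentially. prob (U m) < \<epsilon>"
    using \<open>\<epsilon> > 0\<close> by (intro order_tendstoD) auto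
  then obtain m where m: "prob (U m) < \<epsilon>" by (auto simp: eventually_sequentially)
  have "prob (A m N) \<le> \<epsilon>" if "N \<ge> m" for N
  proof -
    have "prob (A m N) \<le> prob (U m)" by (rule finite_measure_mono) (use that in \<open>auto simp: U_def\<close>)
    then show ?thesis using m by simp
  qed
  then show ?thesis unfolding A_def by blast
qed

text \<open>Refining the grid while lowering the slack gives decreasing events. A path in all of
  them is below the parabola at all dyadic times up to \<open>1/2^m\<close>, hence by
  right-continuity at all times before \<open>1/2^m\<close>, and almost no path is. A grid level and
  a slack can thus be chosen together.\<close>

lemma parabola_start_rare:
  assumes Y: "stat_indep M Y \<nu>"
    and rc: "\<And>\<omega> t. \<omega> \<in> space M \<Longrightarrow> (Y \<omega> \<longlongrightarrow> Y \<omega> t) (at_right t)"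
    and B: "AE \<omega> in M. \<not> (\<exists>e>0. \<forall>h\<in>{0<..<e}. Y \<omega> h - Y \<omega> 0 \<le> h\<^sup>2 / 2)"
    and "\<epsilon> > 0"
  shows "\<exists>n\<ge>m. \<exists>q>0. measure M {\<omega> \<in> space M. below n 1 q m (walk (Y \<omega>) (1/2^n))} \<le> \<epsilon>"
proof -
  interpret prob_space M using Y by (rule stat_indep_prob_space)
  note [measurable] = measurable_walk[OF Y]
  define U where "U k = {\<omega> \<in> space M. below (m + k) 1 (1/2^(m+k)) m (walk (Y \<omega>) (1/2^(m+k)))}" for k
  have U[measurable]: "U k \<in> events" for k unfolding U_def by measurable
  have U_iff: "\<omega> \<in> U k \<longleftrightarrow> \<omega> \<in> space M \<and>
      (\<forall>i\<in>{1..2^k}. Y \<omega> (real i / 2^(m+k)) - Y \<omega> 0 \<le> (real i / 2^(m+k))\<^sup>2 / 2 + 1/2^(m+k))" for \<omega> k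
    by (simp add: U_def below_def walk_def)
  have refine: "U (Suc k) \<subseteq> U k" for k
  proof
    fix \<omega> assume *: "\<omega> \<in> U (Suc k)"
    have "Y \<omega> (real i / 2^(m+k)) - Y \<omega> 0 \<le> (real i / 2^(m+k))\<^sup>2 / 2 + 1/2^(m+k)" if "i \<in> {1..2^k}" for i
    proof -
      have "2 * i \<in> {1..2^Suc k}" using that by auto
      then have "Y \<omega> (real (2 * i) / 2^(m+Suc k)) - Y \<omega> 0 \<le> (real (2 * i) / 2^(m+Suc k))\<^sup>2 / 2 + 1/2^(m+Suc k)"
        using * unfolding U_iff by blast
      moreover have "real (2 * i) / 2^(m+Suc k) = real i / 2^(m+k)" by simp
      moreover have "(1::real) / 2^(m+Suc k) \<le> 1/2^(m+k)" by (simp add: field_simps)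
      ultimately show ?thesis by (simp only:)
    qed
    then show "\<omega> \<in> U k" using * by (simp add: U_iff)
  qed
  then have "decseq U" by (rule decseq_SucI)
  have "(\<Inter>k. U k) \<subseteq> {\<omega> \<in> space M. \<exists>e>0. \<forall>h\<in>{0<..<e}. Y \<omega> h - Y \<omega> 0 \<le> h\<^sup>2 / 2}"
  proof
    fix \<omega> assume *: "\<omega> \<in> (\<Inter>k. U k)"
    then have "\<omega> \<in> space M" by (auto simp: U_def)
    have dyadic: "Y \<omega> (real i / 2^(m+k)) - Y \<omega> 0 \<le> (real i / 2^(m+k))\<^sup>2 / 2" if i: "i \<in> {1..2^k}" for i k
    proof (rule LIMSEQ_le_const)
      have "(\<lambda>r. (real i / 2^(m+k))\<^sup>2 / 2 + (1/2)^r :: real) \<longlonglongrightarrow> (real i / 2^(m+k))\<^sup>2 / 2 + 0"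
        by (intro tendsto_intros LIMSEQ_power_zero) simp
      then show "(\<lambda>r. (real i / 2^(m+k))\<^sup>2 / 2 + (1/2)^r :: real) \<longlonglongrightarrow> (real i / 2^(m+k))\<^sup>2 / 2" by simp
      have "Y \<omega> (real i / 2^(m+k)) - Y \<omega> 0 \<le> (real i / 2^(m+k))\<^sup>2 / 2 + (1/2)^r" for r
      proof -
        \<comment> \<open>The same time on a grid that is \<open>r\<close> levels finer, where the
          slack is at most \<open>(1/2)^r\<close>.\<close>
        have "i * 2^r \<in> {1..2^(k+r)}" using i by (auto simp: power_add)
        then have "Y \<omega> (real (i * 2^r) / 2^(m+(k+r))) - Y \<omega> 0 \<le> (real (i * 2^r) / 2^(m+(k+r)))\<^sup>2 / 2 + 1/2^(m+(k+r))"
          using * unfolding U_iff INT_iff by blast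
        moreover have "real (i * 2^r) / 2^(m+(k+r)) = real i / 2^(m+k)" by (simp add: power_add)
        moreover have "1/2^(m+(k+r)) \<le> ((1/2)^r :: real)"
        proof -
          have "(1/2)^(m+(k+r)) \<le> ((1/2)^r :: real)" by (intro power_decreasing) auto
          then show ?thesis by (simp add: power_divide)
        qed
        ultimately show ?thesis by (simp only:)
      qed
      then show "\<exists>N. \<forall>r\<ge>N. Y \<omega> (real i / 2^(m+k)) - Y \<omega> 0 \<le> (real i / 2^(m+k))\<^sup>2 / 2 + (1/2)^r" by blast
    qed
    have "Y \<omega> h - Y \<omega> 0 \<le> h\<^sup>2 / 2" if h: "h \<in> {0<..<1/2^m}" for h
    proof -
      have "h > 0" using h by simp
      obtain k :: "nat \<Rightarrow> nat" where k: "\<And>N. real (k N) / 2^N < h" "\<And>N. h \<le> (real (k N) + 1) / 2^N"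
        using dyadic_below_exists[OF \<open>h > 0\<close>] by blast
      define t where "t N = real (k N + 2) / 2^N" for N
      have t: "filterlim t (at_right h) sequentially"
        using dyadic_neighbours(2)[of k h, OF k] by (simp add: t_def[abs_def])
      then have th: "t \<longlonglongrightarrow> h" by (simp add: filterlim_at)
      have Yt: "(\<lambda>N. Y \<omega> (t N)) \<longlonglongrightarrow> Y \<omega> h" using filterlim_compose[OF rc[OF \<open>\<omega> \<in> space M\<close>] t] .
      have "\<forall>\<^sub>F N in sequentially. t N < 1/2^m" using th h by (intro order_tendstoD) auto
      moreover have "\<forall>\<^sub>F N in sequentially. N \<ge> m" by (rule eventually_ge_at_top)
      ultimately have ev: "\<forall>\<^sub>F N in sequentially. Y \<omega> (t N) - Y \<omega> 0 \<le> (t N)\<^sup>2 / 2"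
      proof eventually_elim
        case (elim N)
        have "real (k N + 2) < 2^N / 2^m" using elim(1) by (simp add: t_def field_simps)
        also have "\<dots> = real (2^(N-m))" using elim by (intro two_power_divide)
        finally have "k N + 2 < 2^(N-m)" by (simp only: of_nat_less_iff)
        then show ?case using dyadic[of "k N + 2" "N - m"] elim by (simp add: t_def)
      qed
      have l1: "(\<lambda>N. Y \<omega> (t N) - Y \<omega> 0) \<longlonglongrightarrow> Y \<omega> h - Y \<omega> 0" by (intro tendsto_intros Yt)
      have l2: "(\<lambda>N. (t N)\<^sup>2 / 2) \<longlonglongrightarrow> h\<^sup>2 / 2" by (intro tendsto_intros th) auto
      show ?thesis by (rule tendsto_le[OF sequentially_bot l2 l1 ev])
    qed
    then show "\<omega> \<in> {\<omega> \<in> space M. \<exists>e>0. \<forall>h\<in>{0<..<e}. Y \<omega> h - Y \<omega> 0 \<le> h\<^sup>2 / 2}"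
      using \<open>\<omega> \<in> space M\<close> by (auto intro!: exI[of _ "1/2^m"])
  qed
  then have "AE \<omega> in M. \<omega> \<notin> (\<Inter>k. U k)"
    by (intro eventually_mono[OF B]) blast
  moreover have "(\<Inter>k. U k) \<in> events" by measurable
  ultimately have "prob (\<Inter>k. U k) = 0" by (subst prob_eq_0) auto
  moreover have "(\<lambda>k. prob (U k)) \<longlonglongrightarrow> prob (\<Inter>k. U k)"
    using \<open>decseq U\<close> by (intro finite_Lim_measure_decseq) auto
  ultimately have "\<forall>\<^sub>F k in sequentially. prob (U k) < \<epsilon>"
    using \<open>\<epsilon> > 0\<close> by (intro order_tendstoD) auto
  then obtain k where "prob (U k) < \<epsilon>" by (auto simp: eventually_sequentially)
  then show ?thesis
    unfolding U_def by (intro exI[of _ "m + k"] conjI exI[of _ "1/2^(m+k)"]) auto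
qed

section \<open>Maximizers of cadlag paths\<close>

definition upper :: "(real \<Rightarrow> real) \<Rightarrow> real \<Rightarrow> real" where
  "upper f z = max (f z) (left_lim f z)"

text \<open>A relation in place of the greatest maximizer \<open>a_map\<close>: it is closed under
  limits in both arguments, and uniqueness can be stated where it holds.\<close>

definition maximizer :: "(real \<Rightarrow> real) \<Rightarrow> real \<Rightarrow> real \<Rightarrow> bool" where
  "maximizer f x y \<longleftrightarrow> (\<forall>z. upper f z - (z - x)\<^sup>2 / 2 \<le> upper f y - (y - x)\<^sup>2 / 2)"

lemma cadlag_right: "cadlag f \<Longrightarrow> (f \<longlongrightarrow> f y) (at_right y)"
  by (auto simp: cadlag_def continuous_within)

lemma left_lim_eq: "(f \<longlongrightarrow> l) (at_left y) \<Longrightarrow> left_lim f y = l"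
  unfolding left_lim_def by (rule tendsto_Lim) auto

lemma cadlag_left: "cadlag f \<Longrightarrow> (f \<longlongrightarrow> left_lim f y) (at_left y)"
  unfolding cadlag_def using left_lim_eq by metis

lemma upper_ge: "f z \<le> upper f z" "left_lim f z \<le> upper f z"
  by (simp_all add: upper_def)

lemma left_lim_le:
  assumes "cadlag f" and "\<forall>\<^sub>F t in at_left z. f t \<le> g t" and "(g \<longlongrightarrow> c) (at_left z)"
  shows "left_lim f z \<le> c"
  using tendsto_le[OF _ assms(3) cadlag_left[OF assms(1)] assms(2)] by simp

text \<open>Near \<open>y\<close> left limits are controlled as well, because points just to the
  left of \<open>z > y\<close> still lie to the right of \<open>y\<close>.\<close>

lemma upper_at_right:
  assumes "cadlag f" "\<eta> > 0"
  shows "\<forall>\<^sub>F z in at_right y. upper f z < f y + \<eta>"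
proof -
  have "\<forall>\<^sub>F t in at_right y. f t < f y + \<eta> / 2"
    using assms by (intro order_tendstoD(2)[OF cadlag_right]) auto
  then obtain d where d: "d > y" "\<And>t. y < t \<Longrightarrow> t < d \<Longrightarrow> f t < f y + \<eta> / 2"
    unfolding eventually_at_right_field by blast
  have "upper f z < f y + \<eta>" if z: "y < z" "z < d" for z
  proof -
    have "\<forall>\<^sub>F t in at_left z. f t \<le> f y + \<eta> / 2"
      unfolding eventually_at_left_field using z d by (intro exI[of _ y]) (auto intro: less_imp_le)
    then have "left_lim f z \<le> f y + \<eta> / 2"
      using \<open>cadlag f\<close> by (intro left_lim_le[where g="\<lambda>_. f y + \<eta> / 2"]) auto
    then show ?thesis using d(2)[OF z] \<open>\<eta> > 0\<close> by (simp add: upper_def)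
  qed
  then show ?thesis unfolding eventually_at_right_field using d by blast
qed

lemma upper_at_left:
  assumes "cadlag f" "\<eta> > 0"
  shows "\<forall>\<^sub>F z in at_left y. upper f z < left_lim f y + \<eta>"
proof -
  have "\<forall>\<^sub>F t in at_left y. f t < left_lim f y + \<eta> / 2"
    using assms by (intro order_tendstoD(2)[OF cadlag_left]) auto
  then obtain d where d: "d < y" "\<And>t. d < t \<Longrightarrow> t < y \<Longrightarrow> f t < left_lim f y + \<eta> / 2"
    unfolding eventually_at_left_field by blast
  have "upper f z < left_lim f y + \<eta>" if z: "d < z" "z < y" for z
  proof -
    have "\<forall>\<^sub>F t in at_left z. f t \<le> left_lim f y + \<eta> / 2"
      unfolding eventually_at_left_field using z d by (intro exI[of _ d]) (auto intro: less_imp_le)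
    then have "left_lim f z \<le> left_lim f y + \<eta> / 2"
      using \<open>cadlag f\<close> by (intro left_lim_le[where g="\<lambda>_. left_lim f y + \<eta> / 2"]) auto
    then show ?thesis using d(2)[OF z] \<open>\<eta> > 0\<close> by (simp add: upper_def)
  qed
  then show ?thesis unfolding eventually_at_left_field using d by blast
qed

lemma upper_usc:
  assumes "cadlag f" "\<eta> > 0"
  shows "\<forall>\<^sub>F z in nhds y. upper f z < upper f y + \<eta>"
proof -
  have "\<forall>\<^sub>F z in at_right y. upper f z < upper f y + \<eta>"
    using upper_at_right[OF assms, of y] by eventually_elim (use upper_ge[of f y] in linarith)
  moreover have "\<forall>\<^sub>F z in at_left y. upper f z < upper f y + \<eta>"
    using upper_at_left[OF assms, of y] by eventually_elim (use upper_ge[of f y] in linarith)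
  ultimately show ?thesis
    using \<open>\<eta> > 0\<close> by (simp add: eventually_nhds_conv_at eventually_at_split)
qed

lemma usc_attains_max:
  fixes \<phi> :: "real \<Rightarrow> real"
  assumes "compact S" "S \<noteq> {}"
    and usc: "\<And>y \<eta>. \<eta> > 0 \<Longrightarrow> \<forall>\<^sub>F z in nhds y. \<phi> z < \<phi> y + \<eta>"
  shows "\<exists>y\<in>S. \<forall>z\<in>S. \<phi> z \<le> \<phi> y"
proof (rule ccontr)
  assume "\<not> ?thesis"
  then have "\<forall>y\<in>S. \<exists>z\<in>S. \<phi> y < \<phi> z" by (simp add: not_le)
  then obtain g where g: "\<And>y. y \<in> S \<Longrightarrow> g y \<in> S \<and> \<phi> y < \<phi> (g y)" by metis
  have "\<exists>U. open U \<and> y \<in> U \<and> (\<forall>z\<in>U. \<phi> z < \<phi> (g y))" if "y \<in> S" for y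
    using usc[of "\<phi> (g y) - \<phi> y" y] g[OF that] by (auto simp: eventually_nhds)
  then obtain U where U: "\<And>y. y \<in> S \<Longrightarrow> open (U y) \<and> y \<in> U y \<and> (\<forall>z\<in>U y. \<phi> z < \<phi> (g y))" by metis
  have "S \<subseteq> (\<Union>y\<in>S. U y)" using U by blast
  then obtain C where C: "C \<subseteq> S" "finite C" "S \<subseteq> (\<Union>y\<in>C. U y)"
    using compactE_image[OF \<open>compact S\<close>, of S U] U by blast
  have "C \<noteq> {}" using C \<open>S \<noteq> {}\<close> by auto
  obtain c where c: "c \<in> C" "\<And>y. y \<in> C \<Longrightarrow> \<phi> (g y) \<le> \<phi> (g c)"
  proof -
    have "Max ((\<lambda>y. \<phi> (g y)) ` C) \<in> (\<lambda>y. \<phi> (g y)) ` C" using C \<open>C \<noteq> {}\<close> by (intro Max_in) auto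
    then obtain c where "c \<in> C" "\<phi> (g c) = Max ((\<lambda>y. \<phi> (g y)) ` C)" by auto
    then show ?thesis using that C(2) by (auto intro!: Max_ge)
  qed
  have "g c \<in> S" using c C g by blast
  then obtain y where "y \<in> C" "g c \<in> U y" using C by blast
  then have "\<phi> (g c) < \<phi> (g y)" using U C by blast
  then show False using c(2)[OF \<open>y \<in> C\<close>] by simp
qed

text \<open>The competitor \<open>z\<close> is fixed, so only the value of \<open>upper f\<close> at
  \<open>ys n\<close> moves, and for that upper semicontinuity goes in the right direction.\<close>

lemma maximizer_closed:
  assumes "cadlag f" and "xs \<longlonglongrightarrow> x" "ys \<longlonglongrightarrow> y" and max: "\<And>n. maximizer f (xs n) (ys n)"
  shows "maximizer f x y"
  unfolding maximizer_def
proof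
  fix z
  have "upper f z - (z - x)\<^sup>2 / 2 + (y - x)\<^sup>2 / 2 \<le> upper f y + \<eta>" if "\<eta> > 0" for \<eta>
  proof (rule LIMSEQ_le_const2)
    show "(\<lambda>n. upper f z - (z - xs n)\<^sup>2 / 2 + (ys n - xs n)\<^sup>2 / 2) \<longlonglongrightarrow>
        upper f z - (z - x)\<^sup>2 / 2 + (y - x)\<^sup>2 / 2"
      by (intro tendsto_intros assms) auto
    have "\<forall>\<^sub>F n in sequentially. upper f (ys n) < upper f y + \<eta>"
      using upper_usc[OF assms(1) that] assms(3) by (rule eventually_compose_filterlim)
    then obtain N where N: "\<And>n. n \<ge> N \<Longrightarrow> upper f (ys n) < upper f y + \<eta>"
      by (auto simp: eventually_sequentially)
    have "upper f z - (z - xs n)\<^sup>2 / 2 + (ys n - xs n)\<^sup>2 / 2 \<le> upper f y + \<eta>" if "n \<ge> N" for n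
      using max[of n, unfolded maximizer_def, rule_format, of z] N[OF that] by linarith
    then show "\<exists>N. \<forall>n\<ge>N. upper f z - (z - xs n)\<^sup>2 / 2 + (ys n - xs n)\<^sup>2 / 2 \<le> upper f y + \<eta>"
      by blast
  qed
  then have "upper f z - (z - x)\<^sup>2 / 2 + (y - x)\<^sup>2 / 2 \<le> upper f y" by (rule field_le_epsilon)
  then show "upper f z - (z - x)\<^sup>2 / 2 \<le> upper f y - (y - x)\<^sup>2 / 2" by simp
qed

section \<open>Order and size of maximizers\<close>

lemma maximizer_slope:
  "maximizer f x y \<Longrightarrow> upper f z \<le> upper f y + (z - y) * ((z - x) + (y - x)) / 2"
proof -
  assume "maximizer f x y"
  then have "upper f z - (z - x)\<^sup>2 / 2 \<le> upper f y - (y - x)\<^sup>2 / 2" by (simp add: maximizer_def)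
  moreover have "(z - x)\<^sup>2 / 2 - (y - x)\<^sup>2 / 2 = (z - y) * ((z - x) + (y - x)) / 2"
    by (simp add: power2_eq_square field_simps)
  ultimately show ?thesis by linarith
qed

lemma maximizer_slope_le:
  assumes "maximizer f x y" "(z - y) * ((z - x) + (y - x)) \<le> 2 * p"
  shows "upper f z \<le> upper f y + p"
proof -
  have "(z - y) * ((z - x) + (y - x)) / 2 \<le> p" using assms(2) by (simp only: divide_le_eq) simp
  then show ?thesis using maximizer_slope[OF assms(1), of z] by linarith
qed

text \<open>Adding the two optimality inequalities cancels the path and leaves
  \<open>(y2 - y1) * (x2 - x1) \<ge> 0\<close>.\<close>

lemma maximizer_mono:
  assumes "maximizer f x1 y1" "maximizer f x2 y2" "x1 < x2"
  shows "y1 \<le> y2"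
proof (rule ccontr)
  assume "\<not> y1 \<le> y2"
  have "upper f y2 \<le> upper f y1 + (y2 - y1) * ((y2 - x1) + (y1 - x1)) / 2"
    "upper f y1 \<le> upper f y2 + (y1 - y2) * ((y1 - x2) + (y2 - x2)) / 2"
    using maximizer_slope[OF assms(1)] maximizer_slope[OF assms(2)] by blast+
  then have "0 \<le> (y2 - y1) * ((y2 - x1) + (y1 - x1)) / 2 + (y1 - y2) * ((y1 - x2) + (y2 - x2)) / 2"
    by linarith
  also have "\<dots> = (y2 - y1) * (x2 - x1)" by (simp add: field_simps)
  also have "\<dots> < 0" using \<open>\<not> y1 \<le> y2\<close> \<open>x1 < x2\<close> by (intro mult_neg_pos) auto
  finally show False by simp
qed

lemma upper_subquadratic:
  assumes "cadlag f" "hypA f" "e > 0"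
  shows "\<exists>R. \<forall>z. \<bar>z\<bar> > R \<longrightarrow> upper f z \<le> e * z\<^sup>2"
proof -
  have "\<forall>\<^sub>F x in at_infinity. dist (f x / x\<^sup>2) 0 < e"
    using assms unfolding hypA_def by (intro tendstoD)
  then obtain R where R: "\<And>x. \<bar>x\<bar> \<ge> R \<Longrightarrow> \<bar>f x / x\<^sup>2\<bar> < e"
    by (auto simp: eventually_at_infinity dist_real_def)
  have f_le: "f x \<le> e * x\<^sup>2" if "\<bar>x\<bar> \<ge> max R 1" for x
  proof -
    have "f x / x\<^sup>2 < e" by (rule order.strict_trans1[OF abs_ge_self R]) (use that in simp)
    moreover have "x\<^sup>2 > 0" using that by (auto simp: zero_less_power2)
    ultimately show ?thesis by (simp add: divide_less_eq)
  qed
  have "upper f z \<le> e * z\<^sup>2" if z: "\<bar>z\<bar> > max R 1" for z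
  proof -
    have "\<forall>\<^sub>F t in at_left z. \<bar>t\<bar> > max R 1"
      by (rule order_tendstoD(1)[OF tendsto_rabs[OF tendsto_ident_at] z])
    then have "\<forall>\<^sub>F t in at_left z. f t \<le> e * t\<^sup>2"
      by eventually_elim (intro f_le less_imp_le)
    moreover have "((\<lambda>t. e * t\<^sup>2) \<longlongrightarrow> e * z\<^sup>2) (at_left z)" by (intro tendsto_intros)
    ultimately have "left_lim f z \<le> e * z\<^sup>2" by (rule left_lim_le[OF assms(1)])
    then show ?thesis using f_le[of z] z by (simp add: upper_def)
  qed
  then show ?thesis by blast
qed

lemma maximizers_bounded:
  assumes "cadlag f" "hypA f"
  shows "\<exists>K. \<forall>x y. \<bar>x\<bar> \<le> b \<longrightarrow> K < \<bar>y\<bar> \<longrightarrow>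
    upper f y - (y - x)\<^sup>2 / 2 < upper f 0 - (0 - x)\<^sup>2 / 2"
proof -
  obtain R where R: "\<And>z. \<bar>z\<bar> > R \<Longrightarrow> upper f z \<le> 1/8 * z\<^sup>2"
    using upper_subquadratic[OF assms, of "1/8"] by auto
  \<comment> \<open>Of half the square of \<open>y\<close>, the path and the cross term
    \<open>x * y\<close> take at most an eighth of the square each; the remaining quarter exceeds
    \<open>\<bar>upper f 0\<bar>\<close>, since the square of \<open>y\<close> is at least
    \<open>\<bar>y\<bar>\<close>.\<close>
  define K where "K = max R (max (8 * b) (1 + 4 * \<bar>upper f 0\<bar>))"
  have "upper f y - (y - x)\<^sup>2 / 2 < upper f 0 - (0 - x)\<^sup>2 / 2" if x: "\<bar>x\<bar> \<le> b" and y: "\<bar>y\<bar> > K" for x y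
  proof -
    have y': "\<bar>y\<bar> > R" "\<bar>y\<bar> > 8 * b" "\<bar>y\<bar> > 1 + 4 * \<bar>upper f 0\<bar>" using y by (auto simp: K_def)
    have "x * y \<le> \<bar>x\<bar> * \<bar>y\<bar>" by (metis abs_ge_self abs_mult)
    also have "\<dots> \<le> (\<bar>y\<bar> / 8) * \<bar>y\<bar>" using x y' by (intro mult_right_mono) auto
    finally have xy: "x * y \<le> y\<^sup>2 / 8" by (simp add: power2_eq_square abs_mult[symmetric])
    have "\<bar>y\<bar> * 1 \<le> \<bar>y\<bar> * \<bar>y\<bar>" using y' by (intro mult_left_mono) auto
    then have "y\<^sup>2 \<ge> \<bar>y\<bar>" by (simp add: power2_eq_square abs_mult[symmetric])
    then have "y\<^sup>2 > 4 * \<bar>upper f 0\<bar>" using y' by linarith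
    moreover have "(y - x)\<^sup>2 / 2 = y\<^sup>2 / 2 - x * y + (0 - x)\<^sup>2 / 2"
      by (simp add: power2_eq_square field_simps)
    ultimately show ?thesis using R[OF y'(1)] xy by linarith
  qed
  then show ?thesis by blast
qed

text \<open>\<open>GREATEST\<close> has a meaning only if the maximizers have a greatest element:
  they exist by upper semicontinuity on a compact interval, and they form a closed bounded
  set.\<close>

lemma a_map_maximizer:
  assumes "cadlag f" "hypA f"
  shows "maximizer f x (a_map f x)" and "maximizer f x y \<Longrightarrow> y \<le> a_map f x"
proof -
  define \<phi> where "\<phi> z = upper f z - (z - x)\<^sup>2 / 2" for z
  obtain K where K: "\<And>y. \<bar>y\<bar> > K \<Longrightarrow> \<phi> y < \<phi> 0"
    using maximizers_bounded[OF assms, of "\<bar>x\<bar>"] unfolding \<phi>_def by blast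
  have "K \<ge> 0" using K[of 0] by (cases "K \<ge> 0") auto
  have usc: "\<forall>\<^sub>F z in nhds y. \<phi> z < \<phi> y + \<eta>" if "\<eta> > 0" for y \<eta>
  proof -
    have "\<forall>\<^sub>F z in nhds y. upper f z < upper f y + \<eta> / 2"
      using that assms by (intro upper_usc) auto
    moreover have "\<forall>\<^sub>F z in nhds y. (z - x)\<^sup>2 / 2 > (y - x)\<^sup>2 / 2 - \<eta> / 2"
    proof -
      have "((\<lambda>z. (z - x)\<^sup>2 / 2) \<longlongrightarrow> (y - x)\<^sup>2 / 2) (nhds y)"
        by (intro tendsto_intros) (auto simp: filterlim_ident)
      then show ?thesis using that by (intro order_tendstoD) auto
    qed
    ultimately show ?thesis by eventually_elim (simp add: \<phi>_def)
  qed
  have "\<exists>y\<in>{-K..K}. \<forall>z\<in>{-K..K}. \<phi> z \<le> \<phi> y"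
    using \<open>K \<ge> 0\<close> usc by (intro usc_attains_max) auto
  then obtain y0 where y0: "y0 \<in> {-K..K}" "\<And>z. z \<in> {-K..K} \<Longrightarrow> \<phi> z \<le> \<phi> y0" by blast
  have y0_max: "\<phi> z \<le> \<phi> y0" for z
  proof (cases "\<bar>z\<bar> > K")
    case True
    have "\<phi> z < \<phi> 0" using K[OF True] .
    also have "\<phi> 0 \<le> \<phi> y0" using \<open>K \<ge> 0\<close> by (intro y0) auto
    finally show ?thesis by simp
  qed (intro y0, auto)
  define S where "S = {y. maximizer f x y}"
  have "y0 \<in> S" using y0_max by (simp add: S_def maximizer_def \<phi>_def)
  have "closed S"
    unfolding closed_sequential_limits S_def
    using maximizer_closed[OF assms(1) tendsto_const] by blast
  moreover have "bounded S"
  proof -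
    have "\<bar>y\<bar> \<le> K" if "y \<in> S" for y
    proof (rule ccontr)
      assume "\<not> \<bar>y\<bar> \<le> K"
      then have "\<phi> y < \<phi> 0" by (intro K) simp
      moreover have "\<phi> 0 \<le> \<phi> y" using that unfolding S_def maximizer_def \<phi>_def mem_Collect_eq by blast
      ultimately show False by simp
    qed
    then show ?thesis by (auto simp: bounded_iff)
  qed
  ultimately have "compact S" by (simp add: compact_eq_bounded_closed)
  then obtain s where s: "s \<in> S" "\<And>y. y \<in> S \<Longrightarrow> y \<le> s"
    using compact_attains_sup[of S] \<open>y0 \<in> S\<close> by blast
  have "a_map f x = (GREATEST y. y \<in> S)"
    unfolding a_map_def S_def maximizer_def upper_def by simp
  also have "\<dots> = s" using s by (intro Greatest_equality) auto
  finally have "a_map f x = s" .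
  then show "maximizer f x (a_map f x)" "maximizer f x y \<Longrightarrow> y \<le> a_map f x"
    using s by (auto simp: S_def)
qed

text \<open>A centre far to the right would prefer \<open>B + 1\<close> to every \<open>y\<close> in
  \<open>{-B..B}\<close>, and likewise on the left. Hence the centres that belong to a convergent
  sequence of maximizers have a convergent subsequence.\<close>

lemma maximized_points_bounded:
  assumes "cadlag f"
  shows "\<exists>C. \<forall>x y. \<bar>y\<bar> \<le> B \<longrightarrow> maximizer f x y \<longrightarrow> \<bar>x\<bar> \<le> C"
proof (cases "B \<ge> 0")
  case True
  have "\<exists>y\<in>{-B..B}. \<forall>z\<in>{-B..B}. upper f z \<le> upper f y"
    using True upper_usc[OF assms] by (intro usc_attains_max) auto
  then obtain c where "\<And>z. z \<in> {-B..B} \<Longrightarrow> upper f z \<le> c" by blast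
  then have c: "upper f z \<le> c" if "\<bar>z\<bar> \<le> B" for z using that by (simp add: abs_le_iff)
  define C where "C = B + 1 + \<bar>c\<bar> + \<bar>upper f (B + 1)\<bar> + \<bar>upper f (- B - 1)\<bar>"
  have "\<bar>x\<bar> \<le> C" if y: "\<bar>y\<bar> \<le> B" and max: "maximizer f x y" for x y
  proof (rule ccontr)
    assume *: "\<not> \<bar>x\<bar> \<le> C"
    have "x > B + 1 \<or> x < - B - 1" using * True by (auto simp: C_def)
    then show False
    proof
      assume x: "x > B + 1"
      have "(B + 1 - y) * ((B + 1 - x) + (y - x)) = - ((B + 1 - y) * (2 * x - B - 1 - y))"
        by (simp add: algebra_simps)
      also have "\<dots> \<le> - (1 * (2 * x - 2 * B - 1))"
        using x y True by (intro le_imp_neg_le mult_mono) auto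
      also have "\<dots> = 2 * (B + 1 / 2 - x)" by simp
      finally have "upper f (B + 1) \<le> upper f y + (B + 1 / 2 - x)"
        by (rule maximizer_slope_le[OF max])
      then have "x \<le> B + 1 + c - upper f (B + 1)" using c[OF y] by linarith
      then show False using * x True by (simp add: C_def)
    next
      assume x: "x < - B - 1"
      have "(- B - 1 - y) * ((- B - 1 - x) + (y - x)) = - ((B + 1 + y) * (- 2 * x - B - 1 + y))"
        by (simp add: algebra_simps)
      also have "\<dots> \<le> - (1 * (- 2 * x - 2 * B - 1))"
        using x y True by (intro le_imp_neg_le mult_mono) auto
      also have "\<dots> = 2 * (B + 1 / 2 + x)" by simp
      finally have "upper f (- B - 1) \<le> upper f y + (B + 1 / 2 + x)"
        by (rule maximizer_slope_le[OF max])
      then have "- x \<le> B + 1 + c - upper f (- B - 1)" using c[OF y] by linarith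
      then show False using * x True by (simp add: C_def)
    qed
  qed
  then show ?thesis by blast
qed auto

lemma calA_maximizer:
  assumes "cadlag f" "hypA f" "y \<in> calA f"
  shows "\<exists>x. maximizer f x y"
proof -
  obtain ys where ys: "\<forall>n. ys n \<in> range (a_map f)" "ys \<longlonglongrightarrow> y"
    using assms(3) unfolding calA_def closure_sequential by (elim exE conjE)
  then have "\<forall>n. \<exists>x. ys n = a_map f x" by auto
  then obtain xs where xs: "\<And>n. ys n = a_map f (xs n)" by metis
  have max: "maximizer f (xs n) (ys n)" for n
    unfolding xs by (rule a_map_maximizer[OF assms(1,2)])
  obtain B where B: "\<And>n. \<bar>ys n\<bar> \<le> B"
    using convergent_imp_bounded[OF ys(2)] by (auto simp: bounded_iff)
  obtain C where "\<And>n. \<bar>xs n\<bar> \<le> C" using maximized_points_bounded[OF assms(1), of B] B max by blast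
  then have "bounded (range xs)" by (auto simp: bounded_iff)
  then obtain x r where r: "strict_mono (r :: nat \<Rightarrow> nat)" "(xs \<circ> r) \<longlonglongrightarrow> x"
    using bounded_imp_convergent_subsequence by blast
  have "maximizer f x y"
    using assms(1) r(2) LIMSEQ_subseq_LIMSEQ[OF ys(2) r(1)]
    by (rule maximizer_closed) (simp add: max)
  then show ?thesis ..
qed

text \<open>These are the properties taken from the random path; what follows from them is
  deterministic. In the slope and jump conditions the path is compared with its limit from the side
  it is viewed on, in the return conditions with the limit at \<open>s\<close> from the opposite
  side. Reflection of time exchanges the members of each pair.\<close>

locale generic_path =
  fixes f :: "real \<Rightarrow> real"
  assumes cadlag: "cadlag f" and hypA: "hypA f"
    and left_slope: "\<And>y c e. c > 0 \<Longrightarrow> e > 0 \<Longrightarrow> \<not> (\<forall>z\<in>{y-e..<y}. f z \<le> left_lim f y - c * (y - z))"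
    and right_slope: "\<And>y c e. c > 0 \<Longrightarrow> e > 0 \<Longrightarrow> \<not> (\<forall>z\<in>{y<..y+e}. f z \<le> f y - c * (z - y))"
    and right_of_jump: "\<And>y e. f y \<noteq> left_lim f y \<Longrightarrow> e > 0 \<Longrightarrow> \<not> (\<forall>h\<in>{0<..<e}. f (y + h) \<le> f y + h\<^sup>2 / 2)"
    and left_of_jump: "\<And>y e. f y \<noteq> left_lim f y \<Longrightarrow> e > 0 \<Longrightarrow> \<not> (\<forall>h\<in>{0<..<e}. f (y - h) \<le> left_lim f y + h\<^sup>2 / 2)"
    and no_return_right: "\<And>s y. s < y \<Longrightarrow> f s < left_lim f s \<Longrightarrow> isCont f y \<Longrightarrow> f y = left_lim f s - (y - s)\<^sup>2 / 2 \<Longrightarrow>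
      \<not> (\<forall>t>s. f t \<le> f y + (t - y)\<^sup>2 / 2)"
    and no_return_left: "\<And>s y. y < s \<Longrightarrow> left_lim f s < f s \<Longrightarrow> isCont f y \<Longrightarrow> f y = f s - (s - y)\<^sup>2 / 2 \<Longrightarrow>
      \<not> (\<forall>t<s. f t \<le> f y + (t - y)\<^sup>2 / 2)"
begin

section \<open>Maximizers at their own centre\<close>

lemma fixed_le:
  assumes "maximizer f y y"
  shows "f z \<le> upper f y + (z - y)\<^sup>2 / 2"
  using maximizer_slope[OF assms, of z] upper_ge(1)[of f z] by (simp add: power2_eq_square)

text \<open>The upper value at a jump is the limit from one of the two sides, and on that side the
  path exceeds the parabola arbitrarily close to the jump.\<close>

lemma fixed_continuous:
  assumes "maximizer f y y"
  shows "left_lim f y = f y"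
proof (rule ccontr)
  assume "left_lim f y \<noteq> f y"
  then have jump: "f y \<noteq> left_lim f y" by simp
  show False
  proof (cases "left_lim f y \<le> f y")
    case True
    then have "upper f y = f y" by (simp add: upper_def)
    then have "f (y + h) \<le> f y + h\<^sup>2 / 2" for h using fixed_le[OF assms, of "y + h"] by simp
    then show False using right_of_jump[OF jump, of 1] by auto
  next
    case False
    then have "upper f y = left_lim f y" by (simp add: upper_def)
    then have "f (y - h) \<le> left_lim f y + h\<^sup>2 / 2" for h using fixed_le[OF assms, of "y - h"] by simp
    then show False using left_of_jump[OF jump, of 1] by auto
  qed
qed

lemma fixed_isCont:
  assumes "maximizer f y y"
  shows "isCont f y"
  using cadlag_left[OF cadlag, of y] cadlag_right[OF cadlag, of y] fixed_continuous[OF assms]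
  by (simp add: isCont_def filterlim_split_at)

lemma fixed_upper: "maximizer f y y \<Longrightarrow> upper f y = f y"
  by (simp add: upper_def fixed_continuous)

text \<open>Otherwise \<open>upper f y\<close> is the limit from the right, and optimality for a
  centre beyond \<open>y\<close> makes the path fall at rate \<open>c\<close> to the right of
  \<open>y\<close>.\<close>

lemma maximizer_left_jump:
  assumes "maximizer f x y" "y < x"
  shows "f y < left_lim f y"
proof (rule ccontr)
  assume "\<not> f y < left_lim f y"
  then have up: "upper f y = f y" by (simp add: upper_def)
  define c where "c = (x - y) / 2"
  have "c > 0" and c2: "2 * c = x - y" using assms by (simp_all add: c_def)
  have "f z \<le> f y - c * (z - y)" if z: "z \<in> {y<..y + c}" for z
  proof -
    have "(z - x) + (y - x) \<le> - 2 * c" using z \<open>c > 0\<close> c2 unfolding greaterThanAtMost_iff by linarith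
    then have "(z - y) * ((z - x) + (y - x)) \<le> (z - y) * (- 2 * c)"
      using z by (intro mult_left_mono) auto
    also have "\<dots> = 2 * (- (c * (z - y)))" by simp
    finally have "upper f z \<le> upper f y + (- (c * (z - y)))" by (rule maximizer_slope_le[OF assms(1)])
    then show ?thesis using upper_ge(1)[of f z] up by linarith
  qed
  then show False using right_slope[OF \<open>c > 0\<close> \<open>c > 0\<close>, of y] by blast
qed

lemma maximizer_right_jump:
  assumes "maximizer f x y" "x < y"
  shows "left_lim f y < f y"
proof (rule ccontr)
  assume "\<not> left_lim f y < f y"
  then have up: "upper f y = left_lim f y" by (simp add: upper_def)
  define c where "c = (y - x) / 2"
  have "c > 0" and c2: "2 * c = y - x" using assms by (simp_all add: c_def)
  have "f z \<le> left_lim f y - c * (y - z)" if z: "z \<in> {y - c..<y}" for z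
  proof -
    have "2 * c \<le> (z - x) + (y - x)" using z \<open>c > 0\<close> c2 unfolding atLeastLessThan_iff by linarith
    then have "(z - y) * ((z - x) + (y - x)) \<le> (z - y) * (2 * c)"
      using z by (intro mult_left_mono_neg) auto
    also have "\<dots> = 2 * (- (c * (y - z)))" by (simp add: algebra_simps)
    finally have "upper f z \<le> upper f y + (- (c * (y - z)))" by (rule maximizer_slope_le[OF assms(1)])
    then show ?thesis using upper_ge(1)[of f z] up by linarith
  qed
  then show False using left_slope[OF \<open>c > 0\<close> \<open>c > 0\<close>, of y] by blast
qed

lemma fixed_unique:
  assumes y: "maximizer f y y" and y': "maximizer f y y'"
  shows "y' = y"
proof (rule ccontr)
  assume "y' \<noteq> y"
  have "upper f y' - (y' - y)\<^sup>2 / 2 \<le> upper f y - (y - y)\<^sup>2 / 2"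
    using y unfolding maximizer_def by blast
  moreover have "upper f y - (y - y)\<^sup>2 / 2 \<le> upper f y' - (y' - y)\<^sup>2 / 2"
    using y' unfolding maximizer_def by blast
  ultimately have eq: "f y = upper f y' - (y' - y)\<^sup>2 / 2" using fixed_upper[OF y] by simp
  have le: "f t \<le> f y + (t - y)\<^sup>2 / 2" for t using fixed_le[OF y] fixed_upper[OF y] by simp
  show False
  proof (cases "y' < y")
    case True
    have "f y' < left_lim f y'" using maximizer_left_jump[OF y' True] .
    then show False
      using no_return_right[OF True _ fixed_isCont[OF y]] eq le
      by (simp add: upper_def power2_commute[of y y'])
  next
    case False
    then have "y < y'" using \<open>y' \<noteq> y\<close> by simp
    have "left_lim f y' < f y'" using maximizer_right_jump[OF y' \<open>y < y'\<close>] .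
    then show False
      using no_return_left[OF \<open>y < y'\<close> _ fixed_isCont[OF y]] eq le by (simp add: upper_def)
  qed
qed

lemma a_map_fixed_iff: "a_map f y = y \<longleftrightarrow> maximizer f y y"
  using a_map_maximizer[OF cadlag hypA, of y] fixed_unique by metis

text \<open>The neighbours carry the argument: optimality of \<open>y\<close> alone would be
  compatible with a jump. If \<open>y < x\<close>, then by monotonicity all points of
  \<open>calA f\<close> to the right of \<open>y\<close> have centres at least \<open>x\<close>, so
  from each of them the path falls steeply. As they approach \<open>y\<close>, this passes to the
  limit \<open>f y\<close> from the right, even if the upper value at \<open>y\<close> is the left
  limit. The other side is symmetric.\<close>

lemma regular_imp_fixed:
  assumes "lagrangian_regular f y"
  shows "maximizer f y y"
proof -
  have "y \<in> calA f" and left: "\<And>e. e > 0 \<Longrightarrow> \<exists>z\<in>calA f. y - e < z \<and> z < y"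
    and right: "\<And>e. e > 0 \<Longrightarrow> \<exists>z\<in>calA f. y < z \<and> z < y + e"
    using assms by (auto simp: lagrangian_regular_def)
  obtain x where x: "maximizer f x y" using calA_maximizer[OF cadlag hypA \<open>y \<in> calA f\<close>] by blast
  have "\<not> y < x"
  proof
    assume "y < x"
    define c where "c = (x - y) / 2"
    have "c > 0" and c2: "2 * c = x - y" using \<open>y < x\<close> by (simp_all add: c_def)
    have "f z \<le> f y - c * (z - y)" if z: "z \<in> {y<..y + c}" for z
    proof (rule field_le_epsilon)
      fix \<epsilon> :: real assume "\<epsilon> > 0"
      \<comment> \<open>One \<open>\<eta>\<close> is lost in the value at \<open>y'\<close>, and
        \<open>\<eta> * c\<close> through the distance of \<open>y'\<close> from
        \<open>y\<close>.\<close>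
      define \<eta> where "\<eta> = \<epsilon> / (1 + c)"
      have "\<eta> > 0" using \<open>\<epsilon> > 0\<close> \<open>c > 0\<close> by (simp add: \<eta>_def)
      have "\<eta> * (1 + c) = \<epsilon>" using \<open>c > 0\<close> by (simp add: \<eta>_def)
      then have \<eta>c: "\<eta> + \<eta> * c = \<epsilon>" by (simp add: distrib_left)
      obtain d where d: "d > y" "\<And>t. y < t \<Longrightarrow> t < d \<Longrightarrow> upper f t < f y + \<eta>"
        using upper_at_right[OF cadlag \<open>\<eta> > 0\<close>, of y] unfolding eventually_at_right_field by blast
      define e where "e = min (d - y) (min (z - y) \<eta>)"
      have e: "e > 0" "e \<le> d - y" "e \<le> z - y" "e \<le> \<eta>" using d z \<open>\<eta> > 0\<close> by (auto simp: e_def)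
      obtain y' where y': "y' \<in> calA f" "y < y'" "y' < y + e" using right[OF \<open>e > 0\<close>] by blast
      obtain x' where x': "maximizer f x' y'" using calA_maximizer[OF cadlag hypA y'(1)] by blast
      have "x \<le> x'" using maximizer_mono[OF x' x] y' by linarith
      have "(z - x') + (y' - x') \<le> - 2 * c"
        using z y' e \<open>x \<le> x'\<close> c2 unfolding greaterThanAtMost_iff by linarith
      then have "(z - y') * ((z - x') + (y' - x')) \<le> (z - y') * (- 2 * c)"
        using y' e by (intro mult_left_mono) auto
      also have "\<dots> = 2 * (- ((z - y') * c))" by simp
      finally have "upper f z \<le> upper f y' + (- ((z - y') * c))" by (rule maximizer_slope_le[OF x'])
      then have "f z \<le> upper f y' - (z - y') * c" using upper_ge(1)[of f z] by linarith
      also have "\<dots> \<le> f y + \<eta> - (z - y') * c" using d(2)[of y'] y' e by simp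
      also have "\<dots> = f y - c * (z - y) + \<eta> + (y' - y) * c" by (simp add: algebra_simps)
      also have "\<dots> \<le> f y - c * (z - y) + \<eta> + \<eta> * c"
        using y' e \<open>c > 0\<close> by (intro add_left_mono mult_right_mono) auto
      also have "\<dots> = f y - c * (z - y) + \<epsilon>"
        using \<eta>c by linarith
      finally show "f z \<le> f y - c * (z - y) + \<epsilon>" .
    qed
    then show False using right_slope[OF \<open>c > 0\<close> \<open>c > 0\<close>, of y] by blast
  qed
  moreover have "\<not> x < y"
  proof
    assume "x < y"
    define c where "c = (y - x) / 2"
    have "c > 0" and c2: "2 * c = y - x" using \<open>x < y\<close> by (simp_all add: c_def)
    have "f z \<le> left_lim f y - c * (y - z)" if z: "z \<in> {y - c..<y}" for z
    proof (rule field_le_epsilon)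
      fix \<epsilon> :: real assume "\<epsilon> > 0"
      define \<eta> where "\<eta> = \<epsilon> / (1 + c)"
      have "\<eta> > 0" using \<open>\<epsilon> > 0\<close> \<open>c > 0\<close> by (simp add: \<eta>_def)
      have "\<eta> * (1 + c) = \<epsilon>" using \<open>c > 0\<close> by (simp add: \<eta>_def)
      then have \<eta>c: "\<eta> + \<eta> * c = \<epsilon>" by (simp add: distrib_left)
      obtain d where d: "d < y" "\<And>t. d < t \<Longrightarrow> t < y \<Longrightarrow> upper f t < left_lim f y + \<eta>"
        using upper_at_left[OF cadlag \<open>\<eta> > 0\<close>, of y] unfolding eventually_at_left_field by blast
      define e where "e = min (y - d) (min (y - z) \<eta>)"
      have e: "e > 0" "e \<le> y - d" "e \<le> y - z" "e \<le> \<eta>" using d z \<open>\<eta> > 0\<close> by (auto simp: e_def)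
      obtain y' where y': "y' \<in> calA f" "y - e < y'" "y' < y" using left[OF \<open>e > 0\<close>] by blast
      obtain x' where x': "maximizer f x' y'" using calA_maximizer[OF cadlag hypA y'(1)] by blast
      have "x' \<le> x" using maximizer_mono[OF x x'] y' by linarith
      have "2 * c \<le> (z - x') + (y' - x')"
        using z y' e \<open>x' \<le> x\<close> c2 unfolding atLeastLessThan_iff by linarith
      then have "(z - y') * ((z - x') + (y' - x')) \<le> (z - y') * (2 * c)"
        using y' e by (intro mult_left_mono_neg) auto
      also have "\<dots> = 2 * (- ((y' - z) * c))" by (simp add: algebra_simps)
      finally have "upper f z \<le> upper f y' + (- ((y' - z) * c))" by (rule maximizer_slope_le[OF x'])
      then have "f z \<le> upper f y' - (y' - z) * c" using upper_ge(1)[of f z] by linarith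
      also have "\<dots> \<le> left_lim f y + \<eta> - (y' - z) * c" using d(2)[of y'] y' e by simp
      also have "\<dots> = left_lim f y - c * (y - z) + \<eta> + (y - y') * c" by (simp add: algebra_simps)
      also have "\<dots> \<le> left_lim f y - c * (y - z) + \<eta> + \<eta> * c"
        using y' e \<open>c > 0\<close> by (intro add_left_mono mult_right_mono) auto
      also have "\<dots> = left_lim f y - c * (y - z) + \<epsilon>"
        using \<eta>c by linarith
      finally show "f z \<le> left_lim f y - c * (y - z) + \<epsilon>" .
    qed
    then show False using left_slope[OF \<open>c > 0\<close> \<open>c > 0\<close>, of y] by blast
  qed
  ultimately show ?thesis using x by simp
qed

text \<open>In effect \<open>a_map f\<close> is continuous at such a \<open>y\<close>: limits of
  maximizers are maximizers for \<open>y\<close>, and there is only one. For \<open>S\<close> a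
  closed half-line that misses \<open>y\<close>, this yields values of \<open>a_map f\<close> close
  to \<open>y\<close>.\<close>

lemma a_map_limit:
  assumes y: "maximizer f y y" and "xs \<longlonglongrightarrow> y" and "closed S" "\<And>n. a_map f (xs n) \<in> S"
  shows "y \<in> S"
proof -
  have max: "maximizer f (xs n) (a_map f (xs n))" for n by (rule a_map_maximizer[OF cadlag hypA])
  obtain b where b: "\<And>n. \<bar>xs n\<bar> \<le> b"
    using convergent_imp_bounded[OF assms(2)] by (auto simp: bounded_iff)
  obtain K where K: "\<And>x y. \<bar>x\<bar> \<le> b \<Longrightarrow> K < \<bar>y\<bar> \<Longrightarrow> upper f y - (y - x)\<^sup>2 / 2 < upper f 0 - (0 - x)\<^sup>2 / 2"
    using maximizers_bounded[OF cadlag hypA, of b] by blast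
  have "\<bar>a_map f (xs n)\<bar> \<le> K" for n
  proof (rule ccontr)
    assume "\<not> \<bar>a_map f (xs n)\<bar> \<le> K"
    then have "K < \<bar>a_map f (xs n)\<bar>" by simp
    from K[OF b this] show False using max[of n] unfolding maximizer_def by (meson not_le)
  qed
  then have "bounded (range (\<lambda>n. a_map f (xs n)))" by (auto simp: bounded_iff)
  then obtain l r where r: "strict_mono (r :: nat \<Rightarrow> nat)" "((\<lambda>n. a_map f (xs n)) \<circ> r) \<longlonglongrightarrow> l"
    using bounded_imp_convergent_subsequence by blast
  have "maximizer f y l"
    using cadlag LIMSEQ_subseq_LIMSEQ[OF assms(2) r(1)] r(2)
    by (rule maximizer_closed) (simp add: max)
  then have "l = y" using fixed_unique[OF y] by simp
  moreover have "l \<in> S"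
    using closed_sequentially[OF \<open>closed S\<close> _ r(2)] assms(4) by simp
  ultimately show ?thesis by simp
qed

text \<open>Centres slightly off \<open>y\<close> have maximizers near \<open>y\<close>, on the same
  side by monotonicity. They differ from \<open>y\<close> because a maximizer away from its centre
  sits at a jump, whereas \<open>y\<close> is a continuity point.\<close>

lemma fixed_imp_regular:
  assumes y: "maximizer f y y"
  shows "lagrangian_regular f y"
proof -
  note a = a_map_maximizer[OF cadlag hypA]
  have A: "a_map f x \<in> calA f" for x
    unfolding calA_def by (rule subsetD[OF closure_subset]) simp
  have "y \<in> calA f" using A[of y] y a_map_fixed_iff[of y] by simp
  moreover have "\<exists>z\<in>calA f. y - e < z \<and> z < y" if "e > 0" for e
  proof -
    define xs where "xs n = y - inverse (real (Suc n))" for n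
    have "xs \<longlonglongrightarrow> y - 0" unfolding xs_def by (intro tendsto_intros LIMSEQ_inverse_real_of_nat)
    then have "xs \<longlonglongrightarrow> y" by simp
    then obtain n where "a_map f (xs n) \<notin> {..y - e}"
      using a_map_limit[OF y, of xs "{..y - e}"] \<open>e > 0\<close> by auto
    moreover have "xs n < y" by (simp add: xs_def)
    then have "a_map f (xs n) \<le> y" using maximizer_mono[OF a(1) y] by simp
    moreover have "a_map f (xs n) \<noteq> y"
      using maximizer_right_jump[of "xs n" y] a(1)[of "xs n"] \<open>xs n < y\<close> fixed_continuous[OF y] by auto
    ultimately show ?thesis using A[of "xs n"] by (intro bexI[of _ "a_map f (xs n)"]) auto
  qed
  moreover have "\<exists>z\<in>calA f. y < z \<and> z < y + e" if "e > 0" for e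
  proof -
    define xs where "xs n = y + inverse (real (Suc n))" for n
    have "xs \<longlonglongrightarrow> y + 0" unfolding xs_def by (intro tendsto_intros LIMSEQ_inverse_real_of_nat)
    then have "xs \<longlonglongrightarrow> y" by simp
    then obtain n where "a_map f (xs n) \<notin> {y + e..}"
      using a_map_limit[OF y, of xs "{y + e..}"] \<open>e > 0\<close> by auto
    moreover have "y < xs n" by (simp add: xs_def)
    then have "y \<le> a_map f (xs n)" using maximizer_mono[OF y a(1)] by simp
    moreover have "a_map f (xs n) \<noteq> y"
      using maximizer_left_jump[of "xs n" y] a(1)[of "xs n"] \<open>y < xs n\<close> fixed_continuous[OF y] by auto
    ultimately show ?thesis using A[of "xs n"] by (intro bexI[of _ "a_map f (xs n)"]) auto
  qed
  ultimately show ?thesis by (simp add: lagrangian_regular_def)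
qed

lemma fixed_iff_regular: "a_map f y = y \<longleftrightarrow> lagrangian_regular f y"
  using a_map_fixed_iff fixed_imp_regular regular_imp_fixed by blast

lemma calA0_eq: "calA0 f = {y. lagrangian_regular f y}"
proof -
  have "closed {y. maximizer f y y}"
    unfolding closed_sequential_limits using maximizer_closed[OF cadlag] by blast
  then have "calA0 f = {y. maximizer f y y}"
    unfolding calA0_def a_map_fixed_iff by (rule closure_closed)
  then show ?thesis using fixed_iff_regular a_map_fixed_iff by simp
qed

end

section \<open>Almost sure path properties\<close>

lemma filterlim_add_at_left: "filterlim (\<lambda>t. p + t) (at_left (y::real)) (at_left (y - p))"
proof -
  have "filterlim (\<lambda>t. p + t) (nhds (p + (y - p))) (at_left (y - p))" by (intro tendsto_intros)
  moreover have "\<forall>\<^sub>F t in at_left (y - p). p + t < y"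
    unfolding eventually_at_left_field by (intro exI[of _ "y - p - 1"]) auto
  ultimately show ?thesis
    by (auto simp: filterlim_at elim!: eventually_mono)
qed

lemma filterlim_add_at_right: "filterlim (\<lambda>t. p + t) (at_right (y::real)) (at_right (y - p))"
proof -
  have "filterlim (\<lambda>t. p + t) (nhds (p + (y - p))) (at_right (y - p))" by (intro tendsto_intros)
  moreover have "\<forall>\<^sub>F t in at_right (y - p). p + t > y"
    unfolding eventually_at_right_field by (intro exI[of _ "y - p + 1"]) auto
  ultimately show ?thesis
    by (auto simp: filterlim_at elim!: eventually_mono)
qed

section \<open>From short windows to the whole line\<close>

lemma inverse_Suc_le:
  assumes "(0::real) < c" obtains r where "1 / real (Suc r) < c"
  using reals_Archimedean[OF assms] by (auto simp: inverse_eq_divide)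

lemma two_power_less:
  assumes "(0::real) < e" obtains m :: nat where "2 / 2^m < e"
proof -
  obtain m :: nat where "(1/2)^m < e / 2" using real_arch_pow_inv[of "e / 2" "1/2"] assms by auto
  then show ?thesis using that[of m] by (simp add: power_divide field_simps)
qed

text \<open>\<open>X\<close> carries the exceptional points and \<open>Y\<close> the regularity: the
  estimates at the origin are made for \<open>Y\<close> and reach \<open>X\<close> through the
  common \<open>\<nu>\<close>. Forwards both are the given process. Backwards \<open>X\<close> is
  its time reversal and \<open>Y\<close> its negative.\<close>

locale companion =
  fixes M :: "'a measure" and X Y :: "'a \<Rightarrow> real \<Rightarrow> real" and \<nu>
  assumes X: "stat_indep M X \<nu>" and Y: "stat_indep M Y \<nu>"
    and right_cont: "\<And>\<omega> t. \<omega> \<in> space M \<Longrightarrow> (Y \<omega> \<longlongrightarrow> Y \<omega> t) (at_right t)"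
    and pure_jump: "AE \<omega> in M. \<exists>J. \<forall>x\<ge>0. (J has_sum Y \<omega> x - Y \<omega> 0) {0<..x}"
    and not_below: "AE \<omega> in M. \<not> (\<exists>e>0. \<forall>h\<in>{0<..<e}. Y \<omega> h - Y \<omega> 0 \<le> h\<^sup>2 / 2)"
begin

lemma AE_no_left_slope:
  "AE \<omega> in M. \<forall>y l c e. c > 0 \<longrightarrow> e > 0 \<longrightarrow> (X \<omega> \<longlongrightarrow> l) (at_left y) \<longrightarrow>
     \<not> (\<forall>z\<in>{y-e..<y}. X \<omega> z \<le> l - c * (y - z))"
proof -
  \<comment> \<open>Halved to match the factor 2 in \<open>no_left_slope\<close>; for large
    \<open>r\<close> the slope \<open>2 * c r\<close> is below any given one.\<close>
  define c where "c r = 1 / real (Suc r) / 2" for r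
  have c: "c r > 0" for r by (simp add: c_def)
  note rare = steep_start_rare[OF Y pure_jump c]
  have "\<forall>r. \<exists>m. \<forall>N\<ge>m. measure M {\<omega> \<in> space M.
      \<exists>i\<in>{1..2^(N-m)}. walk (Y \<omega>) (1/2^N) i > c r * (real i / 2^N)} \<le> 1/2"
    by (intro allI rare) simp
  from choice[OF this] obtain m where "\<forall>r. \<forall>N\<ge>m r. measure M {\<omega> \<in> space M.
      \<exists>i\<in>{1..2^(N-m r)}. walk (Y \<omega>) (1/2^N) i > c r * (real i / 2^N)} \<le> 1/2" ..
  then have m: "\<And>r N. N \<ge> m r \<Longrightarrow> measure M {\<omega> \<in> space M.
      \<exists>i\<in>{1..2^(N-m r)}. walk (Y \<omega>) (1/2^N) i > c r * (real i / 2^N)} \<le> 1/2"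
    by blast
  have "AE \<omega> in M. \<forall>r. \<forall>p::rat. \<not> (\<exists>y l. 0 < y \<and> y \<le> 1 / 2^m r \<and>
      ((\<lambda>t. X \<omega> (of_rat p + t)) \<longlongrightarrow> l) (at_left y) \<and>
      (\<forall>z\<in>{0..<y}. X \<omega> (of_rat p + z) \<le> l - 2 * c r * (y - z)))"
    unfolding AE_all_countable
  proof (intro allI)
    fix r and p :: rat
    show "AE \<omega> in M. \<not> (\<exists>y l. 0 < y \<and> y \<le> 1 / 2^m r \<and>
        ((\<lambda>t. X \<omega> (of_rat p + t)) \<longlongrightarrow> l) (at_left y) \<and>
        (\<forall>z\<in>{0..<y}. X \<omega> (of_rat p + z) \<le> l - 2 * c r * (y - z)))"
      by (rule no_left_slope[OF stat_indep_shift[OF X] Y c rare m])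
  qed
  then show ?thesis
  proof eventually_elim
    case (elim \<omega>)
    show ?case
    proof (intro allI impI notI)
      fix y l d e :: real
      assume "d > 0" "e > 0" and lim: "(X \<omega> \<longlongrightarrow> l) (at_left y)"
        and le: "\<forall>z\<in>{y-e..<y}. X \<omega> z \<le> l - d * (y - z)"
      obtain r where r: "1 / real (Suc r) < d" using inverse_Suc_le[OF \<open>d > 0\<close>] .
      \<comment> \<open>The rational origin \<open>p\<close> is within \<open>e\<close> of
        \<open>y\<close>, so that the slope bound holds from \<open>p\<close> on, and within the
        length of the window.\<close>
      have "max (y - e) (y - 1 / 2^m r) < y" using \<open>e > 0\<close> by simp
      then obtain p where p: "max (y - e) (y - 1 / 2^m r) < of_rat p" "of_rat p < y"
        using of_rat_dense by blast
      define y' where "y' = y - of_rat p"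
      have y': "0 < y'" "y' \<le> 1 / 2^m r" using p by (auto simp: y'_def)
      have "((\<lambda>t. X \<omega> (of_rat p + t)) \<longlongrightarrow> l) (at_left y')"
        unfolding y'_def by (rule filterlim_compose[OF lim filterlim_add_at_left])
      moreover have "X \<omega> (of_rat p + z) \<le> l - 2 * c r * (y' - z)" if z: "z \<in> {0..<y'}" for z
      proof -
        have "of_rat p + z \<in> {y-e..<y}" using z p by (auto simp: y'_def)
        then have "X \<omega> (of_rat p + z) \<le> l - d * (y - (of_rat p + z))" using le by blast
        moreover have "2 * c r * (y' - z) \<le> d * (y' - z)"
        proof (intro mult_right_mono)
          have "2 * c r = 1 / real (Suc r)" by (simp add: c_def del: of_nat_Suc)
          then show "2 * c r \<le> d" using r by linarith
        qed (use z in simp)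
        ultimately show ?thesis by (simp add: y'_def algebra_simps)
      qed
      ultimately show False using elim y' by blast
    qed
  qed
qed

lemma oscillation_bounds:
  obtains m where "\<And>r N. N \<ge> m r \<Longrightarrow>
    measure M {\<omega> \<in> space M. oscillates (1 / real (Suc r)) (2^(N - m r)) (walk (Y \<omega>) (1/2^N))} \<le> 1/2"
proof -
  have "\<exists>m. \<forall>N\<ge>m. measure M {\<omega> \<in> space M. oscillates (1 / real (Suc r)) (2^(N-m)) (walk (Y \<omega>) (1/2^N))} \<le> 1/2" for r
    by (rule oscillation_rare[OF Y right_cont]) auto
  then show ?thesis using that by metis
qed

lemma AE_jump_not_below_parabola:
  "AE \<omega> in M. \<forall>y a b e. (X \<omega> \<longlongrightarrow> a) (at_left y) \<longrightarrow> (X \<omega> \<longlongrightarrow> b) (at_right y) \<longrightarrow> a \<noteq> b \<longrightarrow> e > 0 \<longrightarrow>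
     \<not> (\<forall>h\<in>{0<..<e}. X \<omega> (y + h) \<le> b + h\<^sup>2 / 2)"
proof -
  obtain m0 where m0: "\<And>r N. N \<ge> m0 r \<Longrightarrow>
    measure M {\<omega> \<in> space M. oscillates (1 / real (Suc r)) (2^(N - m0 r)) (walk (Y \<omega>) (1/2^N))} \<le> 1/2"
    using oscillation_bounds by blast
  have "AE \<omega> in M. \<forall>r m. \<forall>p::rat. \<not> (\<exists>y a b. 0 < y \<and> y < 1/2^m0 r \<and>
      ((\<lambda>t. X \<omega> (of_rat p + t)) \<longlongrightarrow> a) (at_left y) \<and>
      ((\<lambda>t. X \<omega> (of_rat p + t)) \<longlongrightarrow> b) (at_right y) \<and> \<bar>b - a\<bar> > 1 / real (Suc r) \<and>
      (\<forall>h\<in>{0<..2/2^m}. X \<omega> (of_rat p + (y + h)) \<le> b + h\<^sup>2 / 2))"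
    unfolding AE_all_countable
  proof (intro allI)
    fix r m and p :: rat
    show "AE \<omega> in M. \<not> (\<exists>y a b. 0 < y \<and> y < 1/2^m0 r \<and>
      ((\<lambda>t. X \<omega> (of_rat p + t)) \<longlongrightarrow> a) (at_left y) \<and>
      ((\<lambda>t. X \<omega> (of_rat p + t)) \<longlongrightarrow> b) (at_right y) \<and> \<bar>b - a\<bar> > 1 / real (Suc r) \<and>
      (\<forall>h\<in>{0<..2/2^m}. X \<omega> (of_rat p + (y + h)) \<le> b + h\<^sup>2 / 2))"
      by (rule jump_not_below_parabola[OF stat_indep_shift[OF X] Y m0
            parabola_start_rare[OF Y right_cont not_below]])
  qed
  then show ?thesis
  proof eventually_elim
    case (elim \<omega>)
    show ?case
    proof (intro allI impI notI)
      fix y a b e :: real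
      assume a: "(X \<omega> \<longlongrightarrow> a) (at_left y)" and b: "(X \<omega> \<longlongrightarrow> b) (at_right y)" and "a \<noteq> b" "e > 0"
        and le: "\<forall>h\<in>{0<..<e}. X \<omega> (y + h) \<le> b + h\<^sup>2 / 2"
      have "\<bar>b - a\<bar> > 0" using \<open>a \<noteq> b\<close> by simp
      then obtain r where r: "1 / real (Suc r) < \<bar>b - a\<bar>" using inverse_Suc_le by blast
      obtain m :: nat where m: "2 / 2^m < e" using two_power_less[OF \<open>e > 0\<close>] .
      have "y - 1 / 2^m0 r < y" by simp
      then obtain p where p: "y - 1 / 2^m0 r < of_rat p" "of_rat p < y" using of_rat_dense by blast
      define y' where "y' = y - of_rat p"
      have y': "0 < y'" "y' < 1 / 2^m0 r" using p by (auto simp: y'_def)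
      have "((\<lambda>t. X \<omega> (of_rat p + t)) \<longlongrightarrow> a) (at_left y')"
        unfolding y'_def by (rule filterlim_compose[OF a filterlim_add_at_left])
      moreover have "((\<lambda>t. X \<omega> (of_rat p + t)) \<longlongrightarrow> b) (at_right y')"
        unfolding y'_def by (rule filterlim_compose[OF b filterlim_add_at_right])
      moreover have "\<forall>h\<in>{0<..2/2^m}. X \<omega> (of_rat p + (y' + h)) \<le> b + h\<^sup>2 / 2"
      proof
        fix h :: real assume "h \<in> {0<..2/2^m}"
        then have "X \<omega> (y + h) \<le> b + h\<^sup>2 / 2" using m by (intro le[rule_format]) auto
        then show "X \<omega> (of_rat p + (y' + h)) \<le> b + h\<^sup>2 / 2" by (simp add: y'_def)
      qed
      ultimately show False using elim[rule_format, of r p m] y' r by blast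
    qed
  qed
qed

lemma AE_jump_no_parabolic_return:
  "AE \<omega> in M. \<forall>s y a b. s < y \<longrightarrow> (X \<omega> \<longlongrightarrow> a) (at_left s) \<longrightarrow> (X \<omega> \<longlongrightarrow> b) (at_right s) \<longrightarrow> b < a \<longrightarrow>
     isCont (X \<omega>) y \<longrightarrow> X \<omega> y = a - (y - s)\<^sup>2 / 2 \<longrightarrow> \<not> (\<forall>t>s. X \<omega> t \<le> X \<omega> y + (t - y)\<^sup>2 / 2)"
proof -
  obtain m0 where m0: "\<And>r N. N \<ge> m0 r \<Longrightarrow>
    measure M {\<omega> \<in> space M. oscillates (1 / real (Suc r)) (2^(N - m0 r)) (walk (Y \<omega>) (1/2^N))} \<le> 1/2"
    using oscillation_bounds by blast
  have R: "\<exists>n. \<exists>q>0. measure M {\<omega> \<in> space M. below n 1 q 0 (walk (Y \<omega>) (1/2^n))} \<le> \<epsilon>" if "\<epsilon> > 0" for \<epsilon>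
    using parabola_start_rare[OF Y right_cont not_below that, of 0] by blast
  have "AE \<omega> in M. \<forall>r L. \<forall>p::rat. \<not> (\<exists>s y a b. 0 < s \<and> s < 1/2^m0 r \<and> s < y \<and> y < real L \<and>
      ((\<lambda>t. X \<omega> (of_rat p + t)) \<longlongrightarrow> a) (at_left s) \<and>
      ((\<lambda>t. X \<omega> (of_rat p + t)) \<longlongrightarrow> b) (at_right s) \<and> a - b > 1 / real (Suc r) \<and>
      isCont (\<lambda>t. X \<omega> (of_rat p + t)) y \<and> X \<omega> (of_rat p + y) = a - (y - s)\<^sup>2 / 2 \<and>
      (\<forall>t>s. X \<omega> (of_rat p + t) \<le> X \<omega> (of_rat p + y) + (t - y)\<^sup>2 / 2))"
    unfolding AE_all_countable
  proof (intro allI)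
    fix r L and p :: rat
    show "AE \<omega> in M. \<not> (\<exists>s y a b. 0 < s \<and> s < 1/2^m0 r \<and> s < y \<and> y < real L \<and>
      ((\<lambda>t. X \<omega> (of_rat p + t)) \<longlongrightarrow> a) (at_left s) \<and>
      ((\<lambda>t. X \<omega> (of_rat p + t)) \<longlongrightarrow> b) (at_right s) \<and> a - b > 1 / real (Suc r) \<and>
      isCont (\<lambda>t. X \<omega> (of_rat p + t)) y \<and> X \<omega> (of_rat p + y) = a - (y - s)\<^sup>2 / 2 \<and>
      (\<forall>t>s. X \<omega> (of_rat p + t) \<le> X \<omega> (of_rat p + y) + (t - y)\<^sup>2 / 2))"
      by (rule jump_no_parabolic_return[OF stat_indep_shift[OF X] Y m0 R]) auto
  qed
  then show ?thesis
  proof eventually_elim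
    case (elim \<omega>)
    show ?case
    proof (intro allI impI notI)
      fix s y a b :: real
      assume "s < y" and a: "(X \<omega> \<longlongrightarrow> a) (at_left s)" and b: "(X \<omega> \<longlongrightarrow> b) (at_right s)" and "b < a"
        and cont: "isCont (X \<omega>) y" and Xy: "X \<omega> y = a - (y - s)\<^sup>2 / 2"
        and le: "\<forall>t>s. X \<omega> t \<le> X \<omega> y + (t - y)\<^sup>2 / 2"
      have "a - b > 0" using \<open>b < a\<close> by simp
      then obtain r where r: "1 / real (Suc r) < a - b" using inverse_Suc_le by blast
      have "s - 1 / 2^m0 r < s" by simp
      then obtain p where p: "s - 1 / 2^m0 r < of_rat p" "of_rat p < s" using of_rat_dense by blast
      define s' y' where "s' = s - of_rat p" and "y' = y - of_rat p"
      have s': "0 < s'" "s' < 1 / 2^m0 r" "s' < y'" using p \<open>s < y\<close> by (auto simp: s'_def y'_def)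
      obtain L where L: "y' < real L" using reals_Archimedean2 by blast
      have "((\<lambda>t. X \<omega> (of_rat p + t)) \<longlongrightarrow> a) (at_left s')"
        unfolding s'_def by (rule filterlim_compose[OF a filterlim_add_at_left])
      moreover have "((\<lambda>t. X \<omega> (of_rat p + t)) \<longlongrightarrow> b) (at_right s')"
        unfolding s'_def by (rule filterlim_compose[OF b filterlim_add_at_right])
      moreover have "isCont (\<lambda>t. X \<omega> (of_rat p + t)) y'"
      proof (rule isCont_o2[where f="\<lambda>t. of_rat p + t"])
        show "isCont (X \<omega>) (of_rat p + y')" using cont by (simp add: y'_def)
      qed simp
      moreover have "X \<omega> (of_rat p + y') = a - (y' - s')\<^sup>2 / 2" using Xy by (simp add: y'_def s'_def)
      moreover have "\<forall>t>s'. X \<omega> (of_rat p + t) \<le> X \<omega> (of_rat p + y') + (t - y')\<^sup>2 / 2"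
      proof (intro allI impI)
        fix t assume "t > s'"
        then have "X \<omega> (of_rat p + t) \<le> X \<omega> y + ((of_rat p + t) - y)\<^sup>2 / 2"
          by (intro le[rule_format]) (simp add: s'_def)
        then show "X \<omega> (of_rat p + t) \<le> X \<omega> (of_rat p + y') + (t - y')\<^sup>2 / 2"
          by (simp add: y'_def algebra_simps)
      qed
      ultimately show False using elim[rule_format, of r L p] s' r L by blast
    qed
  qed
qed

end

text \<open>The upper limit serves the given process, the lower limit its negative, which is the
  companion of the reversed path.\<close>

lemma hypB_not_below:
  assumes "hypB f"
  shows "\<not> (\<exists>e>0. \<forall>h\<in>{0<..<e}. f h \<le> h\<^sup>2 / 2)" and "\<not> (\<exists>e>0. \<forall>h\<in>{0<..<e}. - f h \<le> h\<^sup>2 / 2)"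
proof -
  have ev: "\<forall>\<^sub>F h in at_right 0. P h" if "e > 0" "\<And>h. h \<in> {0<..<e} \<Longrightarrow> P h" for e :: real and P
    unfolding eventually_at_right_field using that by (intro exI[of _ e]) auto
  show "\<not> (\<exists>e>0. \<forall>h\<in>{0<..<e}. f h \<le> h\<^sup>2 / 2)"
  proof
    assume "\<exists>e>0. \<forall>h\<in>{0<..<e}. f h \<le> h\<^sup>2 / 2"
    then obtain e where e: "e > 0" "\<And>h. h \<in> {0<..<e} \<Longrightarrow> f h \<le> h\<^sup>2 / 2" by blast
    have "\<forall>\<^sub>F h in at_right 0. ereal (f h / h\<^sup>2) \<le> ereal (1/2)"
      using e(1) by (rule ev) (use e(2) in \<open>auto simp: divide_le_eq\<close>)
    then have "Limsup (at_right 0) (\<lambda>h. ereal (f h / h\<^sup>2)) \<le> ereal (1/2)" by (rule Limsup_bounded)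
    then show False using assms by (simp add: hypB_def)
  qed
  show "\<not> (\<exists>e>0. \<forall>h\<in>{0<..<e}. - f h \<le> h\<^sup>2 / 2)"
  proof
    assume "\<exists>e>0. \<forall>h\<in>{0<..<e}. - f h \<le> h\<^sup>2 / 2"
    then obtain e where e: "e > 0" "\<And>h. h \<in> {0<..<e} \<Longrightarrow> - f h \<le> h\<^sup>2 / 2" by blast
    have "\<forall>\<^sub>F h in at_right 0. ereal (- 1/2) \<le> ereal (f h / h\<^sup>2)"
      using e(1)
    proof (rule ev)
      fix h assume h: "h \<in> {0<..<e}"
      then have "(- 1/2) * h\<^sup>2 \<le> f h" using e(2)[OF h] by simp
      then show "ereal (- 1/2) \<le> ereal (f h / h\<^sup>2)" using h by (simp add: le_divide_eq)
    qed
    then have "ereal (- 1/2) \<le> Liminf (at_right 0) (\<lambda>h. ereal (f h / h\<^sup>2))" by (rule Liminf_bounded)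
    then show False using assms by (simp add: hypB_def)
  qed
qed

theorem theorem4p15:
  fixes M :: "'a measure" and psi0 :: "'a \<Rightarrow> real \<Rightarrow> real"
  assumes "two_sided_levy M psi0"
    and "AE \<omega> in M. locally_bounded_variation (psi0 \<omega>)"
    and "AE \<omega> in M. zero_drift (psi0 \<omega>)"
    and "AE \<omega> in M. hypA (psi0 \<omega>)"
    and "AE \<omega> in M. hypB (psi0 \<omega>)"
    and "assumption_BII M psi0"
  shows "AE \<omega> in M. (\<forall>y. a_map (psi0 \<omega>) y = y \<longleftrightarrow> lagrangian_regular (psi0 \<omega>) y) \<and>
                    calA0 (psi0 \<omega>) = {y. lagrangian_regular (psi0 \<omega>) y}"
proof -
  define \<nu> where "\<nu> h = distr M borel (\<lambda>\<omega>. psi0 \<omega> h - psi0 \<omega> 0)" for h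
  have psi: "stat_indep M psi0 \<nu>"
    unfolding \<nu>_def using assms(1) by (rule stat_indep_levy)
  have zero: "psi0 \<omega> 0 = 0" and cadlag: "cadlag (psi0 \<omega>)" if "\<omega> \<in> space M" for \<omega>
    using assms(1) that by (auto simp: two_sided_levy_def)
  interpret fwd: companion M psi0 psi0 \<nu>
  proof
    show "(psi0 \<omega> \<longlongrightarrow> psi0 \<omega> t) (at_right t)" if "\<omega> \<in> space M" for \<omega> t
      using cadlag_right[OF cadlag[OF that]] .
    show "AE \<omega> in M. \<exists>J. \<forall>x\<ge>0. (J has_sum psi0 \<omega> x - psi0 \<omega> 0) {0<..x}"
      using assms(3) AE_space by eventually_elim (auto simp: zero_drift_def zero)
    show "AE \<omega> in M. \<not> (\<exists>e>0. \<forall>h\<in>{0<..<e}. psi0 \<omega> h - psi0 \<omega> 0 \<le> h\<^sup>2 / 2)"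
      using assms(5) AE_space
    proof eventually_elim
      case (elim \<omega>)
      show ?case using hypB_not_below(1)[OF elim(1)] zero[OF elim(2)] by simp
    qed
  qed (rule psi)+
  interpret bwd: companion M "\<lambda>\<omega> t. psi0 \<omega> (0 - t)" "\<lambda>\<omega> t. - psi0 \<omega> t" "\<lambda>h. distr (\<nu> h) borel uminus"
  proof
    show "stat_indep M (\<lambda>\<omega> t. psi0 \<omega> (0 - t)) (\<lambda>h. distr (\<nu> h) borel uminus)"
      using psi by (rule stat_indep_reverse)
    show "stat_indep M (\<lambda>\<omega> t. - psi0 \<omega> t) (\<lambda>h. distr (\<nu> h) borel uminus)"
      using psi by (rule stat_indep_uminus)
    show "((\<lambda>t. - psi0 \<omega> t) \<longlongrightarrow> - psi0 \<omega> t) (at_right t)" if "\<omega> \<in> space M" for \<omega> t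
      by (intro tendsto_minus fwd.right_cont that)
    show "AE \<omega> in M. \<exists>J. \<forall>x\<ge>0. (J has_sum - psi0 \<omega> x - - psi0 \<omega> 0) {0<..x}"
      using fwd.pure_jump
    proof eventually_elim
      case (elim \<omega>)
      then obtain J where J: "\<And>x. x \<ge> 0 \<Longrightarrow> (J has_sum psi0 \<omega> x - psi0 \<omega> 0) {0<..x}" by blast
      have "((\<lambda>u. - J u) has_sum - psi0 \<omega> x - - psi0 \<omega> 0) {0<..x}" if "x \<ge> 0" for x
        using J[OF that] by (simp add: has_sum_uminus)
      then show ?case by blast
    qed
    show "AE \<omega> in M. \<not> (\<exists>e>0. \<forall>h\<in>{0<..<e}. - psi0 \<omega> h - - psi0 \<omega> 0 \<le> h\<^sup>2 / 2)"
      using assms(5) AE_space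
    proof eventually_elim
      case (elim \<omega>)
      show ?case using hypB_not_below(2)[OF elim(1)] zero[OF elim(2)] by simp
    qed
  qed
  show ?thesis
    using assms(4) AE_space fwd.AE_no_left_slope bwd.AE_no_left_slope
      fwd.AE_jump_not_below_parabola bwd.AE_jump_not_below_parabola
      fwd.AE_jump_no_parabolic_return bwd.AE_jump_no_parabolic_return
  proof eventually_elim
    case (elim \<omega>)
    define f where "f = psi0 \<omega>"
    have f: "cadlag f" "hypA f" using elim cadlag by (auto simp: f_def)
    note left = cadlag_left[OF f(1)] and right = cadlag_right[OF f(1)]
    \<comment> \<open>Approaching \<open>- y\<close> from the left in reversed time is approaching
      \<open>y\<close> from the right, so \<open>f y\<close> and \<open>left_lim f y\<close>
      exchange their roles.\<close>
    have rleft: "((\<lambda>t. f (0 - t)) \<longlongrightarrow> f y) (at_left (- y))" for y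
      using right[of y] by (simp add: at_left_minus filterlim_filtermap)
    have rright: "((\<lambda>t. f (0 - t)) \<longlongrightarrow> left_lim f y) (at_right (- y))" for y
      using left[of y] by (simp add: at_right_minus filterlim_filtermap)
    interpret generic_path f
    proof
      show "\<not> (\<forall>z\<in>{y-e..<y}. f z \<le> left_lim f y - c * (y - z))" if "c > 0" "e > 0" for y c e
        using elim(3) left[of y] that unfolding f_def by blast
      show "\<not> (\<forall>z\<in>{y<..y+e}. f z \<le> f y - c * (z - y))" if "c > 0" "e > 0" for y c e
      proof
        assume *: "\<forall>z\<in>{y<..y+e}. f z \<le> f y - c * (z - y)"
        have "\<forall>z\<in>{- y - e..<- y}. f (0 - z) \<le> f y - c * (- y - z)"
        proof
          fix z assume "z \<in> {- y - e..<- y}"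
          then have "f (- z) \<le> f y - c * (- z - y)" by (intro *[rule_format]) auto
          then show "f (0 - z) \<le> f y - c * (- y - z)" by (simp add: algebra_simps)
        qed
        then show False using elim(4) rleft[of y] that unfolding f_def by blast
      qed
      show "\<not> (\<forall>h\<in>{0<..<e}. f (y + h) \<le> f y + h\<^sup>2 / 2)" if "f y \<noteq> left_lim f y" "e > 0" for y e
        using elim(5) left[of y] right[of y] that unfolding f_def by metis
      show "\<not> (\<forall>h\<in>{0<..<e}. f (y - h) \<le> left_lim f y + h\<^sup>2 / 2)" if "f y \<noteq> left_lim f y" "e > 0" for y e
        using elim(6)[folded f_def, rule_format, OF rleft rright that] by simp
      show "\<not> (\<forall>t>s. f t \<le> f y + (t - y)\<^sup>2 / 2)"
        if "s < y" "f s < left_lim f s" "isCont f y" "f y = left_lim f s - (y - s)\<^sup>2 / 2" for s y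
        by (rule elim(7)[folded f_def, rule_format, OF that(1) left right that(2-4)])
      show "\<not> (\<forall>t<s. f t \<le> f y + (t - y)\<^sup>2 / 2)"
        if "y < s" "left_lim f s < f s" "isCont f y" "f y = f s - (s - y)\<^sup>2 / 2" for s y
      proof
        assume *: "\<forall>t<s. f t \<le> f y + (t - y)\<^sup>2 / 2"
        \<comment> \<open>In reversed time the upward jump at \<open>s\<close> is a downward jump at
          \<open>- s\<close>, and the return happens at \<open>- y\<close>.\<close>
        have 1: "- s < - y" using that by simp
        have 2: "isCont (\<lambda>t. f (0 - t)) (- y)"
          by (rule isCont_o2[where f="\<lambda>t. 0 - t"]) (use that in auto)
        have 3: "f (0 - - y) = f s - (- y - - s)\<^sup>2 / 2" using that by simp
        have "\<forall>t>- s. f (0 - t) \<le> f (0 - - y) + (t - - y)\<^sup>2 / 2"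
        proof (intro allI impI)
          fix t assume "t > - s"
          then have "f (- t) \<le> f y + (- t - y)\<^sup>2 / 2" by (intro *[rule_format]) simp
          moreover have "(- t - y)\<^sup>2 = (t - - y)\<^sup>2" by (simp add: power2_eq_square algebra_simps)
          ultimately show "f (0 - t) \<le> f (0 - - y) + (t - - y)\<^sup>2 / 2" by simp
        qed
        then show False
          using elim(8)[folded f_def, rule_format, OF 1 rleft rright that(2) 2 3] by blast
      qed
    qed (rule f)+
    show ?case using fixed_iff_regular calA0_eq by (simp add: f_def)
  qed
qed

end
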